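(* Let $f\in\mathbb{T}$ be a univariate trace polynomial. Then the following are equivalent: (1) $f(X)\succeq 0$ for every $n\in\mathbb{N}$ and every $X\in S_n(\mathbb{R})$; (2) $f$ is a quotient of sums of products of squares and traces of squares of trace polynomials, i.e. there exist $r,q\in Q_0$ with $q\neq 0$ such that $f=r/q$ in the field of fractions of $\mathbb{T}$ (equivalently, $qf=r$), where $Q_0\subset\mathbb{T}$ denotes the set of all finite sums of finite products whose factors are each of the form $g^2$ or $\operatorname{Tr}(g^2)$ with $g\in\mathbb{T}$.
   Context: $\mathbb{N}=\{1,2,\dots\}$. Let $\mathbf{T}=\mathbb{R}[\operatorname{Tr}(x^j): j\in\mathbb{N}]$ be the commutative polynomial ring in countably many independent symbols $\operatorname{Tr}(x^j)$ (pure trace polynomials), and let $\mathbb{T}=\mathbf{T}\otimes\mathbb{R}[x]=\mathbf{T}[x]$ be the polynomial ring obtained by adjoining one more variable $x$ (trace polynomials). Let $\operatorname{Tr}:\mathbb{T}\to\mathbf{T}$ be the unital $\mathbf{T}$-linear map with $x^j\mapsto \operatorname{Tr}(x^j)$ for $j\in\mathbb{N}$ (so $\operatorname{Tr}(1)=1$). $S_n(\mathbb{R})$ is the space of real symmetric $n\times n$ matrices. For $f\in\mathbb{T}$ and $X\in S_n(\mathbb{R})$, the evaluation $f(X)\in S_n(\mathbb{R})$ is obtained by replacing $x$ by $X$ and each symbol $\operatorname{Tr}(x^j)$ by the normalized trace $\frac1n\operatorname{tr}(X^j)$ (times the identity $I_n$). $\succeq 0$ means positive semidefinite. *)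

theory Defs
  imports
    "HOL-Library.Poly_Mapping"
    "HOL-Computational_Algebra.Polynomial"
    "HOL-Computational_Algebra.Fraction_Field"
    "Jordan_Normal_Form.Matrix"
begin

section \<open>Trace polynomials\<close>

text \<open>
  The ring of pure trace polynomials is the monoid algebra over the reals of the finitely
  supported exponent vectors \<open>nat \<Rightarrow>\<^sub>0 nat\<close>. The index \<open>i\<close> of an exponent vector stands for the
  symbol \<open>Tr(x^(i+1))\<close>, so that exactly the powers \<open>x^j\<close> with \<open>j \<ge> 1\<close> have a symbol.
\<close>

type_synonym pure_trace_poly = "(nat \<Rightarrow>\<^sub>0 nat) \<Rightarrow>\<^sub>0 real"

type_synonym trace_poly = "pure_trace_poly poly"

text \<open>\<open>Tr_sym j\<close> is \<open>Tr(x^j)\<close>, with the convention \<open>Tr(x^0) = Tr(1) = 1\<close>.\<close>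

definition Tr_sym :: "nat \<Rightarrow> pure_trace_poly" where
  "Tr_sym j = (if j = 0 then 1 else Poly_Mapping.single (Poly_Mapping.single (j - 1) 1) 1)"

definition Tr :: "trace_poly \<Rightarrow> pure_trace_poly" where
  "Tr f = (\<Sum>j\<le>Polynomial.degree f. Polynomial.coeff f j * Tr_sym j)"

lemma Tr_eq_sum:
  assumes "Polynomial.degree f \<le> d"
  shows "Tr f = (\<Sum>j\<le>d. Polynomial.coeff f j * Tr_sym j)"
  unfolding Tr_def using assms
  by (intro sum.mono_neutral_left) (auto simp: Polynomial.coeff_eq_0)

lemma Tr_add: "Tr (f + g) = Tr f + Tr g"
proof -
  define d where "d = max (Polynomial.degree f) (Polynomial.degree g)"
  have "Polynomial.degree f \<le> d" "Polynomial.degree g \<le> d" "Polynomial.degree (f + g) \<le> d"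
    unfolding d_def by (auto intro: Polynomial.degree_add_le)
  then show ?thesis
    by (simp add: Tr_eq_sum[of _ d] distrib_right sum.distrib)
qed

lemma Tr_smult: "Tr (Polynomial.smult c f) = c * Tr f"
  by (simp add: Tr_eq_sum[OF Polynomial.degree_smult_le] Tr_def sum_distrib_left mult.assoc)

lemma Tr_monom: "Tr (Polynomial.monom 1 j) = Tr_sym j"
  by (simp add: Tr_def Polynomial.degree_monom_eq if_distrib[of "\<lambda>a. a * _"] cong: if_cong)

lemma Tr_1: "Tr 1 = 1"
  using Tr_monom[of 0] by (simp add: Tr_sym_def)


section \<open>Evaluation at symmetric matrices\<close>

definition normalized_trace :: "real mat \<Rightarrow> real" where
  "normalized_trace A = (\<Sum>i<dim_row A. A $$ (i, i)) / real (dim_row A)"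

definition eval_pure :: "pure_trace_poly \<Rightarrow> real mat \<Rightarrow> real" where
  "eval_pure p X =
     (\<Sum>m\<in>Poly_Mapping.keys p. Poly_Mapping.lookup p m *
        (\<Prod>i\<in>Poly_Mapping.keys m. normalized_trace (X ^\<^sub>m (i + 1)) ^ Poly_Mapping.lookup m i))"

text \<open>
  The matrix sum of the \<open>eval_pure (coeff f j) X \<cdot>\<^sub>m X ^\<^sub>m j\<close> over \<open>j\<close>, written entrywise because
  the type of matrices of arbitrary dimensions has no zero element to sum from.
\<close>

definition eval_trace_poly :: "trace_poly \<Rightarrow> real mat \<Rightarrow> real mat" where
  "eval_trace_poly f X =
     mat (dim_row X) (dim_col X) (\<lambda>(k, l).
       \<Sum>j\<le>Polynomial.degree f. (eval_pure (Polynomial.coeff f j) X \<cdot>\<^sub>m (X ^\<^sub>m j)) $$ (k, l))"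

definition symmetric_mats :: "nat \<Rightarrow> real mat set" where
  "symmetric_mats n = {X \<in> carrier_mat n n. transpose_mat X = X}"

definition psd :: "nat \<Rightarrow> real mat \<Rightarrow> bool" where
  "psd n A \<longleftrightarrow> A \<in> symmetric_mats n \<and> (\<forall>v\<in>carrier_vec n. v \<bullet> (A *\<^sub>v v) \<ge> 0)"

lemma eval_pure_Tr_sym:
  assumes "j \<ge> 1"
  shows "eval_pure (Tr_sym j) X = normalized_trace (X ^\<^sub>m j)"
  using assms by (simp add: eval_pure_def Tr_sym_def)


section \<open>Sums of products of squares and traces of squares\<close>

definition squares_and_traces :: "trace_poly set" where
  "squares_and_traces = {g ^ 2 | g. True} \<union> {[:Tr (g ^ 2):] | g. True}"

text \<open>
  Empty sums and products add nothing, as \<open>0 = 0^2\<close> and \<open>1 = 1^2\<close>.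
\<close>

definition Q0 :: "trace_poly set" where
  "Q0 = {sum_list (map prod_list gss) | gss. \<forall>gs\<in>set gss. set gs \<subseteq> squares_and_traces}"

end

theory Submission
  imports Defs "HOL-Algebra.Algebraic_Closure_Type" "Jordan_Normal_Form.Char_Poly"
begin

text \<open>
  A trace polynomial sees a symmetric matrix only through an eigenvalue and through the moments of the
  uniform distribution on all eigenvalues. By the spectral theorem and by approximating weights by
  rational numbers, condition (1) therefore says that \<open>f(c; m\<^sub>1, m\<^sub>2, \<dots>) \<ge> 0\<close> whenever \<open>m\<close> is
  the moment sequence of a finitely supported probability measure on the real line and \<open>c\<close> is one of
  its atoms (\<open>nonneg_on_measures_if_psd\<close>, \<open>psd_if_nonneg_on_measures\<close>).

  At such a point \<open>Tr(g^2)\<close> takes the value \<open>\<integral> g^2 \<ge> 0\<close>, so the elements of \<open>Q0\<close> are nonnegative there.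
  If \<open>q f = r\<close> with \<open>q, r \<in> Q0\<close>, then \<open>f\<close> can only be negative where \<open>q\<close> vanishes; a small change of
  the measure avoids this, because power sums are algebraically independent (\<open>perturb\<close>). Hence (2)
  implies (1).

  The converse follows Artin's solution of Hilbert's seventeenth problem. The quotients of elements
  of \<open>Q0\<close> form a cone in the field of fractions. If \<open>f\<close> lies outside of it, Zorn's lemma gives a real
  closed field that contains the trace polynomials and in which \<open>f < 0\<close> and \<open>Tr(g^2) > 0\<close> for all
  \<open>g \<noteq> 0\<close> (\<open>maximal_cone_ivt\<close>). Finitely many sign conditions that hold in this field also hold at
  some real point \<open>(c; a\<^sub>1, a\<^sub>2, \<dots>)\<close> (\<open>artin_lang\<close>, \<open>real_point_with_model_signs\<close>). The real numbers
  \<open>a\<close> need not be moments of anything; but if \<open>Tr(g\<^sub>k^2)\<close> is among the conditions for the members \<open>g\<^sub>k\<close>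
  of a family of trace polynomials that is orthogonal for the form \<open>Tr(g h)\<close>, then the moment
  functional of \<open>a\<close> is positive definite up to the degrees that occur in \<open>f\<close>, and Gauss quadrature
  with a prescribed node (\<open>quadrature_with_node\<close>) replaces it by a measure with atom \<open>c\<close> at which \<open>f\<close>
  is negative.

  The transfer of sign conditions is the quantifier elimination of Cohen and Hormander in relative
  form: the order pattern of the roots of finitely many polynomials over a real closed field,
  together with all their signs, is determined by the signs of finitely many elements of the
  coefficient ring (\<open>sign_transfer\<close>).
\<close>

hide_const (open) UnivPoly.coeff UnivPoly.deg UnivPoly.monom Polynomials.degree Polynomials.lead_coeff
  Poly_Mapping.degree Coset.order Module.smult
no_notation Polynomials.var (\<open>X\<index>\<close>)

section \<open>Polynomials over real closed fields\<close>

text \<open>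
  The axiom is the intermediate value property of polynomials. It speaks of coefficient sequences
  because the type of polynomials over \<open>'a\<close> presupposes that \<open>'a\<close> is an instance of a type class.
\<close>

class real_closed_field = linordered_field +
  assumes ivt_sum: "a < b \<Longrightarrow> (\<Sum>k\<le>n. c k * a ^ k) < 0 \<Longrightarrow> 0 < (\<Sum>k\<le>n. c k * b ^ k)
    \<Longrightarrow> \<exists>x. a < x \<and> x < b \<and> (\<Sum>k\<le>n. c k * x ^ k) = 0"

lemma poly_ivt:
  fixes p :: "'a::real_closed_field poly"
  shows "a < b \<Longrightarrow> poly p a < 0 \<Longrightarrow> 0 < poly p b \<Longrightarrow> \<exists>x. a < x \<and> x < b \<and> poly p x = 0"
  using ivt_sum[of a b "coeff p" "degree p"] by (simp add: poly_altdef)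

lemma real_ivt_sum:
  fixes a b :: real
  assumes ab: "a < b" and fa: "(\<Sum>k\<le>n. c k * a ^ k) < 0" and fb: "0 < (\<Sum>k\<le>n. c k * b ^ k)"
  shows "\<exists>x. a < x \<and> x < b \<and> (\<Sum>k\<le>n. c k * x ^ k) = 0"
proof -
  define f where "f = (\<lambda>x. \<Sum>k\<le>n. c k * x ^ k)"
  have "continuous_on {a..b} f" unfolding f_def by (intro continuous_intros)
  moreover have f: "f a < 0" "0 < f b" using fa fb by (auto simp: f_def)
  ultimately have "\<exists>x\<ge>a. x \<le> b \<and> f x = 0"
    using ab by (intro IVT') auto
  then obtain x where "a \<le> x" "x \<le> b" "f x = 0" by blast
  with f have "a < x" "x < b" by (metis less_irrefl order_le_less)+
  with \<open>f x = 0\<close> show ?thesis unfolding f_def by blast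
qed

instance real :: real_closed_field
  by intro_classes (rule real_ivt_sum)

text \<open>
  The two arguments live in different ordered rings: signs are compared between a field and its
  specialisations.
\<close>

definition same_sign :: "'a::linordered_idom \<Rightarrow> 'b::linordered_idom \<Rightarrow> bool" where
  "same_sign a b \<longleftrightarrow> (a < 0 \<longleftrightarrow> b < 0) \<and> (0 < a \<longleftrightarrow> 0 < b)"

lemma same_sign_sym: "same_sign a b \<Longrightarrow> same_sign b a"
  by (auto simp: same_sign_def)

lemma same_sign_refl [simp]: "same_sign a a"
  by (auto simp: same_sign_def)

lemma same_sign_trans: "same_sign a b \<Longrightarrow> same_sign b c \<Longrightarrow> same_sign a c"
  by (auto simp: same_sign_def)

lemma same_sign_0 [simp]: "same_sign 0 b \<longleftrightarrow> b = 0" "same_sign a 0 \<longleftrightarrow> a = 0"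
  by (auto simp: same_sign_def)

lemma same_sign_eq_0: "same_sign a b \<Longrightarrow> a = 0 \<longleftrightarrow> b = 0"
  by (auto simp: same_sign_def)

lemma same_sign_uminus [simp]: "same_sign (- a) (- b) \<longleftrightarrow> same_sign a b"
  by (auto simp: same_sign_def)

lemma same_sign_mult:
  fixes a c :: "'a::linordered_idom"
  shows "same_sign a b \<Longrightarrow> same_sign c d \<Longrightarrow> same_sign (a * c) (b * d)"
  by (cases a "0::'a" rule: linorder_cases; cases c "0::'a" rule: linorder_cases)
    (simp_all add: same_sign_def zero_less_mult_iff mult_less_0_iff)

lemma same_sign_power:
  assumes "same_sign a b"
  shows "same_sign (a ^ n) (b ^ n)"
proof (induction n)
  case 0
  show ?case by (simp add: same_sign_def)
next
  case (Suc n)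
  then show ?case using same_sign_mult[OF assms Suc] by simp
qed

lemma same_sign_mult_cancel:
  fixes a c :: "'a::linordered_idom"
  assumes "same_sign (c * a) (d * b)" "same_sign c d" "c \<noteq> 0"
  shows "same_sign a b"
  using assms by (cases c "0::'a" rule: linorder_cases)
    (simp_all add: same_sign_def zero_less_mult_iff mult_less_0_iff)

lemma same_sign_diff_lessD:
  "same_sign (a - b) (c - d) \<Longrightarrow> a < b \<longleftrightarrow> c < d"
  "same_sign (a - b) (c - d) \<Longrightarrow> b < a \<longleftrightarrow> d < c"
  by (auto simp: same_sign_def)

lemma same_sign_diffI:
  "(a < b \<longleftrightarrow> c < d) \<Longrightarrow> (b < a \<longleftrightarrow> d < c) \<Longrightarrow> same_sign (a - b) (c - d)"
  by (auto simp: same_sign_def)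

lemma poly_root_between:
  fixes p :: "'a::real_closed_field poly"
  assumes "a < b" "poly p a * poly p b < 0"
  shows "\<exists>x. a < x \<and> x < b \<and> poly p x = 0"
proof (cases "poly p a < 0")
  case True
  then show ?thesis using assms poly_ivt[of a b p] by (auto simp: mult_less_0_iff)
next
  case False
  then show ?thesis using assms poly_ivt[of a b "- p"] by (auto simp: mult_less_0_iff)
qed

lemma poly_sign_const:
  fixes p :: "'a::real_closed_field poly"
  assumes "\<And>x. min a b \<le> x \<Longrightarrow> x \<le> max a b \<Longrightarrow> poly p x \<noteq> 0"
  shows "same_sign (poly p a) (poly p b)"
proof (rule ccontr)
  assume n: "\<not> same_sign (poly p a) (poly p b)"
  have "poly p a \<noteq> 0" "poly p b \<noteq> 0" using assms by auto
  with n have s: "poly p a * poly p b < 0" "poly p b * poly p a < 0"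
    by (auto simp: same_sign_def mult_less_0_iff)
  from n have "a \<noteq> b" by auto
  then consider "a < b" | "b < a" by fastforce
  then show False
  proof cases
    case 1
    from poly_root_between[OF 1 s(1)] show ?thesis using assms by (fastforce simp: min_def max_def)
  next
    case 2
    from poly_root_between[OF 2 s(2)] show ?thesis using assms by (fastforce simp: min_def max_def)
  qed
qed

text \<open>
  Between consecutive roots \<open>a\<close> and \<open>b\<close>, write \<open>p = (x - a)^m (x - b)^n q\<close>. The derivative is
  \<open>(x - a)^(m-1) (x - b)^(n-1)\<close> times a polynomial whose values at \<open>a\<close> and \<open>b\<close> are
  \<open>m (a - b) q(a)\<close> and \<open>n (b - a) q(b)\<close>; since \<open>q\<close> keeps its sign, these are opposite.
\<close>

lemma poly_rolle:
  fixes p :: "'a::real_closed_field poly"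
  assumes ab: "a < b" and pa: "poly p a = 0" and pb: "poly p b = 0"
  shows "\<exists>c. a < c \<and> c < b \<and> poly (pderiv p) c = 0"
proof (cases "p = 0")
  case True
  then show ?thesis using dense[OF ab] by auto
next
  case p0: False
  define R where "R = {x. a < x \<and> x \<le> b \<and> poly p x = 0}"
  have finR: "finite R" unfolding R_def by (rule finite_subset[OF _ poly_roots_finite[OF p0]]) auto
  \<comment> \<open>The next root after a.\<close>
  define e where "e = Min R"
  have bR: "b \<in> R" using ab pb by (auto simp: R_def)
  have "e \<in> R" unfolding e_def using finR bR by (intro Min_in) auto
  then have e: "a < e" "e \<le> b" "poly p e = 0" by (auto simp: R_def)
  have nor: "poly p x \<noteq> 0" if "a < x" "x < e" for x
  proof
    assume "poly p x = 0"
    then have "x \<in> R" using that e by (auto simp: R_def)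
    then have "e \<le> x" unfolding e_def using finR by simp
    then show False using that by simp
  qed
  define A B where "A = [:-a, 1:]" and "B = [:-e, 1:]"
  obtain p1 where p1: "p = A ^ order a p * p1" "\<not> A dvd p1"
    using order_decomp[OF p0, of a] by (auto simp: A_def)
  have "order a p \<noteq> 0" using pa p0 order_root by blast
  then obtain m where m: "order a p = Suc m" using not0_implies_Suc by blast
  have p1m: "p = A ^ Suc m * p1" using p1(1) unfolding m .
  have p10: "p1 \<noteq> 0" using p1m p0 by auto
  have p1a: "poly p1 a \<noteq> 0" using p1(2) by (auto simp: A_def poly_eq_0_iff_dvd)
  have "poly p1 e = 0" using e unfolding p1m by (simp add: A_def)
  then have "order e p1 \<noteq> 0" using p10 order_root by blast
  then obtain n where n: "order e p1 = Suc n" using not0_implies_Suc by blast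
  obtain q where q: "p1 = B ^ order e p1 * q" "\<not> B dvd q"
    using order_decomp[OF p10, of e] by (auto simp: B_def)
  have q1n: "p1 = B ^ Suc n * q" using q(1) unfolding n .
  have qe: "poly q e \<noteq> 0" using q(2) by (auto simp: B_def poly_eq_0_iff_dvd)
  have qa: "poly q a \<noteq> 0" using p1a unfolding q1n by auto
  have pq: "p = A ^ Suc m * (B ^ Suc n * q)" using p1m unfolding q1n .
  have qx: "poly q x \<noteq> 0" if "a \<le> x" "x \<le> e" for x
    using that qe qa nor[of x] unfolding pq by (cases "x = a"; cases "x = e") auto
  have qs: "same_sign (poly q a) (poly q e)"
    using e(1) by (intro poly_sign_const qx) (auto simp: min_def max_def)
  define h where "h = smult (of_nat (Suc m)) (B * q) + smult (of_nat (Suc n)) (A * q) + A * B * pderiv q"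
  have pAB: "poly A x = x - a" "poly B x = x - e" for x by (simp_all add: A_def B_def)
  have dA: "pderiv A = 1" "pderiv B = 1" by (simp_all add: A_def B_def pderiv_pCons)
  have dp: "pderiv p = A ^ m * B ^ n * h"
    unfolding pq pderiv_mult pderiv_power_Suc dA h_def
    by (simp add: algebra_simps del: of_nat_Suc)
  have ha: "poly h a = of_nat (Suc m) * (a - e) * poly q a"
    by (simp add: h_def pAB del: of_nat_Suc)
  have he: "poly h e = of_nat (Suc n) * (e - a) * poly q e"
    by (simp add: h_def pAB del: of_nat_Suc)
  have "poly h a * poly h e < 0"
    unfolding ha he using qs qa qe e(1)
    by (auto simp: same_sign_def mult_less_0_iff zero_less_mult_iff neq_iff simp del: of_nat_Suc)
  from poly_root_between[OF e(1) this] obtain c where "a < c" "c < e" "poly h c = 0" by blast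
  then show ?thesis using e unfolding dp by (intro exI[of _ c]) auto
qed

text \<open>
  Dividing by \<open>x - c\<close> leaves a polynomial without roots on the interval, whose sign is constant.
\<close>

lemma poly_simple_root_sign_change:
  fixes p :: "'a::real_closed_field poly"
  assumes "a < c" "c < b" "poly p c = 0" "poly (pderiv p) c \<noteq> 0"
    and nor: "\<And>x. a \<le> x \<Longrightarrow> x \<le> b \<Longrightarrow> poly p x = 0 \<Longrightarrow> x = c"
  shows "poly p a * poly p b < 0"
proof -
  obtain q where q: "p = [:-c, 1:] * q" using assms(3) by (auto simp: poly_eq_0_iff_dvd elim: dvdE)
  have "pderiv p = q + [:-c, 1:] * pderiv q"
    unfolding q pderiv_mult by (simp add: pderiv_pCons algebra_simps)
  then have qc: "poly q c \<noteq> 0" using assms(4) by simp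
  have "same_sign (poly q a) (poly q b)"
  proof (rule poly_sign_const)
    fix x assume "min a b \<le> x" "x \<le> max a b"
    then have "a \<le> x" "x \<le> b" using assms by auto
    then show "poly q x \<noteq> 0" using nor[of x] qc unfolding q by (cases "x = c") auto
  qed
  moreover have "poly q a \<noteq> 0" using nor[of a] assms(1,2) unfolding q by auto
  moreover have "poly p a = (a - c) * poly q a" "poly p b = (b - c) * poly q b"
    unfolding q by (auto simp: algebra_simps)
  ultimately show ?thesis using assms(1,2)
    by (auto simp: same_sign_def mult_less_0_iff zero_less_mult_iff neq_iff)
qed

text \<open>
  The lower bound \<open>e\<close> makes the induction on the coefficients work: \<open>a + x p(x) \<ge> a + x e\<close>
  eventually exceeds 1. Comparing growth by limits would fail in a non-archimedean field.
\<close>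

lemma poly_positive_at_top:
  fixes p :: "'a::linordered_field poly"
  assumes "0 < lead_coeff p"
  shows "\<exists>M e. 0 < e \<and> (\<forall>x\<ge>M. e \<le> poly p x)"
  using assms
proof (induction p)
  case 0
  then show ?case by simp
next
  case (pCons a p)
  show ?case
  proof (cases "p = 0")
    case True
    then show ?thesis using pCons.prems by (intro exI[of _ 0] exI[of _ a]) auto
  next
    case False
    then obtain M e where e: "0 < e" and M: "\<And>x. x \<ge> M \<Longrightarrow> e \<le> poly p x" using pCons by auto
    have "1 \<le> poly (pCons a p) x" if x: "x \<ge> max (max M 0) ((\<bar>a\<bar> + 1) / e)" for x
    proof -
      have "\<bar>a\<bar> + 1 \<le> x * e" using x e by (simp add: pos_divide_le_eq)
      also have "\<dots> \<le> x * poly p x" using x M[of x] by (intro mult_left_mono) auto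
      finally show ?thesis by simp
    qed
    then show ?thesis by (intro exI[of _ "max (max M 0) ((\<bar>a\<bar> + 1) / e)"] exI[of _ 1]) auto
  qed
qed

lemma poly_sign_at_top:
  fixes p :: "'a::linordered_field poly"
  shows "\<exists>M. \<forall>x\<ge>M. same_sign (poly p x) (lead_coeff p)"
proof -
  consider "0 < lead_coeff p" | "0 < lead_coeff (- p)" | "p = 0"
    by (metis lead_coeff_minus leading_coeff_0_iff neg_0_less_iff_less neqE)
  then show ?thesis
  proof cases
    case 1
    then show ?thesis using poly_positive_at_top[OF 1] by (force simp: same_sign_def)
  next
    case 2
    then show ?thesis using poly_positive_at_top[OF 2] by (force simp: same_sign_def)
  qed auto
qed

lemma poly_sign_at_bot:
  fixes p :: "'a::linordered_field poly"
  shows "\<exists>M. \<forall>x\<le>M. same_sign (poly p x) ((- 1) ^ degree p * lead_coeff p)"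
proof -
  have d: "lead_coeff (pcompose p [:0, -1:]) = (- 1) ^ degree p * lead_coeff p"
    using lead_coeff_comp[of "[:0, -1:]" p] by simp
  obtain M where M: "\<And>x. x \<ge> M \<Longrightarrow> same_sign (poly p (- x)) ((- 1) ^ degree p * lead_coeff p)"
    using poly_sign_at_top[of "pcompose p [:0, -1:]"] unfolding d by (auto simp: poly_pcompose)
  have "same_sign (poly p x) ((- 1) ^ degree p * lead_coeff p)" if "x \<le> - M" for x
    using M[of "- x"] that by simp
  then show ?thesis by blast
qed

lemma same_sign_lead_power:
  assumes "degree p = degree q" "same_sign (lead_coeff p) (lead_coeff q)"
  shows "same_sign ((- 1) ^ degree p * lead_coeff p) ((- 1) ^ degree q * lead_coeff q)"
proof -
  have "same_sign (- 1) (- 1)" by (simp add: same_sign_def)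
  from same_sign_mult[OF same_sign_power[OF this] assms(2), of "degree p"] show ?thesis
    unfolding assms(1) .
qed

lemma sign_above_roots:
  fixes p :: "'a::real_closed_field poly"
  assumes "\<And>r. x \<le> r \<Longrightarrow> poly p r \<noteq> 0"
  shows "same_sign (poly p x) (lead_coeff p)"
proof -
  obtain M where M: "\<And>y. y \<ge> M \<Longrightarrow> same_sign (poly p y) (lead_coeff p)"
    using poly_sign_at_top by blast
  have "same_sign (poly p x) (poly p (max x M))"
    by (rule poly_sign_const) (use assms in \<open>auto simp: min_def max_def split: if_splits\<close>)
  then show ?thesis using M[of "max x M"] same_sign_trans by (meson max.cobounded2)
qed

lemma sign_below_roots:
  fixes p :: "'a::real_closed_field poly"
  assumes "\<And>r. r \<le> x \<Longrightarrow> poly p r \<noteq> 0"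
  shows "same_sign (poly p x) ((- 1) ^ degree p * lead_coeff p)"
proof -
  obtain M where M: "\<And>y. y \<le> M \<Longrightarrow> same_sign (poly p y) ((- 1) ^ degree p * lead_coeff p)"
    using poly_sign_at_bot by blast
  have "same_sign (poly p x) (poly p (min x M))"
    by (rule poly_sign_const) (use assms in \<open>auto simp: min_def max_def split: if_splits\<close>)
  then show ?thesis using M[of "min x M"] same_sign_trans by (meson min.cobounded2)
qed

lemma adjacent_roots:
  fixes p :: "'a::linordered_field poly"
  assumes "p \<noteq> 0" "poly p x \<noteq> 0" "r \<le> x" "poly p r = 0" "x \<le> s" "poly p s = 0"
  obtains a b where "a < x" "x < b" "poly p a = 0" "poly p b = 0"
    "\<And>y. a < y \<Longrightarrow> y < b \<Longrightarrow> poly p y \<noteq> 0"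
proof -
  define L U where "L = {y. poly p y = 0 \<and> y < x}" and "U = {y. poly p y = 0 \<and> x < y}"
  have fin: "finite L" "finite U"
    unfolding L_def U_def by (rule finite_subset[OF _ poly_roots_finite[OF assms(1)]]; auto)+
  have "r \<noteq> x" "s \<noteq> x" using assms by auto
  then have "r \<in> L" "s \<in> U" using assms by (auto simp: L_def U_def)
  then have mem: "Max L \<in> L" "Min U \<in> U" using fin by (blast intro: Max_in Min_in)+
  have no: "poly p y \<noteq> 0" if "Max L < y" "y < Min U" for y
  proof
    assume "poly p y = 0"
    then have "y \<in> L \<or> y \<in> U" using assms(2) by (cases y x rule: linorder_cases) (auto simp: L_def U_def)
    then show False using fin that by (meson Max_ge Min_le leD)
  qed
  show ?thesis
  proof (rule that)
    show "Max L < x" "poly p (Max L) = 0" using mem(1) by (simp_all add: L_def)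
    show "x < Min U" "poly p (Min U) = 0" using mem(2) by (simp_all add: U_def)
  qed (use no in blast)
qed

section \<open>Sign diagrams\<close>

text \<open>
  A sign diagram relates two families of polynomials \<open>P\<close> and \<open>Q\<close> with the same index set over two
  ordered fields. It is a finite increasing matching \<open>T\<close> of all roots of the one family with all roots
  of the other, such that points in the same position relative to \<open>T\<close> give the same signs. A relation
  is used rather than a function because it makes the notion symmetric.
\<close>

definition root_set :: "('i \<Rightarrow> 'a::idom poly) \<Rightarrow> 'i set \<Rightarrow> 'a set" where
  "root_set P G = {z. \<exists>g\<in>G. P g \<noteq> 0 \<and> poly (P g) z = 0}"

definition matched :: "('a::linordered_field \<times> 'b::linordered_field) set \<Rightarrow> 'a \<Rightarrow> 'b \<Rightarrow> bool" where
  "matched T x y \<longleftrightarrow> (\<forall>(z, w)\<in>T. same_sign (x - z) (y - w))"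

definition diagram ::
  "'i set \<Rightarrow> ('i \<Rightarrow> 'a::linordered_field poly) \<Rightarrow> ('i \<Rightarrow> 'b::linordered_field poly) \<Rightarrow> ('a \<times> 'b) set \<Rightarrow> bool"
  where
  "diagram G P Q T \<longleftrightarrow>
     finite T \<and> (\<forall>(z, w)\<in>T. matched T z w) \<and> fst ` T = root_set P G \<and> snd ` T = root_set Q G \<and>
     (\<forall>x y. matched T x y \<longrightarrow> (\<forall>g\<in>G. same_sign (poly (P g) x) (poly (Q g) y)))"

lemma matchedD: "matched T x y \<Longrightarrow> (z, w) \<in> T \<Longrightarrow> same_sign (x - z) (y - w)"
  by (auto simp: matched_def)

lemma matched_subset: "matched T x y \<Longrightarrow> S \<subseteq> T \<Longrightarrow> matched S x y"
  by (auto simp: matched_def)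

lemma matched_converse [simp]: "matched (T\<inverse>) y x \<longleftrightarrow> matched T x y"
  unfolding matched_def by (auto intro: same_sign_sym)

lemma diagramD:
  assumes "diagram G P Q T"
  shows "finite T" "(z, w) \<in> T \<Longrightarrow> matched T z w" "fst ` T = root_set P G" "snd ` T = root_set Q G"
    "matched T x y \<Longrightarrow> g \<in> G \<Longrightarrow> same_sign (poly (P g) x) (poly (Q g) y)"
  using assms by (auto simp: diagram_def)

lemma diagram_converse:
  assumes "diagram G P Q T"
  shows "diagram G Q P (T\<inverse>)"
proof -
  note D = diagramD[OF assms]
  have "fst ` (T\<inverse>) = snd ` T" "snd ` (T\<inverse>) = fst ` T" by force+
  moreover have "same_sign (poly (Q g) y) (poly (P g) x)" if "matched (T\<inverse>) y x" "g \<in> G" for x y g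
    using D(5)[of x y g] that by (auto intro: same_sign_sym)
  moreover have "matched (T\<inverse>) w z" if "(w, z) \<in> T\<inverse>" for z w
    using D(2)[of z w] that by simp
  ultimately show ?thesis
    unfolding diagram_def using D(1,3,4) by auto
qed

lemma diagramI:
  assumes "finite T" "\<And>z w. (z, w) \<in> T \<Longrightarrow> matched T z w" "fst ` T = root_set P G" "snd ` T = root_set Q G"
    "\<And>x y g. matched T x y \<Longrightarrow> g \<in> G \<Longrightarrow> same_sign (poly (P g) x) (poly (Q g) y)"
  shows "diagram G P Q T"
  unfolding diagram_def using assms by blast

lemma between_finite_sets:
  fixes L U :: "'a::linordered_field set"
  assumes "finite L" "finite U" "\<And>l u. l \<in> L \<Longrightarrow> u \<in> U \<Longrightarrow> l < u"
  shows "\<exists>y. (\<forall>l\<in>L. l < y) \<and> (\<forall>u\<in>U. y < u)"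
proof (cases "L = {}"; cases "U = {}")
  assume "L = {}" "U \<noteq> {}"
  then show ?thesis using assms lt_ex[of "Min U"] by (auto simp: Min_gr_iff)
next
  assume "L \<noteq> {}" "U = {}"
  then show ?thesis using assms gt_ex[of "Max L"] by (auto simp: Max_less_iff)
next
  assume n: "L \<noteq> {}" "U \<noteq> {}"
  then have "Max L < Min U" using assms by (auto simp: Max_less_iff Min_gr_iff)
  from dense[OF this] show ?thesis using assms n by (auto simp: Max_less_iff Min_gr_iff)
qed auto

text \<open>
  As \<open>T\<close> is increasing, the partners of the points below \<open>x\<close> lie below the partners of the points above
  \<open>x\<close>, and an ordered field has an element between two finite sets in this position.
\<close>

lemma matched_exists:
  assumes "finite T" and mono: "\<And>z w. (z, w) \<in> T \<Longrightarrow> matched T z w"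
  shows "\<exists>y. matched T x y"
proof (cases "x \<in> fst ` T")
  case True
  then show ?thesis using mono by force
next
  case False
  define L U where "L = {w. \<exists>z. (z, w) \<in> T \<and> z < x}" and "U = {w. \<exists>z. (z, w) \<in> T \<and> x < z}"
  have "L \<subseteq> snd ` T" "U \<subseteq> snd ` T" by (force simp: L_def U_def)+
  then have fin: "finite L" "finite U" using assms(1) finite_subset by blast+
  have "l < u" if lu: "l \<in> L" "u \<in> U" for l u
  proof -
    from lu obtain z z' where z: "(z, l) \<in> T" "z < x" "(z', u) \<in> T" "x < z'"
      by (auto simp: L_def U_def)
    show ?thesis using same_sign_diff_lessD(1)[OF matchedD[OF mono[OF z(1)] z(3)]] z by auto
  qed
  from between_finite_sets[OF fin this] obtain y where
    y: "\<And>l. l \<in> L \<Longrightarrow> l < y" "\<And>u. u \<in> U \<Longrightarrow> y < u" by blast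
  have "same_sign (x - z) (y - w)" if zw: "(z, w) \<in> T" for z w
  proof -
    have "x \<noteq> z" using False zw by force
    then consider "z < x" | "x < z" by fastforce
    then show ?thesis
    proof cases
      case 1
      then have "w < y" using y zw by (auto simp: L_def)
      with 1 show ?thesis by (auto simp: same_sign_def)
    next
      case 2
      then have "y < w" using y zw by (auto simp: U_def)
      with 2 show ?thesis by (auto simp: same_sign_def)
    qed
  qed
  then show ?thesis unfolding matched_def by blast
qed

text \<open>
  Fewer polynomials have fewer roots, so the gaps become larger. A polynomial of the smaller family
  has none of its roots inside such a gap; hence its sign at a point agrees with its sign at another
  point of the gap that is in the right position for the full diagram.
\<close>

lemma diagram_restrict:
  fixes P :: "'i \<Rightarrow> 'a::real_closed_field poly" and Q :: "'i \<Rightarrow> 'b::real_closed_field poly"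
  assumes D: "diagram G P Q T" and sub: "G' \<subseteq> G" and zero: "\<And>g. g \<in> G' \<Longrightarrow> P g = 0 \<longleftrightarrow> Q g = 0"
  shows "diagram G' P Q {(z, w) \<in> T. z \<in> root_set P G'}"
proof -
  define S where "S = {(z, w) \<in> T. z \<in> root_set P G'}"
  note D' = diagramD[OF D]
  have ST: "S \<subseteq> T" by (auto simp: S_def)
  have iff: "z \<in> root_set P G' \<longleftrightarrow> w \<in> root_set Q G'" if zw: "(z, w) \<in> T" for z w
  proof -
    have "poly (P g) z = 0 \<longleftrightarrow> poly (Q g) w = 0" if "g \<in> G'" for g
      using D'(5)[OF D'(2)[OF zw]] that sub same_sign_eq_0 by blast
    then show ?thesis unfolding root_set_def using zero by blast
  qed
  have f: "fst ` S = root_set P G'"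
  proof -
    have "root_set P G' \<subseteq> fst ` T" unfolding D'(3) using sub by (auto simp: root_set_def)
    then show ?thesis unfolding S_def by force
  qed
  have s: "snd ` S = root_set Q G'"
  proof -
    have "root_set Q G' \<subseteq> snd ` T" unfolding D'(4) using sub by (auto simp: root_set_def)
    then show ?thesis unfolding S_def using iff by force
  qed
  have signs: "same_sign (poly (P g) x) (poly (Q g) y)" if xy: "matched S x y" and g: "g \<in> G'" for x y g
  proof -
    obtain v where v: "matched T x v" using matched_exists[OF D'(1,2)] by blast
    have "same_sign (poly (Q g) v) (poly (Q g) y)"
    proof (cases "v = y \<or> Q g = 0")
      case False
      show ?thesis
      proof (rule poly_sign_const, rule notI)
        fix r assume r: "min v y \<le> r" "r \<le> max v y" "poly (Q g) r = 0"
        then have "r \<in> snd ` S" using False g unfolding s by (auto simp: root_set_def)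
        then obtain z where z: "(z, r) \<in> S" by force
        have "same_sign (x - z) (y - r)" "same_sign (x - z) (v - r)"
          using matchedD[OF xy z] matchedD[OF v] z ST by auto
        then have "same_sign (v - r) (y - r)" using same_sign_trans same_sign_sym by blast
        then show False using r False
          by (auto simp: same_sign_def min_def max_def split: if_splits)
      qed
    qed auto
    moreover have "same_sign (poly (P g) x) (poly (Q g) v)" using D'(5)[OF v] g sub by blast
    ultimately show ?thesis using same_sign_trans by blast
  qed
  have "finite S" using finite_subset[OF ST D'(1)] .
  moreover have "matched S z w" if "(z, w) \<in> S" for z w
    using D'(2) matched_subset[OF _ ST] that ST by blast
  ultimately have "diagram G' P Q S" unfolding diagram_def using f s signs by auto
  then show ?thesis by (simp add: S_def)
qed

text \<open>
  The left neighbour of \<open>\<rho>\<close> among the matched points, with a point near minus infinity as a substitute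
  if there is none. For such a substitute the sign of \<open>u'\<close> is recorded so that a left and a right
  witness are always in the correct order.
\<close>

lemma diagram_left_witness:
  fixes p :: "'a::real_closed_field poly" and q :: "'b::real_closed_field poly"
  assumes D: "diagram G P Q T"
    and deg: "degree p = degree q" and lc: "same_sign (lead_coeff p) (lead_coeff q)"
    and atT: "\<And>z w. (z, w) \<in> T \<Longrightarrow> same_sign (poly p z) (poly q w)"
    and \<rho>: "\<rho> \<notin> fst ` T"
  shows "\<exists>u u'. u < \<rho> \<and> same_sign (poly p u) (poly q u') \<and> ((u, u') \<in> T \<or> u' < 0) \<and>
    (\<forall>(z, w)\<in>T. (z < \<rho> \<longrightarrow> z \<le> u \<and> w \<le> u') \<and> (\<rho> < z \<longrightarrow> u' < w))"
proof (cases "\<exists>z\<in>fst ` T. z < \<rho>")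
  case True
  note D' = diagramD[OF D]
  define L where "L = {z \<in> fst ` T. z < \<rho>}"
  have "finite L" "L \<noteq> {}" using D'(1) True by (auto simp: L_def)
  then have "Max L \<in> L" "\<And>z. z \<in> L \<Longrightarrow> z \<le> Max L" by auto
  note ext = this
  define u where "u = Max L"
  obtain u' where u': "(u, u') \<in> T" "u < \<rho>" using ext(1) by (force simp: L_def u_def)
  moreover have "z \<le> u" if "(z, w) \<in> T" "z < \<rho>" for z w
  proof -
    have "z \<in> fst ` T" using that(1) by force
    then show ?thesis using ext(2) that(2) unfolding u_def L_def by blast
  qed
  ultimately have u: "(u, u') \<in> T" "u < \<rho>" "\<And>z w. (z, w) \<in> T \<Longrightarrow> z < \<rho> \<Longrightarrow> z \<le> u" by blast+
  have "(z < \<rho> \<longrightarrow> z \<le> u \<and> w \<le> u') \<and> (\<rho> < z \<longrightarrow> u' < w)" if zw: "(z, w) \<in> T" for z w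
    using same_sign_diff_lessD[OF matchedD[OF D'(2)[OF u(1)] zw]] u zw
    by (meson leD leI order.strict_trans)
  then show ?thesis using u atT by blast
next
  case False
  note D' = diagramD[OF D]
  obtain M where M: "\<And>x. x \<le> M \<Longrightarrow> same_sign (poly p x) ((- 1) ^ degree p * lead_coeff p)"
    using poly_sign_at_bot by blast
  obtain N where N: "\<And>x. x \<le> N \<Longrightarrow> same_sign (poly q x) ((- 1) ^ degree q * lead_coeff q)"
    using poly_sign_at_bot by blast
  have "finite (insert 0 (insert N (snd ` T)))" using D'(1) by auto
  from between_finite_sets[of "{}", OF _ this] obtain u' where
    u': "u' < 0" "u' < N" "\<And>z w. (z, w) \<in> T \<Longrightarrow> u' < w" by force
  define u where "u = min M (\<rho> - 1)"
  have "same_sign ((- 1) ^ degree p * lead_coeff p) ((- 1) ^ degree q * lead_coeff q)"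
    using deg lc by (rule same_sign_lead_power)
  then have "same_sign (poly p u) (poly q u')"
    using M[of u] N[of u'] u' unfolding u_def
    by (meson less_imp_le min.cobounded1 same_sign_sym same_sign_trans)
  moreover have "u < \<rho>" unfolding u_def by (simp add: min_less_iff_disj)
  moreover have "(z < \<rho> \<longrightarrow> z \<le> u \<and> w \<le> u') \<and> (\<rho> < z \<longrightarrow> u' < w)" if zw: "(z, w) \<in> T" for z w
  proof -
    have "z \<in> fst ` T" using zw by force
    with False have "\<not> z < \<rho>" by blast
    with u'(3)[OF zw] show ?thesis by simp
  qed
  ultimately show ?thesis using u'(1) by blast
qed

lemma diagram_right_witness:
  fixes p :: "'a::real_closed_field poly" and q :: "'b::real_closed_field poly"
  assumes D: "diagram G P Q T"
    and lc: "same_sign (lead_coeff p) (lead_coeff q)"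
    and atT: "\<And>z w. (z, w) \<in> T \<Longrightarrow> same_sign (poly p z) (poly q w)"
    and \<rho>: "\<rho> \<notin> fst ` T"
  shows "\<exists>v v'. \<rho> < v \<and> same_sign (poly p v) (poly q v') \<and> ((v, v') \<in> T \<or> 0 < v') \<and>
    (\<forall>(z, w)\<in>T. (\<rho> < z \<longrightarrow> v \<le> z \<and> v' \<le> w) \<and> (z < \<rho> \<longrightarrow> w < v'))"
proof (cases "\<exists>z\<in>fst ` T. \<rho> < z")
  case True
  note D' = diagramD[OF D]
  define L where "L = {z \<in> fst ` T. \<rho> < z}"
  have "finite L" "L \<noteq> {}" using D'(1) True by (auto simp: L_def)
  then have "Min L \<in> L" "\<And>z. z \<in> L \<Longrightarrow> Min L \<le> z" by auto
  note ext = this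
  define v where "v = Min L"
  obtain v' where v': "(v, v') \<in> T" "\<rho> < v" using ext(1) by (force simp: L_def v_def)
  moreover have "v \<le> z" if "(z, w) \<in> T" "\<rho> < z" for z w
  proof -
    have "z \<in> fst ` T" using that(1) by force
    then show ?thesis using ext(2) that(2) unfolding v_def L_def by blast
  qed
  ultimately have v: "(v, v') \<in> T" "\<rho> < v" "\<And>z w. (z, w) \<in> T \<Longrightarrow> \<rho> < z \<Longrightarrow> v \<le> z" by blast+
  have "(\<rho> < z \<longrightarrow> v \<le> z \<and> v' \<le> w) \<and> (z < \<rho> \<longrightarrow> w < v')" if zw: "(z, w) \<in> T" for z w
    using same_sign_diff_lessD[OF matchedD[OF D'(2)[OF v(1)] zw]] v zw
    by (meson leD leI order.strict_trans)
  then show ?thesis using v atT by blast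
next
  case False
  note D' = diagramD[OF D]
  obtain M where M: "\<And>x. x \<ge> M \<Longrightarrow> same_sign (poly p x) (lead_coeff p)"
    using poly_sign_at_top by blast
  obtain N where N: "\<And>x. x \<ge> N \<Longrightarrow> same_sign (poly q x) (lead_coeff q)"
    using poly_sign_at_top by blast
  have "finite (insert 0 (insert N (snd ` T)))" using D'(1) by auto
  from between_finite_sets[of _ "{}", OF this] obtain v' where
    v': "0 < v'" "N < v'" "\<And>z w. (z, w) \<in> T \<Longrightarrow> w < v'" by force
  define v where "v = max M (\<rho> + 1)"
  have "same_sign (poly p v) (poly q v')"
    using M[of v] N[of v'] v' lc unfolding v_def
    by (meson less_imp_le max.cobounded1 same_sign_sym same_sign_trans)
  moreover have "\<rho> < v" unfolding v_def by (simp add: less_max_iff_disj)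
  moreover have "(\<rho> < z \<longrightarrow> v \<le> z \<and> v' \<le> w) \<and> (z < \<rho> \<longrightarrow> w < v')" if zw: "(z, w) \<in> T" for z w
  proof -
    have "z \<in> fst ` T" using zw by force
    with False have "\<not> \<rho> < z" by blast
    with v'(3)[OF zw] show ?thesis by simp
  qed
  ultimately show ?thesis using v'(1) by blast
qed

text \<open>
  Adding a polynomial \<open>p\<close> whose derivative is already in the diagram. A root \<open>\<rho>\<close> of \<open>p\<close> inside a gap is
  simple, and it is the only root of \<open>p\<close> in the closed gap by Rolle's theorem. So \<open>p\<close> changes sign from
  one end of the gap to the other; the signs at the ends are shared with \<open>q\<close>, which therefore has a
  root in the corresponding gap.
\<close>

lemma diagram_root_partner:
  fixes P :: "'i \<Rightarrow> 'a::real_closed_field poly" and Q :: "'i \<Rightarrow> 'b::real_closed_field poly"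
  assumes D: "diagram G P Q T" and e: "e \<in> G" "P e = pderiv p" "Q e = pderiv q"
    and deg: "degree p = degree q" "degree p > 0" and lc: "same_sign (lead_coeff p) (lead_coeff q)"
    and atT: "\<And>z w. (z, w) \<in> T \<Longrightarrow> same_sign (poly p z) (poly q w)"
    and root: "poly p \<rho> = 0"
  shows "\<exists>\<eta>. poly q \<eta> = 0 \<and> matched T \<rho> \<eta>"
proof (cases "\<rho> \<in> fst ` T")
  case True
  then obtain w where w: "(\<rho>, w) \<in> T" by force
  then have "poly q w = 0" using atT[OF w] root by simp
  then show ?thesis using diagramD(2)[OF D w] by blast
next
  case False
  note D' = diagramD[OF D]
  obtain u u' where u: "u < \<rho>" "same_sign (poly p u) (poly q u')" "(u, u') \<in> T \<or> u' < 0"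
    and uT: "\<And>z w. (z, w) \<in> T \<Longrightarrow> (z < \<rho> \<longrightarrow> z \<le> u \<and> w \<le> u') \<and> (\<rho> < z \<longrightarrow> u' < w)"
    using diagram_left_witness[OF D deg(1) lc atT False] by blast
  obtain v v' where v: "\<rho> < v" "same_sign (poly p v) (poly q v')" "(v, v') \<in> T \<or> 0 < v'"
    and vT: "\<And>z w. (z, w) \<in> T \<Longrightarrow> (\<rho> < z \<longrightarrow> v \<le> z \<and> v' \<le> w) \<and> (z < \<rho> \<longrightarrow> w < v')"
    using diagram_right_witness[OF D lc atT False] by blast
  have uv': "u' < v'" using u v uT vT by fastforce
  have pd: "pderiv p \<noteq> 0" using deg(2) by (simp add: pderiv_eq_0_iff)
  have crit: "\<exists>w. (c, w) \<in> T" if "poly (pderiv p) c = 0" for c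
  proof -
    have "c \<in> root_set P G" using that pd e by (auto simp: root_set_def intro!: bexI[of _ e])
    then show ?thesis unfolding D'(3)[symmetric] by force
  qed
  have "x = \<rho>" if x: "u \<le> x" "x \<le> v" "poly p x = 0" for x
  proof (rule ccontr)
    assume "x \<noteq> \<rho>"
    then consider "x < \<rho>" | "\<rho> < x" by fastforce
    then show False
    proof cases
      case 1
      from poly_rolle[OF 1 x(3) root] obtain c where "x < c" "c < \<rho>" "poly (pderiv p) c = 0" by blast
      then show ?thesis using crit[of c] uT x by fastforce
    next
      case 2
      from poly_rolle[OF 2 root x(3)] obtain c where "\<rho> < c" "c < x" "poly (pderiv p) c = 0" by blast
      then show ?thesis using crit[of c] vT x by fastforce
    qed
  qed
  moreover have "poly (pderiv p) \<rho> \<noteq> 0" using crit[of \<rho>] False by force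
  ultimately have "poly p u * poly p v < 0"
    using poly_simple_root_sign_change[OF u(1) v(1) root] by blast
  then have "poly q u' * poly q v' < 0"
    using same_sign_mult[OF u(2) v(2)] by (simp add: same_sign_def)
  from poly_root_between[OF uv' this] obtain \<eta> where \<eta>: "u' < \<eta>" "\<eta> < v'" "poly q \<eta> = 0" by blast
  have "same_sign (\<rho> - z) (\<eta> - w)" if zw: "(z, w) \<in> T" for z w
  proof -
    have "z \<noteq> \<rho>" using zw False by force
    then consider "z < \<rho>" | "\<rho> < z" by fastforce
    then show ?thesis
    proof cases
      case 1
      then have "w < \<eta>" using uT[OF zw] \<eta> by auto
      with 1 show ?thesis by (simp add: same_sign_def)
    next
      case 2
      then have "\<eta> < w" using vT[OF zw] \<eta> by auto
      with 2 show ?thesis by (simp add: same_sign_def)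
    qed
  qed
  then show ?thesis using \<eta> unfolding matched_def by blast
qed

text \<open>
  The new matching adds all pairs of roots of \<open>p\<close> and \<open>q\<close> in the same gap. It is increasing since
  between two roots there is a root of the derivative, which is already matched. For the signs at \<open>x\<close>
  and \<open>y\<close>: if \<open>x\<close> lies between two adjacent roots of \<open>p\<close>, then there is a root \<open>c\<close> of the derivative
  between them, at which the sign of \<open>p\<close> agrees with the sign of \<open>q\<close> at the partner of \<open>c\<close>; otherwise
  the leading coefficients decide.
\<close>

lemma diagram_insert:
  fixes P :: "'i \<Rightarrow> 'a::real_closed_field poly" and Q :: "'i \<Rightarrow> 'b::real_closed_field poly"
  assumes D: "diagram G P Q T" and e: "e \<in> G" "P e = pderiv (P i)" "Q e = pderiv (Q i)"
    and deg: "degree (P i) = degree (Q i)" "degree (P i) > 0"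
    and lc: "same_sign (lead_coeff (P i)) (lead_coeff (Q i))"
    and atT: "\<And>z w. (z, w) \<in> T \<Longrightarrow> same_sign (poly (P i) z) (poly (Q i) w)"
  shows "\<exists>T'. diagram (insert i G) P Q T'"
proof -
  define p q where "p = P i" and "q = Q i"
  note D' = diagramD[OF D]
  have p0: "p \<noteq> 0" "q \<noteq> 0" using deg by (auto simp: p_def q_def)
  have pd: "pderiv p \<noteq> 0" "pderiv q \<noteq> 0" using deg by (auto simp: pderiv_eq_0_iff p_def q_def)
  have part1: "\<exists>\<eta>. poly q \<eta> = 0 \<and> matched T \<rho> \<eta>" if "poly p \<rho> = 0" for \<rho>
    using diagram_root_partner[OF D e deg lc atT] that unfolding p_def q_def by blast
  have part2: "\<exists>\<rho>. poly p \<rho> = 0 \<and> matched T \<rho> \<eta>" if r: "poly q \<eta> = 0" for \<eta>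
  proof -
    have "\<exists>\<rho>. poly (P i) \<rho> = 0 \<and> matched (T\<inverse>) \<eta> \<rho>"
      by (rule diagram_root_partner[OF diagram_converse[OF D] e(1,3,2)])
        (use deg lc atT r same_sign_sym in \<open>auto simp: q_def\<close>)
    then show ?thesis by (simp add: p_def)
  qed
  have crit1: "\<exists>w. (c, w) \<in> T" if "poly (pderiv p) c = 0" for c
  proof -
    have "c \<in> root_set P G" using that pd e by (auto simp: root_set_def p_def intro!: bexI[of _ e])
    then show ?thesis unfolding D'(3)[symmetric] by force
  qed
  have crit2: "\<exists>z. (z, c) \<in> T" if "poly (pderiv q) c = 0" for c
  proof -
    have "c \<in> root_set Q G" using that pd e by (auto simp: root_set_def q_def intro!: bexI[of _ e])
    then show ?thesis unfolding D'(4)[symmetric] by force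
  qed
  define N where "N = {(\<rho>, \<eta>). poly p \<rho> = 0 \<and> poly q \<eta> = 0 \<and> matched T \<rho> \<eta>}"
  define T' where "T' = T \<union> N"
  have mT: "matched T z w" if "(z, w) \<in> T'" for z w
    using that D'(2) by (auto simp: T'_def N_def)
  have atT': "same_sign (poly p z) (poly q w)" if "(z, w) \<in> T'" for z w
    using that atT by (auto simp: T'_def N_def p_def q_def)
  have less1: "\<eta> < \<eta>'" if n: "(\<rho>, \<eta>) \<in> N" "(\<rho>', \<eta>') \<in> N" "\<rho> < \<rho>'" for \<rho> \<eta> \<rho>' \<eta>'
  proof -
    obtain c where c: "\<rho> < c" "c < \<rho>'" "poly (pderiv p) c = 0"
      using poly_rolle[OF n(3)] n by (auto simp: N_def)
    obtain w where w: "(c, w) \<in> T" using crit1 c by blast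
    have "same_sign (\<rho> - c) (\<eta> - w)" "same_sign (\<rho>' - c) (\<eta>' - w)"
      using matchedD[OF _ w] n by (auto simp: N_def)
    then have "\<eta> < w" "w < \<eta>'" using c by (auto simp: same_sign_def)
    then show ?thesis by simp
  qed
  have less2: "\<rho> < \<rho>'" if n: "(\<rho>, \<eta>) \<in> N" "(\<rho>', \<eta>') \<in> N" "\<eta> < \<eta>'" for \<rho> \<eta> \<rho>' \<eta>'
  proof -
    obtain w where c: "\<eta> < w" "w < \<eta>'" "poly (pderiv q) w = 0"
      using poly_rolle[OF n(3)] n by (auto simp: N_def)
    obtain c where w: "(c, w) \<in> T" using crit2 c by blast
    have "same_sign (\<rho> - c) (\<eta> - w)" "same_sign (\<rho>' - c) (\<eta>' - w)"
      using matchedD[OF _ w] n by (auto simp: N_def)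
    then have "\<rho> < c" "c < \<rho>'" using c by (auto simp: same_sign_def)
    then show ?thesis by simp
  qed
  have mono: "matched T' z w" if zw: "(z, w) \<in> T'" for z w
    unfolding matched_def
  proof clarify
    fix a b assume ab: "(a, b) \<in> T'"
    consider "(a, b) \<in> T" | "(z, w) \<in> T" | "(a, b) \<in> N" "(z, w) \<in> N"
      using ab zw by (auto simp: T'_def)
    then show "same_sign (z - a) (w - b)"
    proof cases
      case 1
      then show ?thesis using matchedD[OF mT[OF zw]] by blast
    next
      case 2
      then have "same_sign (- (a - z)) (- (b - w))"
        unfolding same_sign_uminus using matchedD[OF mT[OF ab]] by blast
      then show ?thesis by simp
    next
      case 3
      then show ?thesis
        by (intro same_sign_diffI) (blast intro: less1 less2)+
    qed
  qed
  have roots: "root_set P (insert i G) = root_set P G \<union> {x. poly p x = 0}"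
    "root_set Q (insert i G) = root_set Q G \<union> {x. poly q x = 0}"
    using p0 by (auto simp: root_set_def p_def q_def)
  have f: "fst ` T' = root_set P (insert i G)"
  proof -
    have "{x. poly p x = 0} = fst ` N" using part1 by (force simp: N_def)
    then show ?thesis unfolding roots T'_def image_Un D'(3) by simp
  qed
  have s: "snd ` T' = root_set Q (insert i G)"
  proof -
    have "{x. poly q x = 0} = snd ` N" using part2 by (force simp: N_def)
    then show ?thesis unfolding roots T'_def image_Un D'(4) by simp
  qed
  have "finite N"
    by (rule finite_subset[OF _ finite_cartesian_product[OF poly_roots_finite[OF p0(1)] poly_roots_finite[OF p0(2)]]])
      (auto simp: N_def)
  then have fin: "finite T'" using D'(1) by (simp add: T'_def)
  have signs: "same_sign (poly p x) (poly q y)" if xy: "matched T' x y" for x y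
  proof -
    have xyT: "matched T x y" using matched_subset[OF xy] by (simp add: T'_def)
    have P1: "\<exists>\<eta>. poly q \<eta> = 0 \<and> (\<rho>, \<eta>) \<in> T'" if "poly p \<rho> = 0" for \<rho>
      using part1[OF that] that by (auto simp: T'_def N_def)
    have P2: "\<exists>\<rho>. poly p \<rho> = 0 \<and> (\<rho>, \<eta>) \<in> T'" if "poly q \<eta> = 0" for \<eta>
      using part2[OF that] that by (auto simp: T'_def N_def)
    consider "poly p x = 0" | "poly q y = 0" | "poly p x \<noteq> 0" "poly q y \<noteq> 0" by blast
    then show ?thesis
    proof cases
      case 1
      then obtain \<eta> where "poly q \<eta> = 0" "(x, \<eta>) \<in> T'" using P1 by blast
      then show ?thesis using matchedD[OF xy, of x \<eta>] 1 by simp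
    next
      case 2
      then obtain \<rho> where "poly p \<rho> = 0" "(\<rho>, y) \<in> T'" using P2 by blast
      then show ?thesis using matchedD[OF xy, of \<rho> y] 2 by simp
    next
      case 3
      have above: ?thesis if no: "\<And>r. x \<le> r \<Longrightarrow> poly p r \<noteq> 0"
      proof -
        have "poly q r \<noteq> 0" if "y \<le> r" for r
        proof
          assume "poly q r = 0"
          then obtain z where "poly p z = 0" "(z, r) \<in> T'" using P2 by blast
          then show False using matchedD[OF xy, of z r] no[of z] that by (auto simp: same_sign_def)
        qed
        then show ?thesis using sign_above_roots[of x p] sign_above_roots[of y q] no lc
          unfolding p_def q_def by (meson same_sign_sym same_sign_trans)
      qed
      have below: ?thesis if no: "\<And>r. r \<le> x \<Longrightarrow> poly p r \<noteq> 0"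
      proof -
        have "poly q r \<noteq> 0" if "r \<le> y" for r
        proof
          assume "poly q r = 0"
          then obtain z where "poly p z = 0" "(z, r) \<in> T'" using P2 by blast
          then show False using matchedD[OF xy, of z r] no[of z] that by (auto simp: same_sign_def)
        qed
        then show ?thesis using sign_below_roots[of x p] sign_below_roots[of y q] no
            same_sign_lead_power[OF deg(1) lc]
          unfolding p_def q_def by (meson same_sign_sym same_sign_trans)
      qed
      show ?thesis
      proof (rule ccontr)
        assume neg: "\<not> ?thesis"
        obtain r s where "r \<le> x" "poly p r = 0" "x \<le> s" "poly p s = 0"
          using above below neg by blast
        from adjacent_roots[OF p0(1) 3(1) this] obtain a b where
          ab: "a < x" "x < b" "poly p a = 0" "poly p b = 0"
          and no: "\<And>y. a < y \<Longrightarrow> y < b \<Longrightarrow> poly p y \<noteq> 0" by blast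
        \<comment> \<open>The matched root c of the derivative carries the sign of p from x to the other field.\<close>
        obtain c where c: "a < c" "c < b" "poly (pderiv p) c = 0"
          using poly_rolle[of a b p] ab by auto
        obtain c' where c': "(c, c') \<in> T" using crit1[OF c(3)] by blast
        have s1: "same_sign (poly p x) (poly p c)"
          by (rule poly_sign_const) (use no ab c in \<open>auto simp: min_def max_def split: if_splits\<close>)
        have s2: "same_sign (poly p c) (poly q c')" using atT' c' by (auto simp: T'_def)
        have s3: "same_sign (poly q c') (poly q y)"
        proof (rule poly_sign_const, rule notI)
          fix t assume t: "min c' y \<le> t" "t \<le> max c' y" "poly q t = 0"
          obtain z where z: "poly p z = 0" "(z, t) \<in> T'" using P2[OF t(3)] by blast
          have "same_sign (x - z) (y - t)" using matchedD[OF xy z(2)] .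
          moreover have "same_sign (c - z) (c' - t)"
            using matchedD[OF mono z(2), of c c'] c' by (simp add: T'_def)
          ultimately have "min c x \<le> z" "z \<le> max c x"
            using t(1,2) by (auto simp: same_sign_def min_def max_def not_less split: if_splits)
          then have "a < z" "z < b" using c ab by (auto simp: min_def max_def split: if_splits)
          then show False using no z by blast
        qed
        show False using neg same_sign_trans[OF s1 same_sign_trans[OF s2 s3]] by blast
      qed
    qed
  qed
  have "same_sign (poly (P g) x) (poly (Q g) y)" if "matched T' x y" "g \<in> insert i G" for x y g
  proof (cases "g = i")
    case True
    then show ?thesis using signs[OF that(1)] by (simp add: p_def q_def)
  next
    case False
    have "matched T x y" using matched_subset[OF that(1)] by (simp add: T'_def)
    with D'(5) that(2) False show ?thesis by blast
  qed
  moreover have "\<forall>(z, w)\<in>T'. matched T' z w" using mono by (intro ballI case_prodI2) simp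
  ultimately have "diagram (insert i G) P Q T'"
    unfolding diagram_def using fin f s by blast
  then show ?thesis by blast
qed

section \<open>Transfer of sign conditions\<close>

text \<open>
  The elements whose signs control a diagram are kept in a subring of the coefficient ring. In the
  induction on the number of variables this is the ring of polynomials in the variables that have
  already been specialised.
\<close>

definition subring_set :: "'a::comm_ring_1 set \<Rightarrow> bool" where
  "subring_set S \<longleftrightarrow> 1 \<in> S \<and> (\<forall>x\<in>S. \<forall>y\<in>S. x - y \<in> S \<and> x * y \<in> S)"

definition polys_over :: "'a::comm_ring_1 set \<Rightarrow> 'a poly set" where
  "polys_over S = {p. \<forall>n. coeff p n \<in> S}"

lemma subring_setD:
  assumes "subring_set S"
  shows "1 \<in> S" "0 \<in> S" "x \<in> S \<Longrightarrow> y \<in> S \<Longrightarrow> x - y \<in> S" "x \<in> S \<Longrightarrow> - x \<in> S"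
    "x \<in> S \<Longrightarrow> y \<in> S \<Longrightarrow> x + y \<in> S" "x \<in> S \<Longrightarrow> y \<in> S \<Longrightarrow> x * y \<in> S"
proof -
  have d: "x - y \<in> S" if "x \<in> S" "y \<in> S" for x y using assms that by (auto simp: subring_set_def)
  show 1: "1 \<in> S" using assms by (auto simp: subring_set_def)
  show 0: "0 \<in> S" using d[OF 1 1] by simp
  have m: "- x \<in> S" if "x \<in> S" for x using d[OF 0 that] by simp
  show "x \<in> S \<Longrightarrow> - x \<in> S" by (rule m)
  show "x \<in> S \<Longrightarrow> y \<in> S \<Longrightarrow> x - y \<in> S" by (rule d)
  show "x \<in> S \<Longrightarrow> y \<in> S \<Longrightarrow> x + y \<in> S" using d[of x "- y"] m by simp
  show "x \<in> S \<Longrightarrow> y \<in> S \<Longrightarrow> x * y \<in> S" using assms by (auto simp: subring_set_def)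
qed

lemma subring_set_sum:
  assumes "subring_set S" "\<And>i. i \<in> A \<Longrightarrow> f i \<in> S"
  shows "sum f A \<in> S"
  using assms(2) by (induction A rule: infinite_finite_induct)
    (auto intro: subring_setD[OF assms(1)])

lemma subring_set_of_nat: "subring_set S \<Longrightarrow> of_nat n \<in> S"
  by (induction n) (auto intro: subring_setD)

lemma polys_overI: "(\<And>n. coeff p n \<in> S) \<Longrightarrow> p \<in> polys_over S"
  by (auto simp: polys_over_def)

lemma polys_overD: "p \<in> polys_over S \<Longrightarrow> coeff p n \<in> S"
  by (auto simp: polys_over_def)

lemma polys_over_diff: "subring_set S \<Longrightarrow> p \<in> polys_over S \<Longrightarrow> q \<in> polys_over S \<Longrightarrow> p - q \<in> polys_over S"
  by (auto simp: polys_over_def intro: subring_setD)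

lemma polys_over_smult: "subring_set S \<Longrightarrow> c \<in> S \<Longrightarrow> q \<in> polys_over S \<Longrightarrow> smult c q \<in> polys_over S"
  by (auto simp: polys_over_def intro: subring_setD)

lemma polys_over_monom: "subring_set S \<Longrightarrow> c \<in> S \<Longrightarrow> monom c n \<in> polys_over S"
  by (auto simp: polys_over_def coeff_monom intro: subring_setD)

lemma polys_over_mult:
  assumes "subring_set S" "p \<in> polys_over S" "q \<in> polys_over S"
  shows "p * q \<in> polys_over S"
  using assms by (auto simp: polys_over_def coeff_mult intro!: subring_set_sum subring_setD)

lemma polys_over_pderiv: "subring_set S \<Longrightarrow> p \<in> polys_over S \<Longrightarrow> pderiv p \<in> polys_over S"
  by (auto simp: polys_over_def coeff_pderiv simp del: of_nat_Suc
      intro!: subring_setD subring_set_of_nat)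

text \<open>
  Only the leading coefficient of the divisor is inverted, so quotient and remainder stay in the
  subring and the multiplier has a sign that survives specialisation.
\<close>

lemma pseudo_division:
  fixes p g :: "'a::idom poly"
  assumes S: "subring_set S" and g: "g \<in> polys_over S" "degree g > 0"
  shows "p \<in> polys_over S \<Longrightarrow> \<exists>k q r. r \<in> polys_over S \<and> degree r < degree g \<and>
    smult (lead_coeff g ^ k) p = g * q + r"
proof (induction "degree p" arbitrary: p rule: less_induct)
  case less
  show ?case
  proof (cases "degree p < degree g")
    case True
    then show ?thesis using less.prems by (intro exI[of _ 0] exI[of _ p]) auto
  next
    case False
    define b where "b = lead_coeff g"
    define m where "m = monom (lead_coeff p) (degree p - degree g)"
    define p' where "p' = smult b p - m * g"
    have p0: "degree p > 0" using False g by simp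
    have le: "degree p' \<le> degree p"
      unfolding p'_def m_def
      by (intro degree_diff_le degree_smult_le order_trans[OF degree_mult_le])
        (use False degree_monom_le[of "lead_coeff p" "degree p - degree g"] in linarith)
    have "coeff (m * g) (degree p) = lead_coeff p * b"
      unfolding m_def coeff_monom_mult using False by (simp add: b_def)
    then have "coeff p' (degree p) = 0" by (simp add: p'_def mult.commute)
    then have lt: "degree p' < degree p"
      using le p0 by (metis degree_0 leading_coeff_0_iff order_le_imp_less_or_eq)
    have "b \<in> S" "lead_coeff p \<in> S" using g less.prems by (auto simp: b_def dest: polys_overD)
    then have "p' \<in> polys_over S" unfolding p'_def m_def using S g(1) less.prems
      by (intro polys_over_diff polys_over_mult polys_over_smult polys_over_monom)
    from less.hyps[OF lt this] obtain k q r where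
      r: "r \<in> polys_over S" "degree r < degree g" "smult (b ^ k) p' = g * q + r"
      unfolding b_def by blast
    have "smult (b ^ Suc k) p = smult (b ^ k) (p' + m * g)"
      by (simp add: p'_def mult.commute)
    also have "\<dots> = g * (q + smult (b ^ k) m) + r"
      using r(3) by (simp add: smult_add_right algebra_simps)
    finally show ?thesis using r(1,2) unfolding b_def by blast
  qed
qed

text \<open>
  \<open>\<phi>\<close> is fixed while \<open>\<psi>\<close> ranges over all specialisations that preserve the signs of the finite set \<open>H\<close>.
  The set \<open>H\<close> may depend on \<open>\<phi>\<close>; this is less than quantifier elimination gives, and it avoids the
  case distinctions of that procedure on vanishing leading coefficients.
\<close>

definition sign_transfer ::
  "('a::idom \<Rightarrow> 'r::real_closed_field) \<Rightarrow> 'a set \<Rightarrow> 's::real_closed_field itself \<Rightarrow> 'a poly set \<Rightarrow> bool" where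
  "sign_transfer \<phi> S s G \<longleftrightarrow> (\<exists>H. finite H \<and> H \<subseteq> S \<and> (\<forall>\<psi>::'a \<Rightarrow> 's. comm_ring_hom \<psi> \<longrightarrow>
     (\<forall>h\<in>H. same_sign (\<phi> h) (\<psi> h)) \<longrightarrow> (\<exists>T. diagram G (map_poly \<phi>) (map_poly \<psi>) T)))"

lemma hom_degree_eq:
  assumes "comm_ring_hom \<phi>" "\<phi> (lead_coeff p) \<noteq> 0"
  shows "degree (map_poly \<phi> p) = degree p" "lead_coeff (map_poly \<phi> p) = \<phi> (lead_coeff p)"
proof -
  interpret comm_ring_hom \<phi> by fact
  show 1: "degree (map_poly \<phi> p) = degree p"
    using assms(2) by (intro degree_map_poly) auto
  show "lead_coeff (map_poly \<phi> p) = \<phi> (lead_coeff p)" unfolding 1 by (simp add: coeff_map_poly)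
qed

lemma hom_poly_division:
  fixes \<phi> :: "'a::idom \<Rightarrow> 'b::idom"
  assumes "comm_ring_hom \<phi>" "smult c p = g * q + r" "poly (map_poly \<phi> g) z = 0"
  shows "\<phi> c * poly (map_poly \<phi> p) z = poly (map_poly \<phi> r) z"
proof -
  interpret base: comm_ring_hom \<phi> by fact
  interpret map_poly_comm_ring_hom \<phi> ..
  have "map_poly \<phi> (smult c p) = map_poly \<phi> g * map_poly \<phi> q + map_poly \<phi> r"
    unfolding assms(2) by (simp add: hom_distribs)
  then have "poly (smult (\<phi> c) (map_poly \<phi> p)) z = poly (map_poly \<phi> g * map_poly \<phi> q + map_poly \<phi> r) z"
    by (simp add: hom_distribs)
  then show ?thesis using assms(3) by simp
qed

lemma sign_transfer_constants:
  fixes \<phi> :: "'a::idom \<Rightarrow> 'r::real_closed_field"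
  assumes \<phi>: "comm_ring_hom \<phi>" and G: "finite G" "G \<subseteq> polys_over S" "\<And>g. g \<in> G \<Longrightarrow> degree g = 0"
  shows "sign_transfer \<phi> S TYPE('s::real_closed_field) G"
proof -
  interpret \<phi>: comm_ring_hom \<phi> by fact
  define H where "H = (\<lambda>g. coeff g 0) ` G"
  have H: "finite H" "H \<subseteq> S" using G by (auto simp: H_def dest: polys_overD)
  have "diagram G (map_poly \<phi>) (map_poly \<psi>) {}"
    if \<psi>: "comm_ring_hom \<psi>" and sg: "\<forall>h\<in>H. same_sign (\<phi> h) (\<psi> h)" for \<psi> :: "'a \<Rightarrow> 's"
  proof -
    interpret \<psi>: comm_ring_hom \<psi> by fact
    have const: "map_poly \<phi> g = [:\<phi> (coeff g 0):] \<and> map_poly \<psi> g = [:\<psi> (coeff g 0):] \<and>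
        same_sign (\<phi> (coeff g 0)) (\<psi> (coeff g 0))" if g: "g \<in> G" for g
    proof -
      obtain c where "g = [:c:]" using G(3)[OF g] by (rule degree_eq_zeroE)
      then show ?thesis using g sg by (auto simp: H_def hom_distribs)
    qed
    have "root_set (map_poly \<phi>) G = {}" "root_set (map_poly \<psi>) G = {}"
      unfolding root_set_def using const by auto
    moreover have "same_sign (poly (map_poly \<phi> g) x) (poly (map_poly \<psi> g) y)" if "g \<in> G" for g x y
      using const[OF that] by simp
    ultimately show ?thesis
      by (intro diagramI) simp_all
  qed
  then show ?thesis unfolding sign_transfer_def using H by blast
qed

text \<open>
  At a root of some \<open>g\<close> the polynomial \<open>p\<close> has, up to a power of the leading coefficient of \<open>g\<close>, the value
  of its remainder modulo \<open>g\<close>. So a diagram that contains the derivative of \<open>p\<close> and the remainders of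
  \<open>p\<close> tells the signs of \<open>p\<close> at all matched points, which is what the insertion of \<open>p\<close> needs.
\<close>

lemma sign_transfer_step:
  fixes \<phi> :: "'a::idom \<Rightarrow> 'r::real_closed_field"
  assumes \<phi>: "comm_ring_hom \<phi>" and inj: "\<And>x. \<phi> x = 0 \<Longrightarrow> x = 0" and S: "subring_set S"
    and G: "finite G" "insert p G \<subseteq> polys_over S" "p \<notin> G" and p: "degree p > 0"
    and rem: "\<And>g. g \<in> insert (pderiv p) G \<Longrightarrow> degree g > 0 \<Longrightarrow>
      \<exists>k q. smult (lead_coeff g ^ k) p = g * q + rem g"
    and IH: "sign_transfer \<phi> S TYPE('s::real_closed_field)
      (insert (pderiv p) G \<union> rem ` {g \<in> insert (pderiv p) G. degree g > 0})" (is "sign_transfer _ _ _ ?G'")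
  shows "sign_transfer \<phi> S TYPE('s) (insert p G)"
proof -
  let ?G0 = "insert (pderiv p) G"
  obtain H where H: "finite H" "H \<subseteq> S" and HT: "\<forall>\<psi>::'a \<Rightarrow> 's. comm_ring_hom \<psi> \<longrightarrow>
    (\<forall>h\<in>H. same_sign (\<phi> h) (\<psi> h)) \<longrightarrow> (\<exists>T. diagram ?G' (map_poly \<phi>) (map_poly \<psi>) T)"
    using IH unfolding sign_transfer_def by (elim exE conjE) (rule that)
  \<comment> \<open>Where the leading coefficients keep their signs, degrees are preserved and no polynomial becomes 0.\<close>
  define L where "L = lead_coeff ` insert p ?G0"
  show ?thesis unfolding sign_transfer_def
  proof (intro exI[of _ "H \<union> L"] conjI allI impI)
    show "finite (H \<union> L)" using H G by (simp add: L_def)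
    have "insert p ?G0 \<subseteq> polys_over S" using G(2) polys_over_pderiv[OF S, of p] by auto
    then show "H \<union> L \<subseteq> S" using H(2) unfolding L_def by (auto dest: polys_overD)
    fix \<psi> :: "'a \<Rightarrow> 's"
    assume \<psi>: "comm_ring_hom \<psi>" and sg: "\<forall>h\<in>H \<union> L. same_sign (\<phi> h) (\<psi> h)"
    interpret \<phi>: comm_ring_hom \<phi> by fact
    interpret \<psi>: comm_ring_hom \<psi> by fact
    interpret \<phi>i: idom_hom \<phi> ..
    interpret \<psi>i: idom_hom \<psi> ..
    obtain T where T: "diagram ?G' (map_poly \<phi>) (map_poly \<psi>) T" using HT[rule_format, OF \<psi>] sg by blast
    have lead: "\<phi> (lead_coeff g) \<noteq> 0" "\<psi> (lead_coeff g) \<noteq> 0" "same_sign (\<phi> (lead_coeff g)) (\<psi> (lead_coeff g))"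
      if "g \<in> insert p ?G0" "g \<noteq> 0" for g
    proof -
      show 1: "same_sign (\<phi> (lead_coeff g)) (\<psi> (lead_coeff g))" using sg that(1) by (auto simp: L_def)
      show 2: "\<phi> (lead_coeff g) \<noteq> 0" using inj[of "lead_coeff g"] that(2) by auto
      show "\<psi> (lead_coeff g) \<noteq> 0" using same_sign_eq_0[OF 1] 2 by simp
    qed
    have zero: "map_poly \<phi> g = 0 \<longleftrightarrow> map_poly \<psi> g = 0" if g: "g \<in> insert p ?G0" for g
    proof (cases "g = 0")
      case False
      have "map_poly \<phi> g \<noteq> 0"
        using hom_degree_eq(2)[OF \<phi> lead(1)[OF g False]] lead(1)[OF g False] leading_coeff_0_iff by metis
      moreover have "map_poly \<psi> g \<noteq> 0"
        using hom_degree_eq(2)[OF \<psi> lead(2)[OF g False]] lead(2)[OF g False] leading_coeff_0_iff by metis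
      ultimately show ?thesis by simp
    qed simp
    define T0 where "T0 = {(z, w) \<in> T. z \<in> root_set (map_poly \<phi>) ?G0}"
    have T0: "diagram ?G0 (map_poly \<phi>) (map_poly \<psi>) T0"
      unfolding T0_def by (rule diagram_restrict[OF T]) (use zero in auto)
    have pp: "p \<in> insert p ?G0" "p \<noteq> 0" using p by auto
    note ld = lead[OF pp]
    have atT: "same_sign (poly (map_poly \<phi> p) z) (poly (map_poly \<psi> p) w)" if zw: "(z, w) \<in> T0" for z w
    proof -
      have zT: "(z, w) \<in> T" and "z \<in> root_set (map_poly \<phi>) ?G0" using zw by (auto simp: T0_def)
      then obtain g where g: "g \<in> ?G0" "map_poly \<phi> g \<noteq> 0" "poly (map_poly \<phi> g) z = 0"
        by (auto simp: root_set_def)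
      have deg: "degree g > 0"
      proof (rule ccontr)
        assume "\<not> degree g > 0"
        then obtain c where "g = [:c:]" using degree_eq_zeroE by blast
        then show False using g(2,3) by (simp add: hom_distribs)
      qed
      then have g0: "g \<noteq> 0" by auto
      obtain k q where kq: "smult (lead_coeff g ^ k) p = g * q + rem g" using rem[OF g(1) deg] by blast
      have mt: "matched T z w" using diagramD(2)[OF T zT] .
      have "same_sign (poly (map_poly \<phi> g) z) (poly (map_poly \<psi> g) w)"
        using diagramD(5)[OF T mt] g(1) by blast
      then have gw: "poly (map_poly \<psi> g) w = 0" using g(3) by simp
      have rs: "same_sign (poly (map_poly \<phi> (rem g)) z) (poly (map_poly \<psi> (rem g)) w)"
        using diagramD(5)[OF T mt] g(1) deg by blast
      have "same_sign (\<phi> (lead_coeff g) ^ k) (\<psi> (lead_coeff g) ^ k)"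
        using lead(3)[of g] g(1) g0 by (intro same_sign_power) auto
      then have ls: "same_sign (\<phi> (lead_coeff g ^ k)) (\<psi> (lead_coeff g ^ k))"
        by (simp add: hom_distribs)
      have "\<phi> (lead_coeff g ^ k) \<noteq> 0" using inj[of "lead_coeff g ^ k"] g0 by auto
      from same_sign_mult_cancel[OF _ ls this] rs show ?thesis
        unfolding hom_poly_division[OF \<phi> kq g(3), symmetric] hom_poly_division[OF \<psi> kq gw, symmetric] .
    qed
    have "\<exists>T'. diagram (insert p ?G0) (map_poly \<phi>) (map_poly \<psi>) T'"
    proof (rule diagram_insert[OF T0, of "pderiv p"])
      show "pderiv p \<in> ?G0" by simp
      show "map_poly \<phi> (pderiv p) = pderiv (map_poly \<phi> p)" by (rule \<phi>i.map_poly_pderiv)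
      show "map_poly \<psi> (pderiv p) = pderiv (map_poly \<psi> p)" by (rule \<psi>i.map_poly_pderiv)
      show "degree (map_poly \<phi> p) = degree (map_poly \<psi> p)" "degree (map_poly \<phi> p) > 0"
        using hom_degree_eq(1)[OF \<phi> ld(1)] hom_degree_eq(1)[OF \<psi> ld(2)] p by simp_all
      show "same_sign (lead_coeff (map_poly \<phi> p)) (lead_coeff (map_poly \<psi> p))"
        unfolding hom_degree_eq(2)[OF \<phi> ld(1)] hom_degree_eq(2)[OF \<psi> ld(2)] by (rule ld(3))
    qed (rule atT)
    then obtain T' where T': "diagram (insert p ?G0) (map_poly \<phi>) (map_poly \<psi>) T'" by blast
    show "\<exists>T. diagram (insert p G) (map_poly \<phi>) (map_poly \<psi>) T"
      by (rule exI, rule diagram_restrict[OF T']) (use zero in auto)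
  qed
qed

text \<open>
  Derivatives and remainders have smaller degree, so replacing one polynomial of maximal degree \<open>d\<close> by
  them decreases the number of polynomials of degree \<open>d\<close>: the induction is on \<open>d\<close> and then on this number.
\<close>

theorem sign_transfer:
  fixes \<phi> :: "'a::{idom, ring_char_0} \<Rightarrow> 'r::real_closed_field"
  assumes \<phi>: "comm_ring_hom \<phi>" and inj: "\<And>x. \<phi> x = 0 \<Longrightarrow> x = 0" and S: "subring_set S"
    and G: "finite G" "G \<subseteq> polys_over S"
  shows "sign_transfer \<phi> S TYPE('s::real_closed_field) G"
proof -
  have "finite G \<Longrightarrow> G \<subseteq> polys_over S \<Longrightarrow> \<forall>g\<in>G. degree g \<le> d \<Longrightarrow> card {g \<in> G. degree g = d} \<le> k \<Longrightarrow>
    sign_transfer \<phi> S TYPE('s) G" for d k and G :: "'a poly set"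
  proof (induction d arbitrary: k G)
    case 0
    then show ?case by (intro sign_transfer_constants[OF \<phi>]) auto
  next
    case (Suc d)
    note IHd = Suc.IH
    show ?case using Suc.prems
    proof (induction k arbitrary: G)
      case 0
      have "degree g \<noteq> Suc d" if "g \<in> G" for g
        using 0 that by auto
      then have "\<forall>g\<in>G. degree g \<le> d" using 0(3) le_Suc_eq by blast
      then show ?case using IHd[OF 0(1,2) _ order_refl] by blast
    next
      case (Suc k)
      show ?case
      proof (cases "\<exists>p\<in>G. degree p = Suc d")
        case False
        then have "\<forall>g\<in>G. degree g \<le> d" using Suc.prems(3) le_Suc_eq by blast
        then show ?thesis using IHd[OF Suc.prems(1,2) _ order_refl] by blast
      next
        case True
        then obtain p where p: "p \<in> G" "degree p = Suc d" by blast
        define G1 where "G1 = G - {p}"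
        have Gi: "G = insert p G1" "p \<notin> G1" using p by (auto simp: G1_def)
        let ?G0 = "insert (pderiv p) G1"
        have pS: "p \<in> polys_over S" using Suc.prems(2) p by auto
        have G0S: "?G0 \<subseteq> polys_over S"
          using Suc.prems(2) polys_over_pderiv[OF S pS] by (auto simp: G1_def)
        have "\<forall>g\<in>{g \<in> ?G0. degree g > 0}. \<exists>r. r \<in> polys_over S \<and> degree r < degree g \<and>
            (\<exists>k q. smult (lead_coeff g ^ k) p = g * q + r)"
        proof
          fix g assume g: "g \<in> {g \<in> ?G0. degree g > 0}"
          then have "g \<in> polys_over S" "degree g > 0" using G0S by auto
          from pseudo_division[OF S this pS] show "\<exists>r. r \<in> polys_over S \<and> degree r < degree g \<and>
            (\<exists>k q. smult (lead_coeff g ^ k) p = g * q + r)" by (elim exE conjE) (intro exI conjI)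
        qed
        from bchoice[OF this] obtain rem where
          rem: "\<And>g. g \<in> ?G0 \<Longrightarrow> degree g > 0 \<Longrightarrow> rem g \<in> polys_over S \<and> degree (rem g) < degree g \<and>
            (\<exists>k q. smult (lead_coeff g ^ k) p = g * q + rem g)" by blast
        let ?G' = "?G0 \<union> rem ` {g \<in> ?G0. degree g > 0}"
        have dp: "degree (pderiv p) \<le> d" using p(2) by (simp add: degree_pderiv)
        have dG0: "degree g \<le> Suc d" if "g \<in> ?G0" for g
          using that dp Suc.prems(3) by (auto simp: G1_def)
        have dr: "degree (rem g) \<le> d" if "g \<in> ?G0" "degree g > 0" for g
          using rem[OF that] dG0[OF that(1)] by linarith
        have fin: "finite ?G'" using Suc.prems(1) by (auto simp: G1_def)
        have "{g \<in> ?G'. degree g = Suc d} \<subseteq> {g \<in> G. degree g = Suc d} - {p}"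
          using dp dr by (fastforce simp: G1_def)
        then have "card {g \<in> ?G'. degree g = Suc d} \<le> card ({g \<in> G. degree g = Suc d} - {p})"
          using Suc.prems(1) by (intro card_mono) auto
        also have "\<dots> = card {g \<in> G. degree g = Suc d} - 1"
          using p Suc.prems(1) by (subst card_Diff_singleton) auto
        finally have card: "card {g \<in> ?G'. degree g = Suc d} \<le> k" using Suc.prems(4) by linarith
        have "sign_transfer \<phi> S TYPE('s) ?G'"
        proof (rule Suc.IH[OF fin _ _ card])
          show "?G' \<subseteq> polys_over S" using G0S rem by blast
          show "\<forall>g\<in>?G'. degree g \<le> Suc d" using dG0 dr le_SucI by blast
        qed
        then show ?thesis unfolding Gi(1)
        proof (rule sign_transfer_step[OF \<phi> inj S _ _ Gi(2), rotated -1])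
          show "finite G1" using Suc.prems(1) by (simp add: G1_def)
          show "insert p G1 \<subseteq> polys_over S" using Suc.prems(2) Gi by simp
        qed (use p rem in auto)
      qed
    qed
  qed
  from this[OF G, of "Max (degree ` G)" "card {g \<in> G. degree g = Max (degree ` G)}"] G(1)
  show ?thesis by simp
qed

section \<open>Real closure by maximal cones\<close>

text \<open>
  The differences of elements of such a set form a subfield, and the last two conditions make the set
  a preordering of this subfield that is closed under inversion. A cone thus encodes a field together
  with a preordering of it.
\<close>

definition proper_cone :: "'a::field set \<Rightarrow> bool" where
  "proper_cone P \<longleftrightarrow> 1 \<in> P \<and> - 1 \<notin> P \<and>
     (\<forall>x\<in>P. \<forall>y\<in>P. x + y \<in> P \<and> x * y \<in> P \<and> (x - y)\<^sup>2 \<in> P) \<and> (\<forall>x\<in>P. inverse x \<in> P)"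

definition maximal_cone :: "'a::field set \<Rightarrow> bool" where
  "maximal_cone P \<longleftrightarrow> proper_cone P \<and> (\<forall>P'. proper_cone P' \<longrightarrow> P \<subseteq> P' \<longrightarrow> P' = P)"

lemma proper_coneD:
  assumes "proper_cone P"
  shows "1 \<in> P" "- 1 \<notin> P" "0 \<in> P" "x \<in> P \<Longrightarrow> y \<in> P \<Longrightarrow> x + y \<in> P" "x \<in> P \<Longrightarrow> y \<in> P \<Longrightarrow> x * y \<in> P"
    "x \<in> P \<Longrightarrow> y \<in> P \<Longrightarrow> (x - y)\<^sup>2 \<in> P" "x \<in> P \<Longrightarrow> inverse x \<in> P"
proof -
  have "(1 - 1)\<^sup>2 \<in> P" using assms unfolding proper_cone_def by blast
  then show "0 \<in> P" by simp
qed (use assms in \<open>unfold proper_cone_def, blast+\<close>)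

lemma proper_cone_antisym:
  assumes P: "proper_cone P" and x: "x \<in> P" "- x \<in> P"
  shows "x = 0"
proof (rule ccontr)
  assume "x \<noteq> 0"
  then have "(- x) * inverse x = - 1" by simp
  then show False using proper_coneD[OF P] x by metis
qed

text \<open>
  If \<open>a = b - c\<close> does not belong to the cone, then \<open>- a\<close> can be added: \<open>- 1 = p - a q\<close> would give
  \<open>a = (1 + p) / q\<close>.
\<close>

lemma proper_cone_adjoin:
  assumes P: "proper_cone P" and b: "b \<in> P" and c: "c \<in> P" and a: "b - c \<notin> P"
  shows "proper_cone {p - (b - c) * q | p q. p \<in> P \<and> q \<in> P}" (is "proper_cone ?N")
proof -
  note D = proper_coneD[OF P]
  define a where "a = b - c"
  have aa: "a * a \<in> P" using D(6)[OF b c] by (simp add: a_def power2_eq_square)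
  have diff: "\<exists>u\<in>P. \<exists>v\<in>P. (p - a * q) - (p' - a * q') = u - v"
    if "p \<in> P" "q \<in> P" "p' \<in> P" "q' \<in> P" for p q p' q'
  proof -
    have "(p - a * q) - (p' - a * q') = (p + b * q' + c * q) - (p' + b * q + c * q')"
      by (simp add: a_def algebra_simps)
    moreover have "p + b * q' + c * q \<in> P" "p' + b * q + c * q' \<in> P" using that b c by (auto intro!: D)
    ultimately show ?thesis by blast
  qed
  show ?thesis unfolding proper_cone_def a_def[symmetric]
  proof (intro conjI ballI)
    have "1 = 1 - a * 0" by simp
    then show "1 \<in> {p - a * q | p q. p \<in> P \<and> q \<in> P}" using D(1,3) by blast
    show "- 1 \<notin> {p - a * q | p q. p \<in> P \<and> q \<in> P}"
    proof
      assume "- 1 \<in> {p - a * q | p q. p \<in> P \<and> q \<in> P}"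
      then obtain p q where pq: "- 1 = p - a * q" "p \<in> P" "q \<in> P" by blast
      have "q \<noteq> 0" using pq D(2) by auto
      then have "a = (1 + p) * inverse q" using pq(1) by (simp add: field_simps)
      moreover have "1 + p \<in> P" "inverse q \<in> P" using pq by (blast intro: D)+
      ultimately have "a \<in> P" using D(5) by simp
      then show False using a by (simp add: a_def)
    qed
  next
    fix x y assume "x \<in> {p - a * q | p q. p \<in> P \<and> q \<in> P}" "y \<in> {p - a * q | p q. p \<in> P \<and> q \<in> P}"
    then obtain p q p' q' where x: "x = p - a * q" "p \<in> P" "q \<in> P" and y: "y = p' - a * q'" "p' \<in> P" "q' \<in> P"
      by blast
    have "x + y = (p + p') - a * (q + q')" unfolding x(1) y(1) by (simp add: algebra_simps)
    then show "x + y \<in> {p - a * q | p q. p \<in> P \<and> q \<in> P}" using D(4) x y by blast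
    have "x * y = (p * p' + a * a * (q * q')) - a * (p * q' + q * p')"
      unfolding x(1) y(1) by (simp add: algebra_simps)
    moreover have "p * p' + a * a * (q * q') \<in> P" "p * q' + q * p' \<in> P"
      using x y aa by (auto intro!: D)
    ultimately show "x * y \<in> {p - a * q | p q. p \<in> P \<and> q \<in> P}" by blast
    obtain u v where "u \<in> P" "v \<in> P" "x - y = u - v" using diff x y by metis
    then have "(x - y)\<^sup>2 \<in> P" using D(6) by metis
    moreover have "(x - y)\<^sup>2 = (x - y)\<^sup>2 - a * 0" by simp
    ultimately show "(x - y)\<^sup>2 \<in> {p - a * q | p q. p \<in> P \<and> q \<in> P}" using D(3) by blast
  next
    fix x assume "x \<in> {p - a * q | p q. p \<in> P \<and> q \<in> P}"
    then obtain p q where x: "x = p - a * q" "p \<in> P" "q \<in> P" by blast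
    obtain u v where "u \<in> P" "v \<in> P" "x - (0 - a * 0) = u - v"
      using diff[of p q 0 0] x D(3) by metis
    then have "x\<^sup>2 \<in> P" using D(6)[of u v] by simp
    then have s: "inverse (x\<^sup>2) \<in> P" by (rule D)
    have "inverse x = x * inverse (x\<^sup>2)" by (cases "x = 0") (auto simp: power2_eq_square)
    also have "\<dots> = p * inverse (x\<^sup>2) - a * (q * inverse (x\<^sup>2))"
      by (subst (1) x(1)) (simp add: algebra_simps)
    finally show "inverse x \<in> {p - a * q | p q. p \<in> P \<and> q \<in> P}" using D(5) x s by blast
  qed
qed

lemma maximal_cone_exists:
  assumes "proper_cone P"
  shows "\<exists>M. P \<subseteq> M \<and> maximal_cone M"
proof -
  define A where "A = {Q. P \<subseteq> Q \<and> proper_cone Q}"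
  have "\<exists>M\<in>A. \<forall>Q\<in>A. M \<subseteq> Q \<longrightarrow> Q = M"
  proof (rule subset_Zorn_nonempty)
    show "A \<noteq> {}" using assms by (auto simp: A_def)
    fix C assume C: "C \<noteq> {}" "subset.chain A C"
    have mem: "proper_cone Q" "P \<subseteq> Q" if "Q \<in> C" for Q using that C by (auto simp: subset.chain_def A_def)
    have two: "\<exists>Q\<in>C. x \<in> Q \<and> y \<in> Q" if "x \<in> \<Union>C" "y \<in> \<Union>C" for x y
      using that C(2) unfolding subset_chain_def by blast
    have "proper_cone (\<Union>C)" unfolding proper_cone_def
    proof (intro conjI ballI)
      show "1 \<in> \<Union>C" using C(1) mem proper_coneD(1) by blast
      show "- 1 \<notin> \<Union>C" using mem proper_coneD(2) by blast
      fix x assume x: "x \<in> \<Union>C"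
      then show "inverse x \<in> \<Union>C" using mem proper_coneD(7) by blast
      fix y assume y: "y \<in> \<Union>C"
      obtain Q where Q: "Q \<in> C" "x \<in> Q" "y \<in> Q" using two[OF x y] by blast
      note D = proper_coneD[OF mem(1)[OF Q(1)]]
      show "x + y \<in> \<Union>C" "x * y \<in> \<Union>C" "(x - y)\<^sup>2 \<in> \<Union>C" using D Q by blast+
    qed
    then show "\<Union>C \<in> A" using C(1) mem by (auto simp: A_def)
  qed
  then obtain M where M: "P \<subseteq> M" "proper_cone M" "\<And>Q. Q \<in> A \<Longrightarrow> M \<subseteq> Q \<Longrightarrow> Q = M" by (auto simp: A_def)
  have "Q = M" if "proper_cone Q" "M \<subseteq> Q" for Q using M(3)[of Q] that M(1) by (auto simp: A_def)
  then show ?thesis using M(1,2) unfolding maximal_cone_def by blast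
qed

text \<open>
  If \<open>b - c\<close> is not in the cone, adjoining \<open>c - b\<close> gives a proper cone, which is no larger by maximality.
\<close>

lemma maximal_cone_total:
  assumes M: "maximal_cone P" and b: "b \<in> P" and c: "c \<in> P"
  shows "b - c \<in> P \<or> c - b \<in> P"
proof (rule ccontr)
  assume n: "\<not> ?thesis"
  have P: "proper_cone P" using M by (simp add: maximal_cone_def)
  note D = proper_coneD[OF P]
  define N where "N = {p - (b - c) * q | p q. p \<in> P \<and> q \<in> P}"
  have "proper_cone N" unfolding N_def using n by (intro proper_cone_adjoin[OF P b c]) auto
  moreover have "P \<subseteq> N"
  proof
    fix p assume "p \<in> P"
    moreover have "p = p - (b - c) * 0" by simp
    ultimately show "p \<in> N" unfolding N_def using D(3) by blast
  qed
  ultimately have "N = P" using M by (simp add: maximal_cone_def)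
  moreover have "c - b = 0 - (b - c) * 1" by simp
  then have "c - b \<in> N" unfolding N_def using D(1,3) by blast
  ultimately show False using n by blast
qed

text \<open>
  The candidate for a larger cone: with \<open>W\<close> the nonnegative elements of a field and \<open>E\<close> an extension field,
  this is the preordering of \<open>E\<close> generated by \<open>W\<close>.
\<close>

inductive_set weighted_squares :: "'a::comm_ring_1 set \<Rightarrow> 'a set \<Rightarrow> 'a set" for W E where
  zero: "0 \<in> weighted_squares W E"
| add: "x \<in> weighted_squares W E \<Longrightarrow> c \<in> W \<Longrightarrow> y \<in> E \<Longrightarrow> x + c * y\<^sup>2 \<in> weighted_squares W E"

lemma weighted_squares_add:
  assumes "x \<in> weighted_squares W E" "y \<in> weighted_squares W E"
  shows "x + y \<in> weighted_squares W E"
  using assms(2)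
  by induction (auto intro: assms(1) weighted_squares.add simp: add.assoc[symmetric])

lemma weighted_squares_scale:
  assumes W: "\<And>c d. c \<in> W \<Longrightarrow> d \<in> W \<Longrightarrow> c * d \<in> W" and E: "\<And>c d. c \<in> E \<Longrightarrow> d \<in> E \<Longrightarrow> c * d \<in> E"
    and x: "x \<in> weighted_squares W E" and c: "c \<in> W" and y: "y \<in> E"
  shows "x * (c * y\<^sup>2) \<in> weighted_squares W E"
  using x
proof induction
  case zero
  then show ?case by (simp add: weighted_squares.zero)
next
  case (add x d z)
  have "(x + d * z\<^sup>2) * (c * y\<^sup>2) = x * (c * y\<^sup>2) + (d * c) * (z * y)\<^sup>2"
    by (simp add: algebra_simps power_mult_distrib)
  also have "\<dots> \<in> weighted_squares W E"
    using add W E c y by (intro weighted_squares.add) auto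
  finally show ?case .
qed

lemma weighted_squares_mult:
  assumes W: "\<And>c d. c \<in> W \<Longrightarrow> d \<in> W \<Longrightarrow> c * d \<in> W" and E: "\<And>c d. c \<in> E \<Longrightarrow> d \<in> E \<Longrightarrow> c * d \<in> E"
    and x: "x \<in> weighted_squares W E" and y: "y \<in> weighted_squares W E"
  shows "x * y \<in> weighted_squares W E"
  using y
proof induction
  case zero
  then show ?case by (simp add: weighted_squares.zero)
next
  case (add z c y)
  then show ?case unfolding distrib_left
    by (intro weighted_squares_add weighted_squares_scale[OF W E x])
qed

text \<open>
  A maximal cone inside an algebraically closed field orders a real closed field. Let \<open>p\<close> change sign
  between \<open>a\<close> and \<open>b\<close>, and let \<open>\<alpha>\<close> be a root of \<open>p\<close> in the algebraically closed field. If \<open>\<alpha>\<close> is a root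
  of a polynomial of smaller degree, then \<open>p\<close> factors, and one of the factors changes sign. Otherwise
  the polynomials in \<open>\<alpha>\<close> form a field. Its weighted sums of squares form a larger cone unless \<open>- 1\<close> is
  one of them; by maximality nothing is added, so \<open>\<alpha>\<close> already lies in the field. If \<open>- 1\<close> is
  such a sum, then \<open>1 + \<Sum> c\<^sub>i g\<^sub>i^2 = p k\<close> with \<open>k\<close> of smaller degree than \<open>p\<close>. As the left side is
  positive, \<open>k\<close> changes sign together with \<open>p\<close>, so it has a root, at which the left side vanishes.
\<close>

lemma maximal_cone_ivt:
  fixes \<iota> :: "'r::linordered_field \<Rightarrow> 'l::alg_closed_field" and p :: "'r poly"
  assumes hom: "comm_ring_hom \<iota>" and inj: "\<And>x. \<iota> x = 0 \<Longrightarrow> x = 0"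
    and max: "maximal_cone (\<iota> ` {0..})"
  shows "a < b \<Longrightarrow> poly p a * poly p b < 0 \<Longrightarrow> \<exists>x. a < x \<and> x < b \<and> poly p x = 0"
proof (induction "degree p" arbitrary: p rule: less_induct)
  case less
  interpret base: comm_ring_hom \<iota> by fact
  interpret map_poly_comm_ring_hom \<iota> ..
  have p0: "p \<noteq> 0" using less.prems(2) by auto
  have factor: ?case if g: "p = g * h" "degree g < degree p" "degree h < degree p" for g h
  proof -
    have "(poly g a * poly g b) * (poly h a * poly h b) < 0"
      using less.prems(2) unfolding g(1) by (simp add: mult_ac)
    then have "poly g a * poly g b < 0 \<or> poly h a * poly h b < 0" by (meson mult_nonneg_nonneg not_less)
    then show ?thesis using less.hyps[OF g(2) less.prems(1)] less.hyps[OF g(3) less.prems(1)] g(1) by auto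
  qed
  have dp: "degree p > 0"
  proof (rule ccontr)
    assume "\<not> degree p > 0"
    then obtain c where "p = [:c:]" using degree_eq_zeroE by blast
    then show False using less.prems(2) zero_le_square[of c] by simp
  qed
  have dm: "degree (map_poly \<iota> q) = degree q" for q
    using inj[of "lead_coeff q"] by (intro degree_map_poly) auto
  obtain \<alpha> where \<alpha>: "poly (map_poly \<iota> p) \<alpha> = 0"
    using alg_closed_imp_poly_has_root[of "map_poly \<iota> p"] dp by (auto simp: dm)
  define ev where "ev q = poly (map_poly \<iota> q) \<alpha>" for q
  have ev: "ev (q + q') = ev q + ev q'" "ev (q * q') = ev q * ev q'" "ev (q - q') = ev q - ev q'"
    "ev (- q) = - ev q" "ev 1 = 1" "ev 0 = 0" "ev [:c:] = \<iota> c" "ev (smult c q) = \<iota> c * ev q" for q q' c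
    by (simp_all add: ev_def hom_distribs)
  have evp: "ev p = 0" using \<alpha> by (simp add: ev_def)
  show ?case
  proof (cases "\<exists>g. g \<noteq> 0 \<and> degree g < degree p \<and> ev g = 0")
    case True
    \<comment> \<open>A polynomial of least degree with root \<alpha> divides p.\<close>
    define Z where "Z d \<longleftrightarrow> (\<exists>g. g \<noteq> 0 \<and> degree g = d \<and> degree g < degree p \<and> ev g = 0)" for d
    have "\<exists>d. Z d" using True by (auto simp: Z_def)
    then have "Z (LEAST d. Z d)" by (rule LeastI_ex)
    then obtain g where g: "g \<noteq> 0" "degree g = (LEAST d. Z d)" "degree g < degree p" "ev g = 0"
      by (auto simp: Z_def)
    have "ev p = ev (p div g) * ev g + ev (p mod g)"
      using ev(1,2) by (metis div_mult_mod_eq)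
    then have "ev (p mod g) = 0" using evp g by simp
    moreover have "p mod g = 0 \<or> degree (p mod g) < degree g" using g(1) by (rule degree_mod_less)
    ultimately have "p mod g \<noteq> 0 \<longrightarrow> Z (degree (p mod g)) \<and> degree (p mod g) < (LEAST d. Z d)"
      using g(2,3) unfolding Z_def[of "degree (p mod g)"] by (metis less_trans)
    then have "p mod g = 0" using not_less_Least by blast
    then have "g * (p div g) = p" using div_mult_mod_eq[of p g] by (simp add: mult.commute)
    then have pg: "p = g * (p div g)" by (rule sym)
    have pd0: "p div g \<noteq> 0" using \<open>g * (p div g) = p\<close> p0 by (metis mult_zero_right)
    have "degree g \<noteq> 0"
    proof
      assume "degree g = 0"
      then obtain c where c: "g = [:c:]" using degree_eq_zeroE by blast
      then have "\<iota> c = 0" using g(4) ev(7) by simp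
      then show False using inj[of c] c g(1) by simp
    qed
    moreover have "degree p = degree g + degree (p div g)"
      using degree_mult_eq[OF g(1) pd0] \<open>g * (p div g) = p\<close> by metis
    ultimately have "degree (p div g) < degree p" by linarith
    from factor[OF pg g(3) this] show ?thesis .
  next
    case False
    then have minimal: "ev g \<noteq> 0" if "g \<noteq> 0" "degree g < degree p" for g using that by blast
    have modp: "ev (g mod p) = ev g" for g
    proof -
      have "ev g = ev (g div p) * ev p + ev (g mod p)"
        using ev(1,2) by (metis div_mult_mod_eq)
      then show ?thesis using evp by simp
    qed
    have degmod: "degree (g mod p) < degree p" for g
      using degree_mod_less[OF p0, of g] dp by auto
    \<comment> \<open>Euclidean algorithm: p = q g + r gives r = - q g at \<alpha>, so an inverse of r yields one of g.\<close>
    have inv_small: "g \<noteq> 0 \<Longrightarrow> degree g < degree p \<Longrightarrow> \<exists>h. ev g * ev h = 1" for g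
    proof (induction "degree g" arbitrary: g rule: less_induct)
      case less
      show ?case
      proof (cases "degree g = 0")
        case True
        then obtain c where c: "g = [:c:]" using degree_eq_zeroE by blast
        then have "c \<noteq> 0" using less.prems by simp
        then have "ev g * ev [:inverse c:] = 1"
          unfolding c ev(7) by (metis base.hom_mult base.hom_one right_inverse)
        then show ?thesis by blast
      next
        case False
        define q r where "q = p div g" and "r = p mod g"
        have pq: "p = q * g + r" by (simp add: q_def r_def)
        have r: "r = 0 \<or> degree r < degree g" unfolding r_def using less.prems(1) by (rule degree_mod_less)
        have e: "ev q * ev g + ev r = 0" using evp ev(1,2) pq by metis
        have "r \<noteq> 0"
        proof
          assume r0: "r = 0"
          then have "p = q * g" using pq by simp
          moreover from this have "q \<noteq> 0" using p0 by auto
          ultimately have "degree p = degree q + degree g" using less.prems(1) by (simp add: degree_mult_eq)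
          then have "degree q < degree p" using False by simp
          then show False using minimal[of q] minimal[OF less.prems] \<open>q \<noteq> 0\<close> e r0 ev(6) by simp
        qed
        with r have rg: "degree r < degree g" by simp
        from less.hyps[OF rg \<open>r \<noteq> 0\<close>] rg less.prems(2) obtain h where h: "ev r * ev h = 1" by auto
        have "ev r = - (ev q * ev g)" using e by (simp add: eq_neg_iff_add_eq_0 add.commute)
        then have "ev g * ev (- (q * h)) = 1" using h unfolding ev by (simp add: mult_ac)
        then show ?thesis by blast
      qed
    qed
    have inv_ev: "\<exists>h. ev h = inverse (ev g)" for g
    proof (cases "ev g = 0")
      case True
      then show ?thesis using ev(6) by (metis inverse_zero)
    next
      case False
      then have "g mod p \<noteq> 0" using modp[of g] ev(6) by auto
      from inv_small[OF this degmod] obtain h where "ev g * ev h = 1" using modp by auto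
      then show ?thesis by (metis inverse_unique)
    qed
    define W where "W = weighted_squares (\<iota> ` {0..}) (range ev)"
    have WW: "c * d \<in> \<iota> ` {0..}" if "c \<in> \<iota> ` {0..}" "d \<in> \<iota> ` {0..}" for c d
      using that by (auto simp: base.hom_mult[symmetric] intro!: imageI)
    have WE: "c * d \<in> range ev" if "c \<in> range ev" "d \<in> range ev" for c d
      using that by (auto simp: ev(2)[symmetric])
    have lift: "\<exists>s. ev s = x \<and> (\<forall>t. 0 \<le> poly s t) \<and> degree s \<le> 2 * (degree p - 1)" if "x \<in> W" for x
      using that unfolding W_def
    proof induction
      case zero
      then show ?case by (intro exI[of _ 0]) (simp add: ev)
    next
      case (add x c y)
      then obtain s where s: "ev s = x" "\<And>t. 0 \<le> poly s t" "degree s \<le> 2 * (degree p - 1)" by blast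
      from add obtain d g where d: "c = \<iota> d" "d \<ge> 0" "y = ev g" by auto
      define r where "r = g mod p"
      have "degree r \<le> degree p - 1" unfolding r_def using degmod[of g] by simp
      then have "degree (r * r) \<le> 2 * (degree p - 1)" using degree_mult_le[of r r] by linarith
      then have "degree (s + smult d (r * r)) \<le> 2 * (degree p - 1)"
        using s(3) degree_smult_le[of d "r * r"] by (intro degree_add_le) auto
      moreover have "ev (s + smult d (r * r)) = x + c * y\<^sup>2"
        unfolding ev s d r_def modp by (simp add: power2_eq_square)
      moreover have "0 \<le> poly (s + smult d (r * r)) t" for t
        using s(2)[of t] d(2) by simp
      ultimately show ?case by blast
    qed
    have dvd: "p dvd s" if "ev s = 0" for s
    proof -
      have "ev (s mod p) = 0" using modp that by simp
      then have "s mod p = 0" using minimal[of "s mod p"] degmod by blast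
      then show ?thesis by (simp add: mod_eq_0_iff_dvd)
    qed
    \<comment> \<open>Reducing the summands modulo p bounds the degree of the certificate, which makes the
      cofactor k smaller than p.\<close>
    show ?thesis
    proof (cases "- 1 \<in> W")
      case True
      from lift[OF True] obtain s where s: "ev s = - 1" "\<And>t. 0 \<le> poly s t" "degree s \<le> 2 * (degree p - 1)"
        by blast
      have "ev (s + 1) = 0" using s(1) by (simp add: ev)
      from dvd[OF this] obtain k where k: "s + 1 = p * k" by (auto elim: dvdE)
      have pos: "0 < poly p t * poly k t" for t
      proof -
        have "poly p t * poly k t = poly s t + 1" using arg_cong[OF k, of "\<lambda>q. poly q t"] by simp
        then show ?thesis using s(2)[of t] by (simp add: add_nonneg_pos)
      qed
      have "k \<noteq> 0" using pos[of 0] by auto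
      have "degree (s + 1) \<le> 2 * (degree p - 1)" using s(3) by (intro degree_add_le) auto
      then have "degree p + degree k \<le> 2 * (degree p - 1)"
        unfolding k using degree_mult_eq[OF p0 \<open>k \<noteq> 0\<close>] by simp
      then have dk: "degree k < degree p" using dp by linarith
      have "0 < (poly p a * poly p b) * (poly k a * poly k b)"
        using mult_pos_pos[OF pos[of a] pos[of b]] by (simp add: mult_ac)
      then have "poly k a * poly k b < 0" using less.prems(2) by (meson mult_nonpos_nonneg not_less less_imp_le)
      from less.hyps[OF dk less.prems(1) this] obtain w where "poly k w = 0" by blast
      then show ?thesis using pos[of w] by simp
    next
      case False
      have sq: "\<iota> c * (ev g)\<^sup>2 \<in> W" if "c \<ge> 0" for c g
        using weighted_squares.add[OF weighted_squares.zero, of "\<iota> c" "\<iota> ` {0..}" "ev g" "range ev"] that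
        by (simp add: W_def)
      have sq1: "(ev g)\<^sup>2 \<in> W" for g using sq[of 1 g] by simp
      have c1: "\<iota> c \<in> W" if "c \<ge> 0" for c using sq[OF that, of 1] by (simp add: ev)
      have "proper_cone W" unfolding proper_cone_def
      proof (intro conjI ballI)
        show "1 \<in> W" using sq1[of 1] by (simp add: ev)
        show "- 1 \<notin> W" by fact
        fix x assume x: "x \<in> W"
        then obtain s where s: "ev s = x" using lift by blast
        obtain h where h: "ev h = inverse x" using inv_ev[of s] s by auto
        have "inverse x = x * (ev h)\<^sup>2" unfolding h by (cases "x = 0") (auto simp: power2_eq_square)
        then show "inverse x \<in> W" using weighted_squares_mult[OF WW WE] x sq1[of h] by (simp add: W_def)
        fix y assume y: "y \<in> W"
        then obtain s' where s': "ev s' = y" using lift by blast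
        show "x + y \<in> W" using x y unfolding W_def by (rule weighted_squares_add)
        show "x * y \<in> W" using x y weighted_squares_mult[OF WW WE] unfolding W_def by blast
        show "(x - y)\<^sup>2 \<in> W" using sq1[of "s - s'"] s s' by (simp add: ev)
      qed
      then have W: "W = \<iota> ` {0..}" using max c1 by (auto simp: maximal_cone_def)
      \<comment> \<open>The squares of 1 + \<alpha> and of \<alpha> lie in the field, and therefore so does \<alpha>. Hence p is linear.\<close>
      obtain u v where uv: "(ev [:1, 1:])\<^sup>2 = \<iota> u" "(ev [:0, 1:])\<^sup>2 = \<iota> v"
        using sq1 unfolding W by blast
      have e\<alpha>: "ev [:1, 1:] = 1 + \<alpha>" "ev [:0, 1:] = \<alpha>" by (simp_all add: ev_def hom_distribs)
      have two: "(2::'l) \<noteq> 0" using inj[of 2] by (metis base.hom_add base.hom_one one_add_one zero_neq_numeral)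
      define w where "w = (u - v - 1) / 2"
      have "\<iota> 2 = 2" by (metis base.hom_add base.hom_one one_add_one)
      moreover have "u - v - 1 = 2 * w" by (simp add: w_def)
      then have "\<iota> u - \<iota> v - 1 = \<iota> 2 * \<iota> w" by (metis base.hom_mult base.hom_minus base.hom_one)
      ultimately have "2 * \<alpha> = 2 * \<iota> w"
        using uv unfolding e\<alpha> by (simp add: power2_eq_square algebra_simps)
      then have \<alpha>w: "\<alpha> = \<iota> w" using two by simp
      have "\<iota> (poly p w) = 0" using \<alpha> unfolding \<alpha>w by simp
      then have pw: "poly p w = 0" by (rule inj)
      have "ev [:- w, 1:] = 0" using \<alpha>w by (simp add: ev_def hom_distribs)
      then have "degree p \<le> 1" using minimal[of "[:- w, 1:]"] by force
      then have "degree p = 1" using dp by simp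
      obtain h where h: "p = [:- w, 1:] * h" using pw by (auto simp: poly_eq_0_iff_dvd elim: dvdE)
      have pf: "poly p t = (t - w) * poly h t" for t using arg_cong[OF h, of "\<lambda>q. poly q t"] by (simp add: algebra_simps)
      have "h \<noteq> 0" using h p0 by auto
      then have "degree h = 0" using h \<open>degree p = 1\<close> degree_mult_eq[of "[:- w, 1:]" h] by simp
      then obtain c where c: "h = [:c:]" using degree_eq_zeroE by blast
      have "((a - w) * (b - w)) * (c * c) < 0" using less.prems(2) unfolding pf c by (simp add: mult_ac)
      then have "(a - w) * (b - w) < 0" by (meson mult_nonneg_nonneg not_less zero_le_square)
      then have "a < w \<and> w < b" using less.prems(1) by (auto simp: mult_less_0_iff)
      then show ?thesis using pw by blast
    qed
  qed
qed

section \<open>Evaluation of pure trace polynomials\<close>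

text \<open>
  The variable with index \<open>i\<close> stands for \<open>Tr(x^(i+1))\<close>. Any real values \<open>a\<close> are allowed for the
  variables, whether or not they are traces of powers of a matrix.
\<close>

definition monomial_value :: "(nat \<Rightarrow> real) \<Rightarrow> (nat \<Rightarrow>\<^sub>0 nat) \<Rightarrow> real" where
  "monomial_value a m = (\<Prod>i\<in>Poly_Mapping.keys m. a i ^ Poly_Mapping.lookup m i)"

definition evalT :: "(nat \<Rightarrow> real) \<Rightarrow> pure_trace_poly \<Rightarrow> real" where
  "evalT a p = (\<Sum>m\<in>Poly_Mapping.keys p. Poly_Mapping.lookup p m * monomial_value a m)"

abbreviation const_poly :: "real \<Rightarrow> pure_trace_poly" where
  "const_poly c \<equiv> Poly_Mapping.single 0 c"

lemma monomial_value_superset: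
  assumes "finite K" "Poly_Mapping.keys m \<subseteq> K"
  shows "monomial_value a m = (\<Prod>i\<in>K. a i ^ Poly_Mapping.lookup m i)"
  unfolding monomial_value_def using assms
  by (intro prod.mono_neutral_left) (auto simp: in_keys_iff)

lemma monomial_value_0 [simp]: "monomial_value a 0 = 1"
  by (simp add: monomial_value_def)

lemma monomial_value_add: "monomial_value a (m + m') = monomial_value a m * monomial_value a m'"
proof -
  let ?K = "Poly_Mapping.keys m \<union> Poly_Mapping.keys m'"
  have "monomial_value a (m + m') = (\<Prod>i\<in>?K. a i ^ Poly_Mapping.lookup (m + m') i)"
    using Poly_Mapping.keys_add[of m m'] by (intro monomial_value_superset) auto
  also have "\<dots> = (\<Prod>i\<in>?K. a i ^ Poly_Mapping.lookup m i) * (\<Prod>i\<in>?K. a i ^ Poly_Mapping.lookup m' i)"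
    by (simp add: Poly_Mapping.lookup_add power_add prod.distrib)
  also have "\<dots> = monomial_value a m * monomial_value a m'"
    by (subst (1 2) monomial_value_superset[of ?K]) auto
  finally show ?thesis .
qed

lemma evalT_superset:
  assumes "finite K" "Poly_Mapping.keys p \<subseteq> K"
  shows "evalT a p = (\<Sum>m\<in>K. Poly_Mapping.lookup p m * monomial_value a m)"
  unfolding evalT_def using assms
  by (intro sum.mono_neutral_left) (auto simp: in_keys_iff)

lemma evalT_add: "evalT a (p + q) = evalT a p + evalT a q"
proof -
  let ?K = "Poly_Mapping.keys p \<union> Poly_Mapping.keys q"
  have "evalT a (p + q) = (\<Sum>m\<in>?K. Poly_Mapping.lookup (p + q) m * monomial_value a m)"
    using Poly_Mapping.keys_add[of p q] by (intro evalT_superset) auto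
  also have "\<dots> = (\<Sum>m\<in>?K. Poly_Mapping.lookup p m * monomial_value a m) +
      (\<Sum>m\<in>?K. Poly_Mapping.lookup q m * monomial_value a m)"
    by (simp add: Poly_Mapping.lookup_add distrib_right sum.distrib)
  also have "\<dots> = evalT a p + evalT a q"
    by (subst (1 2) evalT_superset[of ?K]) auto
  finally show ?thesis .
qed

lemma evalT_single [simp]: "evalT a (Poly_Mapping.single m c) = c * monomial_value a m"
  by (auto simp: evalT_def)

lemma evalT_0 [simp]: "evalT a 0 = 0"
  by (simp add: evalT_def)

lemma poly_mapping_single_induct [case_names zero add]:
  assumes "P 0" "\<And>p m c. P p \<Longrightarrow> P (p + Poly_Mapping.single m c)"
  shows "P (p :: 'a \<Rightarrow>\<^sub>0 'b::comm_monoid_add)"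
proof -
  have "P p" if "finite K" "Poly_Mapping.keys p \<subseteq> K" for K p
    using that
  proof (induction K arbitrary: p)
    case empty
    then have "p = 0" by (intro poly_mapping_eqI) (auto simp: in_keys_iff)
    then show ?case using assms(1) by simp
  next
    case (insert m K)
    define q where "q = Poly_Mapping.update m 0 p"
    have e: "q + Poly_Mapping.single m (Poly_Mapping.lookup p m) = p"
    proof (rule poly_mapping_eqI)
      fix k
      show "Poly_Mapping.lookup (q + Poly_Mapping.single m (Poly_Mapping.lookup p m)) k = Poly_Mapping.lookup p k"
        by (cases "k = m")
          (simp_all add: q_def Poly_Mapping.lookup_add Poly_Mapping.lookup_update Poly_Mapping.lookup_single)
    qed
    have "Poly_Mapping.keys q \<subseteq> K"
      using insert.prems by (auto simp: q_def Poly_Mapping.keys_update)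
    from assms(2)[OF insert.IH[OF this], of m "Poly_Mapping.lookup p m"] show ?case unfolding e .
  qed
  from this[OF Poly_Mapping.finite_keys order_refl] show ?thesis .
qed

lemma evalT_mult: "evalT a (p * q) = evalT a p * evalT a q"
proof (induction p rule: poly_mapping_single_induct)
  case zero
  then show ?case by simp
next
  case (add p m c)
  have "evalT a (Poly_Mapping.single m c * q) = c * monomial_value a m * evalT a q"
    by (induction q rule: poly_mapping_single_induct)
      (simp_all add: evalT_add distrib_left Poly_Mapping.mult_single monomial_value_add)
  then show ?case using add by (simp add: distrib_right evalT_add)
qed

lemma evalT_hom: "comm_ring_hom (evalT a)"
proof -
  have "evalT a 1 = 1" using evalT_single[of a 0 1] by simp
  then show ?thesis by unfold_locales (simp_all add: evalT_add evalT_mult)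
qed

interpretation evalT: comm_ring_hom "evalT a" for a by (rule evalT_hom)
interpretation evalT_poly: map_poly_comm_ring_hom "evalT a" for a ..

lemma eval_pure_eq: "eval_pure p X = evalT (\<lambda>i. normalized_trace (pow_mat X (i + 1))) p"
  by (simp add: eval_pure_def evalT_def monomial_value_def)

lemma monomial_value_var [simp]: "monomial_value a (Poly_Mapping.single i (Suc 0)) = a i"
  by (simp add: monomial_value_def)

lemma evalT_Tr_sym: "evalT a (Tr_sym j) = (if j = 0 then 1 else a (j - 1))"
  by (simp add: Tr_sym_def)

definition trace_var :: "nat \<Rightarrow> pure_trace_poly" where
  "trace_var i = Poly_Mapping.single (Poly_Mapping.single i 1) 1"

lemma evalT_trace_var [simp]: "evalT a (trace_var i) = a i"
  by (simp add: trace_var_def)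

text \<open>
  The polynomials in the first \<open>n\<close> variables. They are generated by ring operations, so that facts about
  evaluations, which are ring homomorphisms, follow by induction.
\<close>

inductive_set polys_in :: "nat \<Rightarrow> pure_trace_poly set" for n where
  const: "const_poly c \<in> polys_in n"
| var: "i < n \<Longrightarrow> trace_var i \<in> polys_in n"
| add: "p \<in> polys_in n \<Longrightarrow> q \<in> polys_in n \<Longrightarrow> p + q \<in> polys_in n"
| mult: "p \<in> polys_in n \<Longrightarrow> q \<in> polys_in n \<Longrightarrow> p * q \<in> polys_in n"

lemma polys_in_1: "1 \<in> polys_in n"
  using polys_in.const[of 1] by simp

lemma polys_in_subring: "subring_set (polys_in n)"
  unfolding subring_set_def
proof (intro conjI ballI)
  fix x y assume "x \<in> polys_in n" "y \<in> polys_in n"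
  moreover have "x - y = x + const_poly (- 1) * y" by (simp add: Poly_Mapping.single_uminus)
  ultimately show "x - y \<in> polys_in n" by (metis polys_in.intros(1,3,4))
qed (auto intro: polys_in.intros polys_in_1)

lemma polys_in_mono:
  assumes "p \<in> polys_in m" "m \<le> n"
  shows "p \<in> polys_in n"
  using assms(1) by induction (use assms(2) in \<open>auto intro: polys_in.intros\<close>)

lemma polys_in_all: "\<exists>n. p \<in> polys_in n"
proof (induction p rule: poly_mapping_single_induct)
  case zero
  have "0 \<in> polys_in 0" using polys_in.const[of 0] by simp
  then show ?case ..
next
  case (add p m c)
  have mon: "\<exists>n. Poly_Mapping.single m (1::real) \<in> polys_in n" for m :: "nat \<Rightarrow>\<^sub>0 nat"
  proof (induction m rule: poly_mapping_single_induct)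
    case zero
    have "Poly_Mapping.single 0 1 \<in> polys_in 0" by (rule polys_in.const)
    then show ?case ..
  next
    case (add m i k)
    then obtain n where n: "Poly_Mapping.single m (1::real) \<in> polys_in n" by blast
    define N where "N = max n (Suc i)"
    have v: "trace_var i \<in> polys_in N" by (intro polys_in.var) (simp add: N_def)
    have p: "Poly_Mapping.single (Poly_Mapping.single i k) 1 \<in> polys_in N"
    proof (induction k)
      case (Suc k)
      have "Poly_Mapping.single (Poly_Mapping.single i (Suc k)) (1::real) =
        Poly_Mapping.single (Poly_Mapping.single i k) 1 * trace_var i"
        by (simp add: trace_var_def Poly_Mapping.mult_single Poly_Mapping.single_add[symmetric])
      then show ?case using polys_in.mult[OF Suc v] by simp
    qed (use polys_in_1 in simp)
    have "Poly_Mapping.single (m + Poly_Mapping.single i k) (1::real) =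
      Poly_Mapping.single m 1 * Poly_Mapping.single (Poly_Mapping.single i k) 1"
      by (simp add: Poly_Mapping.mult_single)
    moreover have "Poly_Mapping.single m (1::real) \<in> polys_in N" using n by (rule polys_in_mono) (simp add: N_def)
    ultimately show ?case using polys_in.mult[OF _ p] by auto
  qed
  obtain n1 where n1: "p \<in> polys_in n1" using add by blast
  obtain n2 where n2: "Poly_Mapping.single m (1::real) \<in> polys_in n2" using mon by blast
  have "Poly_Mapping.single m c = const_poly c * Poly_Mapping.single m 1"
    by (simp add: Poly_Mapping.mult_single)
  then have "Poly_Mapping.single m c \<in> polys_in n2"
    using polys_in.mult[OF polys_in.const n2] by simp
  then have "Poly_Mapping.single m c \<in> polys_in (max n1 n2)" by (rule polys_in_mono) simp
  moreover have "p \<in> polys_in (max n1 n2)" using n1 by (rule polys_in_mono) simp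
  ultimately show ?case using polys_in.add by blast
qed

lemma polys_in_finite:
  assumes "finite A"
  shows "\<exists>n. A \<subseteq> polys_in n"
proof -
  define N where "N p = (SOME n. p \<in> polys_in n)" for p
  have N: "p \<in> polys_in (N p)" for p unfolding N_def by (rule someI_ex, rule polys_in_all)
  have "p \<in> polys_in (Max (N ` A))" if "p \<in> A" for p
    using N[of p] by (rule polys_in_mono) (use assms that in simp)
  then show ?thesis by blast
qed

lemma evalT_cong:
  assumes "p \<in> polys_in n" "\<And>i. i < n \<Longrightarrow> a i = b i"
  shows "evalT a p = evalT b p"
  using assms(1)
  by induction (use assms(2) in \<open>auto simp: evalT_add evalT_mult\<close>)

text \<open>
  This separates the variable that is eliminated next.
\<close>

lemma polys_in_Suc:
  assumes "p \<in> polys_in (Suc n)"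
  shows "\<exists>g\<in>polys_over (polys_in n). poly g (trace_var n) = p"
  using assms
proof induction
  note D = subring_setD[OF polys_in_subring]
  case (const c)
  then show ?case
    by (intro bexI[of _ "[:const_poly c:]"]) (auto intro!: polys_overI polys_in.const D simp: coeff_pCons split: nat.split)
next
  note D = subring_setD[OF polys_in_subring]
  case (var i)
  show ?case
  proof (cases "i = n")
    case True
    then show ?thesis
      by (intro bexI[of _ "[:0, 1:]"]) (auto intro!: polys_overI polys_in.const D simp: coeff_pCons split: nat.split)
  next
    case False
    then have "trace_var i \<in> polys_in n" using var by (intro polys_in.var) simp
    then show ?thesis
      by (intro bexI[of _ "[:trace_var i:]"]) (auto intro!: polys_overI D simp: coeff_pCons split: nat.split)
  qed
next
  note D = subring_setD[OF polys_in_subring]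
  case (add p q)
  then obtain g h where "g \<in> polys_over (polys_in n)" "h \<in> polys_over (polys_in n)"
    "poly g (trace_var n) = p" "poly h (trace_var n) = q" by blast
  then show ?case by (intro bexI[of _ "g + h"]) (auto simp: polys_over_def intro: polys_in.add)
next
  case (mult p q)
  then obtain g h where gh: "g \<in> polys_over (polys_in n)" "h \<in> polys_over (polys_in n)"
    "poly g (trace_var n) = p" "poly h (trace_var n) = q" by blast
  show ?case
    by (rule bexI[of _ "g * h"]) (use gh polys_over_mult[OF polys_in_subring] in auto)
qed

lemma polys_in_0: "h \<in> polys_in 0 \<Longrightarrow> \<exists>c. h = const_poly c"
proof (induction rule: polys_in.induct)
  case (add p q)
  then show ?case by (metis Poly_Mapping.single_add)
next
  case (mult p q)
  then show ?case using Poly_Mapping.mult_single[of 0 _ 0] by (metis add_0)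
qed auto

text \<open>
  Induction on the number of variables: the last one is eliminated by \<open>sign_transfer\<close>, the induction
  hypothesis specialises the remaining ones, and the sign diagram then shows where to put the last
  coordinate. This is a form of the Artin-Lang theorem, with a real closed extension of the real
  numbers in the place of the function field of a variety.
\<close>

lemma artin_lang:
  fixes \<phi> :: "pure_trace_poly \<Rightarrow> 'r::real_closed_field"
  assumes \<phi>: "comm_ring_hom \<phi>" and inj: "\<And>x. \<phi> x = 0 \<Longrightarrow> x = 0"
    and const: "\<And>c. same_sign (\<phi> (const_poly c)) c"
  shows "finite H \<Longrightarrow> H \<subseteq> polys_in n \<Longrightarrow> \<exists>a. \<forall>h\<in>H. same_sign (\<phi> h) (evalT a h)"
proof (induction n arbitrary: H)
  case 0
  interpret \<phi>: comm_ring_hom \<phi> by fact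
  have "same_sign (\<phi> h) (evalT a h)" if h: "h \<in> H" for h a
  proof -
    obtain c where "h = const_poly c" using polys_in_0[of h] h 0 by blast
    then show ?thesis using const[of c] by simp
  qed
  then show ?case by blast
next
  case (Suc n)
  interpret \<phi>: comm_ring_hom \<phi> by fact
  have "\<forall>h\<in>H. \<exists>g. g \<in> polys_over (polys_in n) \<and> poly g (trace_var n) = h"
    using polys_in_Suc Suc.prems(2) by blast
  from bchoice[OF this] obtain G where
    G: "\<And>h. h \<in> H \<Longrightarrow> G h \<in> polys_over (polys_in n)" "\<And>h. h \<in> H \<Longrightarrow> poly (G h) (trace_var n) = h" by blast
  have "sign_transfer \<phi> (polys_in n) TYPE(real) (G ` H)"
    by (rule sign_transfer[OF \<phi> inj polys_in_subring]) (use Suc.prems(1) G(1) in auto)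
  then obtain H' where H': "finite H'" "H' \<subseteq> polys_in n" and
    T: "\<forall>\<psi>::pure_trace_poly \<Rightarrow> real. comm_ring_hom \<psi> \<longrightarrow> (\<forall>h\<in>H'. same_sign (\<phi> h) (\<psi> h)) \<longrightarrow>
      (\<exists>T. diagram (G ` H) (map_poly \<phi>) (map_poly \<psi>) T)"
    unfolding sign_transfer_def by (elim exE conjE) (rule that)
  obtain a where a: "\<forall>h\<in>H'. same_sign (\<phi> h) (evalT a h)" using Suc.IH[OF H'] by blast
  obtain T where T: "diagram (G ` H) (map_poly \<phi>) (map_poly (evalT a)) T"
    using T[rule_format, OF evalT_hom] a by blast
  obtain y where y: "matched T (\<phi> (trace_var n)) y"
    using matched_exists[OF diagramD(1,2)[OF T]] by blast
  define b where "b = a(n := y)"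
  have "same_sign (\<phi> h) (evalT b h)" if h: "h \<in> H" for h
  proof -
    have e: "map_poly (evalT b) (G h) = map_poly (evalT a) (G h)"
    proof (rule poly_eqI)
      fix k
      have "evalT b (coeff (G h) k) = evalT a (coeff (G h) k)"
        using polys_overD[OF G(1)[OF h]] by (rule evalT_cong) (simp add: b_def)
      then show "coeff (map_poly (evalT b) (G h)) k = coeff (map_poly (evalT a) (G h)) k"
        by (simp add: coeff_map_poly)
    qed
    have "\<phi> h = poly (map_poly \<phi> (G h)) (\<phi> (trace_var n))"
      unfolding \<phi>.poly_map_poly G(2)[OF h] ..
    moreover have "evalT b h = poly (map_poly (evalT b) (G h)) (evalT b (trace_var n))"
      unfolding evalT.poly_map_poly G(2)[OF h] ..
    moreover have "evalT b (trace_var n) = y" by (simp add: b_def)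
    ultimately show ?thesis using diagramD(5)[OF T y imageI[OF h]] unfolding e by simp
  qed
  then show ?case by blast
qed

section \<open>Moment functionals and quadrature\<close>

definition moment_functional :: "(nat \<Rightarrow> real) \<Rightarrow> real poly \<Rightarrow> real" where
  "moment_functional \<mu> p = (\<Sum>j\<le>degree p. coeff p j * \<mu> j)"

lemma moment_functional_eq:
  assumes "degree p \<le> d"
  shows "moment_functional \<mu> p = (\<Sum>j\<le>d. coeff p j * \<mu> j)"
  unfolding moment_functional_def using assms
  by (intro sum.mono_neutral_left) (auto simp: coeff_eq_0)

lemma moment_functional_0 [simp]: "moment_functional \<mu> 0 = 0"
  by (simp add: moment_functional_def)

lemma moment_functional_add: "moment_functional \<mu> (p + q) = moment_functional \<mu> p + moment_functional \<mu> q"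
proof -
  define d where "d = max (degree p) (degree q)"
  have "degree p \<le> d" "degree q \<le> d" "degree (p + q) \<le> d"
    unfolding d_def by (auto intro: degree_add_le)
  then show ?thesis by (simp add: moment_functional_eq[of _ d] distrib_right sum.distrib)
qed

lemma moment_functional_smult: "moment_functional \<mu> (smult c p) = c * moment_functional \<mu> p"
  by (simp add: moment_functional_eq[OF degree_smult_le] moment_functional_def sum_distrib_left mult.assoc)

lemma moment_functional_diff: "moment_functional \<mu> (p - q) = moment_functional \<mu> p - moment_functional \<mu> q"
  using moment_functional_add[of \<mu> p "- q"] moment_functional_smult[of \<mu> "- 1" q] by simp

lemma moment_functional_sum: "moment_functional \<mu> (sum f A) = (\<Sum>i\<in>A. moment_functional \<mu> (f i))"
  by (induction A rule: infinite_finite_induct) (simp_all add: moment_functional_add)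

lemma moment_functional_monom: "moment_functional \<mu> (monom 1 j) = \<mu> j"
  by (simp add: moment_functional_def degree_monom_eq if_distrib[of "\<lambda>a. a * _"] cong: if_cong)

lemma moment_functional_measure:
  assumes "\<And>j. j \<le> degree p \<Longrightarrow> \<mu> j = (\<Sum>r\<in>S. w r * r ^ j)"
  shows "moment_functional \<mu> p = (\<Sum>r\<in>S. w r * poly p r)"
proof -
  have "moment_functional \<mu> p = (\<Sum>j\<le>degree p. \<Sum>r\<in>S. coeff p j * (w r * r ^ j))"
    unfolding moment_functional_def using assms by (simp add: sum_distrib_left)
  also have "\<dots> = (\<Sum>r\<in>S. w r * poly p r)"
    by (subst sum.swap) (simp add: poly_altdef sum_distrib_left mult_ac)
  finally show ?thesis .
qed

definition lagrange :: "real set \<Rightarrow> real \<Rightarrow> real poly" where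
  "lagrange S r = (\<Prod>s\<in>S - {r}. smult (1 / (r - s)) [:- s, 1:])"

lemma poly_lagrange:
  assumes "finite S" "s \<in> S"
  shows "poly (lagrange S r) s = (if s = r then 1 else 0)"
proof -
  have e: "poly (lagrange S r) s = (\<Prod>t\<in>S - {r}. (s - t) / (r - t))"
    by (simp add: lagrange_def poly_prod diff_divide_distrib)
  show ?thesis
  proof (cases "s = r")
    case True
    then show ?thesis unfolding e by (auto intro!: prod.neutral)
  next
    case False
    then show ?thesis unfolding e using assms by (auto simp: prod_zero_iff)
  qed
qed

lemma degree_lagrange:
  assumes "finite S" "r \<in> S"
  shows "degree (lagrange S r) < card S"
proof -
  have "degree (lagrange S r) \<le> (\<Sum>s\<in>S - {r}. degree (smult (1 / (r - s)) [:- s, 1:]))"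
    using degree_prod_sum_le[of "S - {r}" "\<lambda>s. smult (1 / (r - s)) [:- s, 1:]"] assms(1)
    unfolding lagrange_def o_def by blast
  also have "\<dots> \<le> (\<Sum>s\<in>S - {r}. 1)"
    by (intro sum_mono order_trans[OF degree_smult_le]) simp
  also have "\<dots> < card S"
  proof -
    have "0 < card S" using assms by (auto simp: card_gt_0_iff)
    then show ?thesis using assms by simp
  qed
  finally show ?thesis .
qed

lemma lagrange_interpolation:
  assumes S: "finite S" and p: "p = 0 \<or> degree p < card S"
  shows "p = (\<Sum>r\<in>S. smult (poly p r) (lagrange S r))"
proof (cases "p = 0")
  case False
  then have dp: "degree p < card S" using p by simp
  define d where "d = p - (\<Sum>r\<in>S. smult (poly p r) (lagrange S r))"
  have "poly d s = 0" if "s \<in> S" for s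
    using S that by (simp add: d_def poly_sum poly_lagrange if_distrib[of "(*) _"] sum.delta cong: if_cong)
  then have sub: "S \<subseteq> {s. poly d s = 0}" by blast
  have "degree (\<Sum>r\<in>S. smult (poly p r) (lagrange S r)) \<le> card S - 1"
  proof (rule degree_sum_le[OF S])
    fix r assume "r \<in> S"
    then have "degree (lagrange S r) \<le> card S - 1" using degree_lagrange[OF S] by fastforce
    then show "degree (smult (poly p r) (lagrange S r)) \<le> card S - 1"
      using degree_smult_le[of "poly p r" "lagrange S r"] by linarith
  qed
  then have dd: "degree d < card S"
    unfolding d_def using dp degree_diff_le_max[of p "\<Sum>r\<in>S. smult (poly p r) (lagrange S r)"] by linarith
  have "d = 0"
  proof (rule ccontr)
    assume d0: "d \<noteq> 0"
    have "card S \<le> card {s. poly d s = 0}" by (rule card_mono[OF poly_roots_finite[OF d0] sub])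
    also have "\<dots> \<le> degree d" by (rule poly_roots_degree[OF d0])
    finally show False using dd by simp
  qed
  then show ?thesis by (simp add: d_def)
qed simp

lemma quadrature_formula:
  assumes S: "finite S" and g: "g \<noteq> 0" "degree g = card S" "\<And>r. r \<in> S \<Longrightarrow> poly g r = 0"
    and orth: "moment_functional \<mu> (p div g * g) = 0"
  shows "moment_functional \<mu> p = (\<Sum>r\<in>S. moment_functional \<mu> (lagrange S r) * poly p r)"
proof -
  define m where "m = p mod g"
  have pm: "p = p div g * g + m" by (simp add: m_def)
  have "m = 0 \<or> degree m < card S" unfolding m_def using degree_mod_less[OF g(1)] g(2) by auto
  from lagrange_interpolation[OF S this] have me: "m = (\<Sum>r\<in>S. smult (poly m r) (lagrange S r))" .
  have pr: "poly m r = poly p r" if "r \<in> S" for r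
    using g(3)[OF that] arg_cong[OF pm, of "\<lambda>q. poly q r"] by simp
  have "moment_functional \<mu> p = moment_functional \<mu> (p div g * g) + moment_functional \<mu> m"
    using moment_functional_add pm by metis
  also have "\<dots> = moment_functional \<mu> (\<Sum>r\<in>S. smult (poly m r) (lagrange S r))"
    using orth me by simp
  also have "\<dots> = (\<Sum>r\<in>S. moment_functional \<mu> (lagrange S r) * poly p r)"
    unfolding moment_functional_sum moment_functional_smult by (intro sum.cong) (auto simp: pr)
  finally show ?thesis .
qed

definition real_quadratic :: "real \<Rightarrow> real \<Rightarrow> real poly" where
  "real_quadratic a b = [:a\<^sup>2 + b\<^sup>2, - 2 * a, 1:]"

lemma real_quadratic_eq: "real_quadratic a b = [:- a, 1:]\<^sup>2 + [:b\<^sup>2:]"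
  by (simp add: real_quadratic_def power2_eq_square)

text \<open>
  A nonreal root would give a quadratic factor with \<open>b \<noteq> 0\<close>, and a double real root one with \<open>b = 0\<close>.
\<close>

lemma real_rooted:
  "g \<noteq> 0 \<Longrightarrow> (\<And>a b. \<not> real_quadratic a b dvd g) \<Longrightarrow> card {r. poly g r = 0} = degree g"
proof (induction "degree g" arbitrary: g rule: less_induct)
  case less
  interpret cr: map_poly_comm_ring_hom complex_of_real ..
  show ?case
  proof (cases "degree g = 0")
    case True
    then obtain c where "g = [:c:]" using degree_eq_zeroE by blast
    then show ?thesis using less.prems(1) by simp
  next
    case False
    then have "\<not> constant (poly (map_poly complex_of_real g))"
      by (subst constant_degree) (simp add: degree_map_poly)
    from fundamental_theorem_of_algebra[OF this] obtain z where z: "poly (map_poly complex_of_real g) z = 0" ..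
    define q m where "q = g div real_quadratic (Re z) (Im z)" and "m = g mod real_quadratic (Re z) (Im z)"
    have gm: "g = real_quadratic (Re z) (Im z) * q + m" by (simp add: q_def m_def)
    have dq: "degree (real_quadratic a b) = 2" "real_quadratic a b \<noteq> 0" for a b
      by (simp_all add: real_quadratic_def)
    have "poly (map_poly complex_of_real (real_quadratic (Re z) (Im z))) z = 0"
      by (simp add: real_quadratic_def map_poly_pCons complex_eq_iff power2_eq_square algebra_simps)
    then have mz: "poly (map_poly complex_of_real m) z = 0"
      using z arg_cong[OF gm, of "\<lambda>q. poly (map_poly complex_of_real q) z"]
      by (simp add: cr.hom_add cr.hom_mult)
    have "m = 0 \<or> degree m < 2" unfolding m_def using degree_mod_less[OF dq(2)] dq(1) by auto
    then have "degree m \<le> 1" by auto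
    then have m: "m = [:coeff m 0, coeff m 1:]"
      by (intro poly_eqI) (auto simp: coeff_pCons coeff_eq_0 split: nat.split)
    have mz': "complex_of_real (coeff m 0) + z * complex_of_real (coeff m 1) = 0"
      using mz by (subst (asm) m) (simp add: of_real_hom.map_poly_pCons_hom)
    have "Im z = 0"
    proof (rule ccontr)
      assume "Im z \<noteq> 0"
      with mz' have "coeff m 1 = 0" by (simp add: complex_eq_iff)
      with mz' have "coeff m 0 = 0" by (simp add: complex_eq_iff)
      with \<open>coeff m 1 = 0\<close> have "m = 0" using m by simp
      then have "real_quadratic (Re z) (Im z) dvd g" by (simp add: m_def mod_eq_0_iff_dvd)
      then show False using less.prems(2) by blast
    qed
    then have "z = complex_of_real (Re z)" by (simp add: complex_eq_iff)
    with z have "complex_of_real (poly g (Re z)) = 0" by (metis of_real_hom.poly_map_poly)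
    then have root: "poly g (Re z) = 0" by simp
    define r where "r = Re z"
    obtain k where k: "g = [:- r, 1:] * k" using root by (auto simp: poly_eq_0_iff_dvd r_def elim: dvdE)
    have k0: "k \<noteq> 0" using k less.prems(1) by auto
    have dk: "degree g = Suc (degree k)" unfolding k using k0 degree_mult_eq[of "[:- r, 1:]" k] by (simp del: mult_pCons_left)
    have nk: "\<not> real_quadratic a b dvd k" for a b
      using less.prems(2)[of a b] unfolding k by (rule contrapos_nn) (rule dvd_mult)
    have kr: "poly k r \<noteq> 0"
    proof
      assume "poly k r = 0"
      then obtain l where l: "k = [:- r, 1:] * l" by (auto simp: poly_eq_0_iff_dvd elim: dvdE)
      have "real_quadratic r 0 * l = [:- r, 1:] * ([:- r, 1:] * l)"
        by (simp add: real_quadratic_eq power2_eq_square mult.assoc del: mult_pCons_left mult_pCons_right)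
      then have "g = real_quadratic r 0 * l" unfolding k l by (rule sym)
      then show False using less.prems(2)[of r 0] by (metis dvd_triv_left)
    qed
    have "{x. poly g x = 0} = insert r {x. poly k x = 0}" unfolding k by (auto simp del: mult_pCons_left)
    then have "card {x. poly g x = 0} = Suc (card {x. poly k x = 0})"
      using kr poly_roots_finite[OF k0] by simp
    then show ?thesis using less.hyps[of k] dk k0 nk by simp
  qed
qed

text \<open>
  A quadratic factor \<open>(x - a)^2 + b^2\<close> of \<open>g\<close> with cofactor \<open>q\<close> contradicts positivity: the functional
  vanishes on \<open>g q = ((x - a) q)^2 + b^2 q^2\<close>. So \<open>g\<close> has \<open>k\<close> distinct real roots. The weight of a root
  is the value on the Lagrange polynomial, or equally on its square, since the two agree at all roots.
\<close>

lemma gauss_quadrature: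
  assumes k: "k \<ge> 1" "degree g = k" and orth: "\<And>q. degree q + 2 \<le> k \<Longrightarrow> moment_functional \<mu> (g * q) = 0"
    and pos: "\<And>p. p \<noteq> 0 \<Longrightarrow> degree p < k \<Longrightarrow> 0 < moment_functional \<mu> (p * p)"
  obtains S w where "finite S" "S = {r. poly g r = 0}" "\<And>r. r \<in> S \<Longrightarrow> 0 < w r"
    "\<And>p. degree p \<le> 2 * k - 2 \<Longrightarrow> moment_functional \<mu> p = (\<Sum>r\<in>S. w r * poly p r)"
proof -
  have g0: "g \<noteq> 0" using k by auto
  have nq: "\<not> real_quadratic a b dvd g" for a b
  proof
    assume "real_quadratic a b dvd g"
    then obtain q where q: "g = real_quadratic a b * q" by (auto elim: dvdE)
    then have q0: "q \<noteq> 0" using g0 by auto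
    have "degree (real_quadratic a b) = 2" "real_quadratic a b \<noteq> 0" by (simp_all add: real_quadratic_def)
    then have dg: "k = 2 + degree q" using k(2) q0 unfolding q by (simp add: degree_mult_eq)
    define l where "l = [:- a, 1:]"
    have l: "degree l = 1" "l \<noteq> 0" by (simp_all add: l_def)
    have "g * q = (l * q) * (l * q) + smult (b\<^sup>2) (q * q)"
      unfolding q real_quadratic_eq l_def[symmetric] by (simp add: power2_eq_square algebra_simps)
    then have "moment_functional \<mu> ((l * q) * (l * q)) + b\<^sup>2 * moment_functional \<mu> (q * q) = 0"
      using orth[of q] dg by (metis add.commute moment_functional_add moment_functional_smult order_refl)
    moreover have "0 < moment_functional \<mu> ((l * q) * (l * q))"
      by (rule pos) (use q0 dg l in \<open>auto simp: degree_mult_eq\<close>)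
    moreover have "0 < moment_functional \<mu> (q * q)" using pos[OF q0] dg by simp
    ultimately show False by (metis add_pos_nonneg less_irrefl less_imp_le mult_nonneg_nonneg zero_le_power2)
  qed
  define S where "S = {r. poly g r = 0}"
  have S: "finite S" "card S = k" unfolding S_def using poly_roots_finite[OF g0] real_rooted[OF g0 nq] k by auto
  define w where "w r = moment_functional \<mu> (lagrange S r)" for r
  have quad: "moment_functional \<mu> p = (\<Sum>r\<in>S. w r * poly p r)" if dp: "degree p \<le> 2 * k - 2" for p
    unfolding w_def
  proof (rule quadrature_formula[OF S(1) g0])
    show "degree g = card S" using k S by simp
    show "moment_functional \<mu> (p div g * g) = 0"
    proof (cases "p div g = 0")
      case False
      have "degree (p div g) + k = degree (p div g * g)" using False g0 k by (simp add: degree_mult_eq)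
      also have "p div g * g = p - p mod g" by (simp add: minus_mod_eq_div_mult)
      also have "degree (p - p mod g) \<le> max (degree p) (degree (p mod g))" by (rule degree_diff_le_max)
      finally have "degree (p div g) + k \<le> max (degree p) (degree (p mod g))" .
      moreover have "degree (p mod g) < k" using degree_mod_less[OF g0, of p] k by auto
      ultimately have "degree (p div g) + 2 \<le> k" using dp by linarith
      from orth[OF this] show ?thesis by (simp only: mult.commute)
    qed simp
  qed (simp add: S_def)
  have "0 < w r" if r: "r \<in> S" for r
  proof -
    have dl: "degree (lagrange S r) < k" using degree_lagrange[OF S(1) r] S(2) by simp
    have l0: "lagrange S r \<noteq> 0" using poly_lagrange[OF S(1) r, of r] by auto
    have "degree (lagrange S r * lagrange S r) \<le> 2 * k - 2"
      using degree_mult_le[of "lagrange S r" "lagrange S r"] dl by linarith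
    from quad[OF this] have "moment_functional \<mu> (lagrange S r * lagrange S r) =
        (\<Sum>s\<in>S. w s * poly (lagrange S r * lagrange S r) s)" .
    also have "\<dots> = (\<Sum>s\<in>S. if s = r then w s else 0)"
      by (intro sum.cong refl) (simp add: poly_lagrange[OF S(1)])
    also have "\<dots> = w r" using S(1) r by simp
    finally show ?thesis using pos[OF l0 dl] by simp
  qed
  from that[OF S(1) S_def this quad] show ?thesis by blast
qed

text \<open>
  The polynomials \<open>e 0, \<dots>, e (k - 1)\<close> span all polynomials of degree less than \<open>k\<close>.
\<close>

lemma orthogonal_to_lower_degree:
  assumes deg: "\<And>i. i \<le> M \<Longrightarrow> degree (e i) = i" and lead: "\<And>i. i \<le> M \<Longrightarrow> e i \<noteq> (0::real poly)"
    and orth: "\<And>i j. i < j \<Longrightarrow> j \<le> M \<Longrightarrow> moment_functional \<mu> (e j * e i) = 0"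
    and k: "k \<le> M"
  shows "q = 0 \<or> degree q < k \<Longrightarrow> moment_functional \<mu> (e k * q) = 0"
proof (induction "if q = 0 then 0 else Suc (degree q)" arbitrary: q rule: less_induct)
  case less
  show ?case
  proof (cases "q = 0")
    case False
    define d where "d = degree q"
    have d: "d < k" using less.prems False by (simp add: d_def)
    then have ed: "degree (e d) = d" "e d \<noteq> 0" using deg lead k by auto
    have lc: "coeff (e d) d \<noteq> 0" using ed by (metis leading_coeff_0_iff)
    define c where "c = coeff q d / coeff (e d) d"
    define q' where "q' = q - smult c (e d)"
    have qq: "q = smult c (e d) + q'" by (simp add: q'_def)
    have "coeff q' d = 0" using lc by (simp add: q'_def c_def)
    moreover have "degree q' \<le> d"
      unfolding q'_def using ed by (intro degree_diff_le order_trans[OF degree_smult_le]) (auto simp: d_def)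
    ultimately have q': "q' = 0 \<or> degree q' < d" by (metis leading_coeff_0_iff nat_less_le)
    have "moment_functional \<mu> (e k * q') = 0"
      by (rule less.hyps) (use q' d False in \<open>auto simp: d_def\<close>)
    moreover have "moment_functional \<mu> (e k * e d) = 0" using orth d k by simp
    ultimately show ?thesis
      by (subst qq) (simp add: distrib_left moment_functional_add moment_functional_smult)
  qed simp
qed

text \<open>
  Split off the leading term: \<open>p = c e\<^sub>d + q\<close> with \<open>degree q < d\<close>, and \<open>e\<^sub>d\<close> is orthogonal to \<open>q\<close>.
\<close>

lemma positive_definite_of_orthogonal:
  assumes deg: "\<And>i. i \<le> M \<Longrightarrow> degree (e i) = i" and lead: "\<And>i. i \<le> M \<Longrightarrow> e i \<noteq> (0::real poly)"
    and orth: "\<And>i j. i < j \<Longrightarrow> j \<le> M \<Longrightarrow> moment_functional \<mu> (e j * e i) = 0"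
    and pos: "\<And>i. i \<le> M \<Longrightarrow> 0 < moment_functional \<mu> (e i * e i)"
  shows "p \<noteq> 0 \<Longrightarrow> degree p \<le> M \<Longrightarrow> 0 < moment_functional \<mu> (p * p)"
proof (induction "degree p" arbitrary: p rule: less_induct)
  case less
  define d where "d = degree p"
  have d: "d \<le> M" using less.prems by (simp add: d_def)
  then have ed: "degree (e d) = d" "e d \<noteq> 0" using deg lead by auto
  have lc: "coeff (e d) d \<noteq> 0" using ed by (metis leading_coeff_0_iff)
  define c where "c = coeff p d / coeff (e d) d"
  have c0: "c \<noteq> 0" using less.prems(1) lc by (simp add: c_def d_def)
  define q where "q = p - smult c (e d)"
  have pq: "p = smult c (e d) + q" by (simp add: q_def)
  have "coeff q d = 0" using lc by (simp add: q_def c_def)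
  moreover have "degree q \<le> d"
    unfolding q_def using ed by (intro degree_diff_le order_trans[OF degree_smult_le]) (auto simp: d_def)
  ultimately have q: "q = 0 \<or> degree q < d" by (metis leading_coeff_0_iff nat_less_le)
  have pp: "p * p = smult (c\<^sup>2) (e d * e d) + (smult c (e d * q) + smult c (e d * q)) + q * q"
    unfolding pq by (simp add: algebra_simps power2_eq_square)
  have eq: "moment_functional \<mu> (e d * q) = 0"
    by (rule orthogonal_to_lower_degree[of M e \<mu>]) (fact deg lead orth d q)+
  have "moment_functional \<mu> (p * p) =
      c\<^sup>2 * moment_functional \<mu> (e d * e d) + moment_functional \<mu> (q * q)"
    unfolding pp moment_functional_add moment_functional_smult eq by simp
  moreover have "0 < c\<^sup>2 * moment_functional \<mu> (e d * e d)" using c0 pos[OF d] by simp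
  moreover have "0 \<le> moment_functional \<mu> (q * q)"
    using less.hyps[of q] q d less.prems(2) by (cases "q = 0") (auto simp: d_def less_imp_le)
  ultimately show ?case by linarith
qed

text \<open>
  Both the orthogonal polynomial of degree \<open>M\<close> and every combination of those of degree \<open>M\<close> and
  \<open>M + 1\<close> satisfy the orthogonality hypothesis of \<open>gauss_quadrature\<close>. The combination that vanishes at
  \<open>c\<close> makes \<open>c\<close> a node; if its leading term cancels, then \<open>c\<close> is a root of the first polynomial.
\<close>

lemma quadrature_with_node:
  assumes deg: "\<And>i. i \<le> Suc M \<Longrightarrow> degree (e i) = i" and lead: "\<And>i. i \<le> Suc M \<Longrightarrow> e i \<noteq> (0::real poly)"
    and orth: "\<And>i j. i < j \<Longrightarrow> j \<le> Suc M \<Longrightarrow> moment_functional \<mu> (e j * e i) = 0"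
    and pos: "\<And>i. i \<le> Suc M \<Longrightarrow> 0 < moment_functional \<mu> (e i * e i)"
    and M: "M \<ge> 1"
  obtains S w where "finite S" "c \<in> S" "\<And>r. r \<in> S \<Longrightarrow> 0 < w r"
    "\<And>p. degree p \<le> 2 * M - 2 \<Longrightarrow> moment_functional \<mu> p = (\<Sum>r\<in>S. w r * poly p r)"
proof -
  have pd: "0 < moment_functional \<mu> (p * p)" if p: "p \<noteq> 0" "degree p \<le> Suc M" for p
    by (rule positive_definite_of_orthogonal[of "Suc M" e \<mu>, OF _ _ _ _ p]) (fact deg lead orth pos)+
  have low: "moment_functional \<mu> (e k * q) = 0" if "k \<le> Suc M" "degree q < k" for k q
    by (rule orthogonal_to_lower_degree[of "Suc M" e \<mu>]) (fact deg lead orth that(1) disjI2[OF that(2)])+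
  show ?thesis
  proof (cases "poly (e M) c = 0")
    case True
    obtain S w where "finite S" "S = {r. poly (e M) r = 0}" "\<And>r. r \<in> S \<Longrightarrow> 0 < w r"
      "\<And>p. degree p \<le> 2 * M - 2 \<Longrightarrow> moment_functional \<mu> p = (\<Sum>r\<in>S. w r * poly p r)"
      by (rule gauss_quadrature[of M "e M" \<mu>]) (use M deg low pd in auto)
    then show ?thesis using that[of S w] True by blast
  next
    case False
    define g where "g = smult (poly (e M) c) (e (Suc M)) - smult (poly (e (Suc M)) c) (e M)"
    have "degree (smult (poly (e (Suc M)) c) (e M)) < degree (smult (poly (e M) c) (e (Suc M)))"
      using False deg degree_smult_le[of "poly (e (Suc M)) c" "e M"] by simp
    then have dg: "degree g = Suc M"
      unfolding g_def diff_conv_add_uminus using False deg by (subst degree_add_eq_left) auto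
    have go: "moment_functional \<mu> (g * q) = 0" if "degree q + 2 \<le> Suc M" for q
      using low[of "Suc M" q] low[of M q] that
      by (simp add: g_def left_diff_distrib moment_functional_diff moment_functional_smult)
    obtain S w where "finite S" "S = {r. poly g r = 0}" "\<And>r. r \<in> S \<Longrightarrow> 0 < w r"
      "\<And>p. degree p \<le> 2 * Suc M - 2 \<Longrightarrow> moment_functional \<mu> p = (\<Sum>r\<in>S. w r * poly p r)"
      by (rule gauss_quadrature[of "Suc M" g \<mu>]) (use dg pd go in auto)
    moreover have "poly g c = 0" by (simp add: g_def)
    ultimately show ?thesis using that[of S w] by simp
  qed
qed

section \<open>Trace polynomials on finitely supported probability measures\<close>

definition prob_weights :: "real set \<Rightarrow> (real \<Rightarrow> real) \<Rightarrow> bool" where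
  "prob_weights S w \<longleftrightarrow> finite S \<and> (\<forall>r\<in>S. 0 < w r) \<and> sum w S = 1"

definition moments :: "real set \<Rightarrow> (real \<Rightarrow> real) \<Rightarrow> nat \<Rightarrow> real" where
  "moments S w i = (\<Sum>r\<in>S. w r * r ^ Suc i)"

definition eval_at :: "(nat \<Rightarrow> real) \<Rightarrow> real \<Rightarrow> trace_poly \<Rightarrow> real" where
  "eval_at a c f = poly (map_poly (evalT a) f) c"

definition nonneg_on_measures :: "trace_poly \<Rightarrow> bool" where
  "nonneg_on_measures f \<longleftrightarrow> (\<forall>S w. prob_weights S w \<longrightarrow> (\<forall>c\<in>S. 0 \<le> eval_at (moments S w) c f))"

lemma eval_at_hom: "comm_ring_hom (eval_at a c)"
  by unfold_locales (simp_all add: eval_at_def evalT_poly.hom_add evalT_poly.hom_mult)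

interpretation eval_at: comm_ring_hom "eval_at a c" for a c by (rule eval_at_hom)

lemma eval_at_const [simp]: "eval_at a c [:p:] = evalT a p"
  by (simp add: eval_at_def evalT.map_poly_pCons_hom)

lemma eval_at_eq: "eval_at a c f = (\<Sum>j\<le>degree f. evalT a (coeff f j) * c ^ j)"
proof -
  have "eval_at a c f = moment_functional (\<lambda>j. c ^ j) (map_poly (evalT a) f)"
    by (simp add: eval_at_def moment_functional_def poly_altdef)
  also have "\<dots> = (\<Sum>j\<le>degree f. evalT a (coeff f j) * c ^ j)"
    by (subst moment_functional_eq[OF degree_map_poly_le]) (simp add: coeff_map_poly)
  finally show ?thesis .
qed

lemma eval_at_const_poly: "eval_at a c q = evalT a (poly q (const_poly c))"
proof -
  have "evalT a (poly q (const_poly c)) = poly (map_poly (evalT a) q) (evalT a (const_poly c))"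
    by (rule evalT.poly_map_poly[symmetric])
  then show ?thesis by (simp add: eval_at_def)
qed

lemma evalT_Tr: "evalT a (Tr g) = moment_functional (\<lambda>j. evalT a (Tr_sym j)) (map_poly (evalT a) g)"
  unfolding Tr_def by (subst moment_functional_eq[OF degree_map_poly_le])
    (simp add: coeff_map_poly evalT.hom_sum evalT.hom_mult)

lemma evalT_moments_Tr_sym:
  assumes "sum w S = 1"
  shows "evalT (moments S w) (Tr_sym j) = (\<Sum>r\<in>S. w r * r ^ j)"
  using assms by (cases j) (simp_all add: evalT_Tr_sym moments_def)

lemma evalT_moments_Tr:
  assumes "sum w S = 1"
  shows "evalT (moments S w) (Tr g) = (\<Sum>r\<in>S. w r * eval_at (moments S w) r g)"
  unfolding evalT_Tr eval_at_def
  by (rule moment_functional_measure) (rule evalT_moments_Tr_sym[OF assms])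

lemma evalT_moments_Tr_square:
  assumes "prob_weights S w"
  shows "evalT (moments S w) (Tr (g ^ 2)) = (\<Sum>r\<in>S. w r * (eval_at (moments S w) r g)\<^sup>2)"
  using assms by (simp add: prob_weights_def evalT_moments_Tr eval_at.hom_power)

text \<open>
  On a measure, \<open>Tr(g^2)\<close> is the integral of a square.
\<close>

lemma Q0_nonneg:
  assumes w: "prob_weights S w" and x: "x \<in> Q0"
  shows "0 \<le> eval_at (moments S w) c x"
proof -
  have sq: "0 \<le> eval_at (moments S w) c g" if "g \<in> squares_and_traces" for g
  proof -
    have "0 \<le> (\<Sum>r\<in>S. w r * (eval_at (moments S w) r h)\<^sup>2)" for h
      using w by (intro sum_nonneg) (auto simp: prob_weights_def less_imp_le)
    then show ?thesis
      using that by (auto simp: squares_and_traces_def eval_at.hom_power evalT_moments_Tr_square[OF w])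
  qed
  have pr: "0 \<le> eval_at (moments S w) c (prod_list gs)" if "set gs \<subseteq> squares_and_traces" for gs
    using that by (induction gs) (auto simp: eval_at.hom_mult intro!: mult_nonneg_nonneg sq)
  have "0 \<le> eval_at (moments S w) c (sum_list (map prod_list gss))"
    if "\<forall>gs\<in>set gss. set gs \<subseteq> squares_and_traces" for gss
    using that by (induction gss) (auto simp: eval_at.hom_add intro!: add_nonneg_nonneg pr)
  then show ?thesis using x by (auto simp: Q0_def)
qed

lemma tendsto_evalT:
  assumes "\<And>i. ((\<lambda>x. a x i) \<longlongrightarrow> l i) F"
  shows "((\<lambda>x. evalT (a x) p) \<longlongrightarrow> evalT l p) F"
  unfolding evalT_def monomial_value_def by (intro tendsto_intros assms)

lemma tendsto_eval_at:
  assumes "\<And>i. ((\<lambda>x. a x i) \<longlongrightarrow> l i) F" "(c \<longlongrightarrow> c0) F"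
  shows "((\<lambda>x. eval_at (a x) (c x) f) \<longlongrightarrow> eval_at l c0 f) F"
  unfolding eval_at_eq by (intro tendsto_intros tendsto_evalT assms)

text \<open>
  By induction some values of the first \<open>n\<close> variables do not annihilate the leading coefficient with
  respect to the last variable; the nonzero polynomial that remains has finitely many roots.
\<close>

lemma evalT_nonzero:
  assumes "h \<noteq> 0"
  shows "\<exists>b. evalT b h \<noteq> 0"
proof -
  have "h \<in> polys_in n \<Longrightarrow> h \<noteq> 0 \<Longrightarrow> \<exists>b. evalT b h \<noteq> 0" for n h
  proof (induction n arbitrary: h)
    case 0
    then obtain c where "h = const_poly c" using polys_in_0 by blast
    then show ?case using 0 by auto
  next
    case (Suc n)
    obtain g where g: "g \<in> polys_over (polys_in n)" "poly g (trace_var n) = h"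
      using polys_in_Suc[OF Suc.prems(1)] by blast
    have "lead_coeff g \<noteq> 0" using g(2) Suc.prems(2) by auto
    then obtain b where b: "evalT b (lead_coeff g) \<noteq> 0" using Suc.IH[OF polys_overD[OF g(1)]] by blast
    define p where "p = map_poly (evalT b) g"
    have "coeff p (degree g) \<noteq> 0" using b by (simp add: p_def coeff_map_poly)
    then have "p \<noteq> 0" by auto
    then have "finite {y. poly p y = 0}" by (rule poly_roots_finite)
    then obtain y where y: "poly p y \<noteq> 0" using ex_new_if_finite[OF infinite_UNIV_char_0] by blast
    have e: "map_poly (evalT (b(n := y))) g = p"
    proof (rule poly_eqI)
      fix k
      have "evalT (b(n := y)) (coeff g k) = evalT b (coeff g k)"
        using polys_overD[OF g(1)] by (rule evalT_cong) simp
      then show "coeff (map_poly (evalT (b(n := y))) g) k = coeff p k"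
        by (simp add: coeff_map_poly p_def)
    qed
    have "evalT (b(n := y)) h = poly (map_poly (evalT (b(n := y))) g) (evalT (b(n := y)) (trace_var n))"
      unfolding evalT.poly_map_poly g(2) ..
    then have "evalT (b(n := y)) h = poly p y" unfolding e by simp
    then show ?case using y by metis
  qed
  then show ?thesis using polys_in_all assms by blast
qed

text \<open>
  Along a line a polynomial function becomes a polynomial in one variable. It has finitely many zeros
  unless it vanishes on the whole line.
\<close>

lemma evalT_on_line: "\<exists>R::real poly. \<forall>u. evalT (\<lambda>i. (1 - u) * a i + u * b i) h = poly R u"
proof -
  obtain n where "h \<in> polys_in n" using polys_in_all by blast
  then show ?thesis
  proof induction
    case (const c)
    show ?case by (intro exI[of _ "[:c:]"]) simp
  next
    case (var i)
    show ?case by (intro exI[of _ "[:a i, b i - a i:]"]) (simp add: algebra_simps)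
  next
    case (add p q)
    then obtain P Q where "\<forall>u. evalT (\<lambda>i. (1 - u) * a i + u * b i) p = poly P u"
      "\<forall>u. evalT (\<lambda>i. (1 - u) * a i + u * b i) q = poly Q u" by blast
    then show ?case by (intro exI[of _ "P + Q"]) (simp add: evalT_add)
  next
    case (mult p q)
    then obtain P Q where "\<forall>u. evalT (\<lambda>i. (1 - u) * a i + u * b i) p = poly P u"
      "\<forall>u. evalT (\<lambda>i. (1 - u) * a i + u * b i) q = poly Q u" by blast
    then show ?case by (intro exI[of _ "P * Q"]) (simp add: evalT_mult)
  qed
qed

lemma moments_mix: "moments S (\<lambda>r. (1 - u) * w r + u * v r) i = (1 - u) * moments S w i + u * moments S v i"
  by (simp add: moments_def distrib_right sum.distrib sum_distrib_left mult.assoc)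

lemma eventually_at_not_in_finite:
  fixes x :: "'a::t1_space"
  assumes "finite D"
  shows "eventually (\<lambda>y. y \<notin> D) (at x)"
proof -
  have "open (- (D - {x}))" using assms by (intro open_Compl finite_imp_closed) auto
  then show ?thesis unfolding eventually_at_topological by (intro exI[of _ "- (D - {x})"]) auto
qed

lemma at_right_le_at: "at_right (x::real) \<le> at x"
  by (rule at_le) simp

text \<open>
  With \<open>N + 1\<close> nodes every sequence of \<open>N\<close> numbers is the beginning of the moment sequence of a signed
  measure of total mass 1; the weights come from Lagrange interpolation.
\<close>

lemma signed_measure_exists:
  assumes Y: "finite Y" "card Y = Suc N"
  shows "\<exists>v. sum v Y = 1 \<and> (\<forall>i<N. moments Y v i = b i)"
proof -
  define v where "v y = moment_functional (\<lambda>j. evalT b (Tr_sym j)) (lagrange Y y)" for y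
  have v: "(\<Sum>y\<in>Y. v y * y ^ j) = evalT b (Tr_sym j)" if j: "j \<le> N" for j
  proof -
    have "degree (monom (1::real) j) < card Y" using j Y by (simp add: degree_monom_eq)
    then have "monom (1::real) j = (\<Sum>y\<in>Y. smult (poly (monom 1 j) y) (lagrange Y y))"
      using Y(1) by (intro lagrange_interpolation) auto
    then have "moment_functional (\<lambda>j. evalT b (Tr_sym j)) (monom 1 j) = (\<Sum>y\<in>Y. poly (monom 1 j) y * v y)"
      by (metis (no_types, lifting) moment_functional_smult moment_functional_sum sum.cong v_def)
    then show ?thesis by (simp add: moment_functional_monom poly_monom mult.commute)
  qed
  have "sum v Y = 1" using v[of 0] by (simp add: evalT_Tr_sym)
  moreover have "moments Y v i = b i" if "i < N" for i
    using v[of "Suc i"] that by (simp add: moments_def evalT_Tr_sym)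
  ultimately show ?thesis by blast
qed

text \<open>
  Translating the measure moves the atom away from the finitely many constants at which the polynomial
  \<open>q\<close> in \<open>x\<close> vanishes.
\<close>

lemma perturb_atom:
  assumes q: "q \<noteq> 0" and w: "prob_weights S w" and c: "c \<in> S" and f: "eval_at (moments S w) c f < 0"
  shows "\<exists>S' w' c'. prob_weights S' w' \<and> c' \<in> S' \<and> eval_at (moments S' w') c' f < 0 \<and>
    poly q (const_poly c') \<noteq> 0"
proof -
  define S' where "S' d = (\<lambda>r. r + d) ` S" for d
  define w' where "w' d r = w (r - d)" for d r
  have inj: "inj_on (\<lambda>r. r + d) S" for d :: real by (simp add: inj_on_def)
  have m: "moments (S' d) (w' d) i = (\<Sum>r\<in>S. w r * (r + d) ^ Suc i)" for d i
    unfolding moments_def S'_def by (subst sum.reindex[OF inj]) (simp add: w'_def)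
  have pw: "prob_weights (S' d) (w' d)" for d
    using w unfolding prob_weights_def S'_def by (auto simp: sum.reindex[OF inj] w'_def)
  have "((\<lambda>d. eval_at (moments (S' d) (w' d)) (c + d) f) \<longlongrightarrow> eval_at (moments S w) (c + 0) f) (at 0)"
  proof (rule tendsto_eval_at)
    fix i
    have "((\<lambda>d. \<Sum>r\<in>S. w r * (r + d) ^ Suc i) \<longlongrightarrow> (\<Sum>r\<in>S. w r * (r + 0) ^ Suc i)) (at 0)"
      by (intro tendsto_intros)
    then show "((\<lambda>d. moments (S' d) (w' d) i) \<longlongrightarrow> moments S w i) (at 0)"
      unfolding m by (simp add: moments_def)
  qed (intro tendsto_intros)
  then have e1: "eventually (\<lambda>d. eval_at (moments (S' d) (w' d)) (c + d) f < 0) (at 0)"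
    using f by (intro order_tendstoD(2)) auto
  have "inj (\<lambda>d. const_poly (c + d))" by (auto intro!: injI dest: arg_cong[of _ _ "\<lambda>p. Poly_Mapping.lookup p 0"])
  then have "finite ((\<lambda>d. const_poly (c + d)) -` {x. poly q x = 0})"
    by (intro finite_vimageI poly_roots_finite q)
  from eventually_at_not_in_finite[OF this] have e2: "eventually (\<lambda>d. poly q (const_poly (c + d)) \<noteq> 0) (at 0)"
    by simp
  obtain d where "eval_at (moments (S' d) (w' d)) (c + d) f < 0" "poly q (const_poly (c + d)) \<noteq> 0"
    using eventually_happens'[OF at_neq_bot eventually_conj[OF e1 e2]] by blast
  moreover have "c + d \<in> S' d" using c by (simp add: S'_def)
  ultimately show ?thesis using pw by blast
qed

text \<open>
  Some real values \<open>b\<close> of the variables satisfy \<open>h(b) \<noteq> 0\<close>. They are moments of a signed measure on new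
  nodes \<open>Y\<close>. First a small uniform mass \<open>s\<close> on \<open>Y\<close> is mixed in, to make room for negative weights; then
  a much smaller multiple \<open>u\<close> of the signed measure. As a function of \<open>u\<close> the value of \<open>h\<close> is a
  polynomial that does not vanish at \<open>u = 1\<close>, so it vanishes for finitely many \<open>u\<close> only.
\<close>

lemma perturb_moments:
  assumes h: "h \<noteq> 0" and w: "prob_weights S w" and c: "c \<in> S" and f: "eval_at (moments S w) c f < 0"
  shows "\<exists>S' w'. prob_weights S' w' \<and> c \<in> S' \<and> eval_at (moments S' w') c f < 0 \<and> evalT (moments S' w') h \<noteq> 0"
proof -
  obtain b where b: "evalT b h \<noteq> 0" using evalT_nonzero[OF h] by blast
  obtain N where N: "h \<in> polys_in N" using polys_in_all by blast
  have S: "finite S" "\<And>r. r \<in> S \<Longrightarrow> 0 < w r" "sum w S = 1" using w by (auto simp: prob_weights_def)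
  have "infinite (UNIV - S)" using S(1) infinite_UNIV_char_0 by (simp add: Diff_infinite_finite)
  then obtain Y where Y: "finite Y" "card Y = Suc N" "Y \<subseteq> UNIV - S"
    using infinite_arbitrarily_large by metis
  obtain v where v: "sum v Y = 1" "\<And>i. i < N \<Longrightarrow> moments Y v i = b i"
    using signed_measure_exists[OF Y(1,2)] by blast
  define V where "V = S \<union> Y"
  have V: "finite V" using S Y by (simp add: V_def)
  define wA where "wA r = (if r \<in> S then w r else 0)" for r
  define wB where "wB r = (if r \<in> Y then 1 / real (Suc N) else 0)" for r
  define vY where "vY r = (if r \<in> Y then v r else 0)" for r
  have restrict: "(\<Sum>r\<in>V. (if r \<in> A then g r else 0) * k r) = (\<Sum>r\<in>A. g r * k r)" if "A \<subseteq> V" for A and g k :: "real \<Rightarrow> real"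
    using V that by (intro sum.mono_neutral_cong_right) auto
  have sums: "sum wA V = 1" "sum wB V = 1" "sum vY V = 1"
    using restrict[of S w "\<lambda>_. 1"] restrict[of Y "\<lambda>_. 1 / real (Suc N)" "\<lambda>_. 1"] restrict[of Y v "\<lambda>_. 1"] S v Y
    by (simp_all add: V_def wA_def wB_def vY_def)
  have mA: "moments V wA i = moments S w i" for i
    unfolding moments_def wA_def by (rule restrict) (simp add: V_def)
  have mY: "moments V vY i = moments Y v i" for i
    unfolding moments_def vY_def by (rule restrict) (simp add: V_def)
  define w2 where "w2 s r = (1 - s) * wA r + s * wB r" for s r
  have "((\<lambda>s. eval_at (moments V (w2 s)) c f) \<longlongrightarrow> eval_at (moments S w) c f) (at_right 0)"
  proof (rule tendsto_eval_at)
    fix i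
    have "((\<lambda>s. (1 - s) * moments V wA i + s * moments V wB i) \<longlongrightarrow> (1 - 0) * moments V wA i + 0 * moments V wB i) (at_right 0)"
      by (intro tendsto_intros)
    then show "((\<lambda>s. moments V (w2 s) i) \<longlongrightarrow> moments S w i) (at_right 0)"
      unfolding w2_def moments_mix mA by simp
  qed (intro tendsto_intros)
  then have e1: "eventually (\<lambda>s. eval_at (moments V (w2 s)) c f < 0) (at_right 0)"
    using f by (intro order_tendstoD(2)) auto
  have e2: "eventually (\<lambda>s. s \<in> {0<..<1::real}) (at_right 0)"
    by (rule eventually_at_right_real) simp
  obtain s where s: "eval_at (moments V (w2 s)) c f < 0" "0 < s" "s < 1"
    using eventually_happens'[OF trivial_limit_at_right_real eventually_conj[OF e1 e2]] by auto
  have w2pos: "0 < w2 s r" if "r \<in> V" for r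
  proof (cases "r \<in> S")
    case True
    then have "r \<notin> Y" using Y by auto
    then show ?thesis using True s S by (simp add: w2_def wA_def wB_def)
  next
    case False
    then have "r \<in> Y" using that by (simp add: V_def)
    then show ?thesis using False s by (simp add: w2_def wA_def wB_def)
  qed
  have sum2: "sum (w2 s) V = 1"
    unfolding w2_def sum.distrib sum_distrib_left[symmetric] sums by simp
  define w3 where "w3 u r = (1 - u) * w2 s r + u * vY r" for u r
  have m3: "moments V (w3 u) = (\<lambda>i. (1 - u) * moments V (w2 s) i + u * moments V vY i)" for u
    unfolding w3_def by (rule ext) (rule moments_mix)
  have "((\<lambda>u. eval_at (moments V (w3 u)) c f) \<longlongrightarrow> eval_at (moments V (w2 s)) c f) (at_right 0)"
  proof (rule tendsto_eval_at)
    fix i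
    have "((\<lambda>u. (1 - u) * moments V (w2 s) i + u * moments V vY i) \<longlongrightarrow> (1 - 0) * moments V (w2 s) i + 0 * moments V vY i) (at_right 0)"
      by (intro tendsto_intros)
    then show "((\<lambda>u. moments V (w3 u) i) \<longlongrightarrow> moments V (w2 s) i) (at_right 0)"
      unfolding m3 by simp
  qed (intro tendsto_intros)
  then have f1: "eventually (\<lambda>u. eval_at (moments V (w3 u)) c f < 0) (at_right 0)"
    using s(1) by (intro order_tendstoD(2)) auto
  have "eventually (\<lambda>u. 0 < w3 u r) (at_right 0)" if "r \<in> V" for r
  proof -
    have "((\<lambda>u. w3 u r) \<longlongrightarrow> (1 - 0) * w2 s r + 0 * vY r) (at_right 0)"
      unfolding w3_def by (intro tendsto_intros)
    then show ?thesis using w2pos[OF that] by (intro order_tendstoD(1)) auto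
  qed
  then have f2: "eventually (\<lambda>u. \<forall>r\<in>V. 0 < w3 u r) (at_right 0)"
    using V by (intro eventually_ball_finite) auto
  \<comment> \<open>The line through the base point and the signed measure: R is the value of h along it.\<close>
  obtain R where R: "\<And>u. evalT (moments V (w3 u)) h = poly R u"
    using evalT_on_line[of "moments V (w2 s)" "moments V vY" h] unfolding m3 by blast
  have "evalT (moments V (w3 1)) h = evalT b h"
    using N by (rule evalT_cong) (simp add: m3 mY v)
  then have "R \<noteq> 0" using R[of 1] b by auto
  then have "eventually (\<lambda>u. u \<notin> {u. poly R u = 0}) (at 0)"
    by (intro eventually_at_not_in_finite poly_roots_finite)
  then have f3: "eventually (\<lambda>u. u \<notin> {u. poly R u = 0}) (at_right 0)"
    by (rule filter_leD[OF at_right_le_at])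
  obtain u where u: "eval_at (moments V (w3 u)) c f < 0" "\<forall>r\<in>V. 0 < w3 u r" "poly R u \<noteq> 0"
    using eventually_happens'[OF trivial_limit_at_right_real eventually_conj[OF f1 eventually_conj[OF f2 f3]]] by auto
  have "sum (w3 u) V = 1"
    unfolding w3_def sum.distrib sum_distrib_left[symmetric] sums sum2 by simp
  then have "prob_weights V (w3 u)" using u V by (simp add: prob_weights_def)
  then show ?thesis using u R c by (metis UnI1 V_def)
qed

text \<open>
  As a polynomial in \<open>x\<close>, \<open>q\<close> has finitely many roots among the real constants. Once the atom \<open>c\<close> avoids
  them, \<open>q(c)\<close> is a nonzero pure trace polynomial, and only the moments have to be changed further.
\<close>

lemma perturb:
  assumes q: "q \<noteq> 0" and w: "prob_weights S w" and c: "c \<in> S" and f: "eval_at (moments S w) c f < 0"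
  shows "\<exists>S' w' c'. prob_weights S' w' \<and> c' \<in> S' \<and> eval_at (moments S' w') c' f < 0 \<and>
    eval_at (moments S' w') c' q \<noteq> 0"
proof -
  obtain S1 w1 c1 where 1: "prob_weights S1 w1" "c1 \<in> S1" "eval_at (moments S1 w1) c1 f < 0"
    "poly q (const_poly c1) \<noteq> 0" using perturb_atom[OF assms] by blast
  from perturb_moments[OF 1(4,1,2,3)] show ?thesis unfolding eval_at_const_poly[of _ _ q] by blast
qed

text \<open>
  By \<open>perturb\<close>, applied to the negative constant \<open>- 1\<close>, there is a measure with an atom at which \<open>g\<close> does
  not vanish; the integral of \<open>g^2\<close> is then positive.
\<close>

lemma Tr_square_nonzero:
  assumes "g \<noteq> 0"
  shows "Tr (g ^ 2) \<noteq> 0"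
proof -
  have "prob_weights {0} (\<lambda>_. 1)" by (simp add: prob_weights_def)
  from perturb[OF assms this, of 0 "- 1"] obtain S w c where
    w: "prob_weights S w" "c \<in> S" "eval_at (moments S w) c g \<noteq> 0"
    by (auto simp: eval_at.hom_uminus)
  have "0 < (\<Sum>r\<in>S. w r * (eval_at (moments S w) r g)\<^sup>2)"
    using w by (intro sum_pos2[of S c]) (auto simp: prob_weights_def less_imp_le)
  then have "evalT (moments S w) (Tr (g ^ 2)) \<noteq> 0" using evalT_moments_Tr_square[OF w(1)] by simp
  then show ?thesis by auto
qed

text \<open>
  Where \<open>q\<close> is positive and \<open>q f\<close> is nonnegative, \<open>f\<close> is nonnegative; \<open>perturb\<close> excludes that \<open>f\<close> is
  negative only at zeros of \<open>q\<close>.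
\<close>

lemma quotient_nonneg_on_measures:
  assumes "f * q = r" "r \<in> Q0" "q \<in> Q0" "q \<noteq> 0"
  shows "nonneg_on_measures f"
  unfolding nonneg_on_measures_def
proof (intro allI impI ballI, rule ccontr)
  fix S w c assume w: "prob_weights S w" "c \<in> S" and "\<not> 0 \<le> eval_at (moments S w) c f"
  then obtain S' w' c' where 1: "prob_weights S' w'" "eval_at (moments S' w') c' f < 0"
    "eval_at (moments S' w') c' q \<noteq> 0" using perturb[OF assms(4) w, of f] by auto
  have "0 < eval_at (moments S' w') c' q" using Q0_nonneg[OF 1(1) assms(3), of c'] 1(3) by simp
  then have "eval_at (moments S' w') c' f * eval_at (moments S' w') c' q < 0"
    using 1(2) by (simp add: mult_neg_pos)
  moreover have "0 \<le> eval_at (moments S' w') c' r" using Q0_nonneg[OF 1(1) assms(2)] .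
  ultimately show False unfolding assms(1)[symmetric] by (simp add: eval_at.hom_mult)
qed

section \<open>Symmetric matrices and probability measures\<close>

lemma index_mult_mat_sum:
  assumes "A \<in> carrier_mat n m" "B \<in> carrier_mat m p" "k < n" "l < p"
  shows "(A * B) $$ (k, l) = (\<Sum>c<m. A $$ (k, c) * B $$ (c, l))"
  using assms by (simp add: scalar_prod_def lessThan_atLeast0)

lemma index_pow_mat_add:
  fixes X :: "real mat"
  assumes X: "X \<in> carrier_mat n n" and "k < n" "l < n"
  shows "(X ^\<^sub>m (i + j)) $$ (k, l) = (\<Sum>c<n. (X ^\<^sub>m i) $$ (k, c) * (X ^\<^sub>m j) $$ (c, l))"
  using assms(2,3)
proof (induction j arbitrary: l)
  case 0
  then show ?case using X by (simp add: if_distrib[of "(*) _"] cong: if_cong)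
next
  case (Suc j)
  have "(X ^\<^sub>m (i + Suc j)) $$ (k, l) = (\<Sum>d<n. (X ^\<^sub>m (i + j)) $$ (k, d) * X $$ (d, l))"
    using index_mult_mat_sum[OF pow_carrier_mat[OF X] X Suc.prems] by simp
  also have "\<dots> = (\<Sum>d<n. \<Sum>c<n. (X ^\<^sub>m i) $$ (k, c) * ((X ^\<^sub>m j) $$ (c, d) * X $$ (d, l)))"
    using Suc by (simp add: sum_distrib_right mult.assoc)
  also have "\<dots> = (\<Sum>c<n. (X ^\<^sub>m i) $$ (k, c) * (\<Sum>d<n. (X ^\<^sub>m j) $$ (c, d) * X $$ (d, l)))"
    by (subst sum.swap) (simp add: sum_distrib_left)
  also have "\<dots> = (\<Sum>c<n. (X ^\<^sub>m i) $$ (k, c) * (X ^\<^sub>m Suc j) $$ (c, l))"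
    using index_mult_mat_sum[OF pow_carrier_mat[OF X] X _ Suc.prems(2)] by (intro sum.cong) auto
  finally show ?case .
qed

lemma index_pow_mat_symmetric:
  assumes X: "X \<in> symmetric_mats n" and "k < n" "l < n"
  shows "(X ^\<^sub>m i) $$ (k, l) = (X ^\<^sub>m i) $$ (l, k)"
  using assms(2,3)
proof (induction i arbitrary: k l)
  case 0
  then show ?case using X by (auto simp: symmetric_mats_def)
next
  case (Suc i)
  have Xc: "X \<in> carrier_mat n n" and t: "transpose_mat X = X" using X by (auto simp: symmetric_mats_def)
  have sym: "X $$ (a, b) = X $$ (b, a)" if "a < n" "b < n" for a b
    using arg_cong[OF t, of "\<lambda>A. A $$ (a, b)"] that Xc by simp
  have one: "(X ^\<^sub>m 1) $$ (a, b) = X $$ (a, b)" if "a < n" "b < n" for a b using that Xc by simp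
  have "(X ^\<^sub>m (1 + i)) $$ (k, l) = (\<Sum>c<n. X $$ (k, c) * (X ^\<^sub>m i) $$ (c, l))"
    unfolding index_pow_mat_add[OF Xc Suc.prems] using one Suc.prems by (intro sum.cong) auto
  also have "\<dots> = (\<Sum>c<n. (X ^\<^sub>m i) $$ (l, c) * X $$ (c, k))"
    using Suc sym by (intro sum.cong) (auto simp: mult.commute)
  also have "\<dots> = (X ^\<^sub>m (i + 1)) $$ (l, k)"
    unfolding index_pow_mat_add[OF Xc Suc.prems(2,1)] using one Suc.prems by (intro sum.cong) auto
  finally show ?case by simp
qed

lemma index_eval_trace_poly:
  assumes X: "X \<in> carrier_mat n n" and "k < n" "l < n"
  shows "eval_trace_poly f X $$ (k, l) =
    (\<Sum>j\<le>degree f. evalT (\<lambda>i. normalized_trace (X ^\<^sub>m (i + 1))) (coeff f j) * (X ^\<^sub>m j) $$ (k, l))"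
  using assms by (simp add: eval_trace_poly_def eval_pure_eq)

lemma scalar_prod_mult_mat_vec:
  fixes A :: "real mat"
  assumes "A \<in> carrier_mat n n" "v \<in> carrier_vec n"
  shows "v \<bullet> (A *\<^sub>v v) = (\<Sum>k<n. \<Sum>l<n. v $ k * A $$ (k, l) * v $ l)"
  using assms by (simp add: scalar_prod_def lessThan_atLeast0 sum_distrib_left mult.assoc)

lemma psd_index_diagonal_nonneg:
  assumes "psd n A" "i < n"
  shows "0 \<le> A $$ (i, i)"
proof -
  have A: "A \<in> carrier_mat n n" using assms by (auto simp: psd_def symmetric_mats_def)
  have "unit_vec n i \<bullet> (A *\<^sub>v unit_vec n i) = (A *\<^sub>v unit_vec n i) $ i"
    using A assms(2) by (intro scalar_prod_left_unit) auto
  also have "\<dots> = A $$ (i, i)" using A assms(2) by simp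
  finally show ?thesis using assms(1) unfolding psd_def by (metis unit_vec_carrier)
qed

lemma pow_mat_diagonal:
  fixes xs :: "real list"
  defines "X \<equiv> Matrix.mat (length xs) (length xs) (\<lambda>(i, l). if i = l then xs ! i else 0)"
  assumes "i < length xs" "l < length xs"
  shows "(X ^\<^sub>m j) $$ (i, l) = (if i = l then (xs ! i) ^ j else 0)"
  using assms(2,3)
proof (induction j arbitrary: l)
  case 0
  then show ?case by (simp add: X_def)
next
  case (Suc j)
  have Xc: "X \<in> carrier_mat (length xs) (length xs)" by (simp add: X_def)
  have "(X ^\<^sub>m Suc j) $$ (i, l) = (\<Sum>c<length xs. (X ^\<^sub>m j) $$ (i, c) * X $$ (c, l))"
    using index_mult_mat_sum[OF pow_carrier_mat[OF Xc] Xc Suc.prems] by simp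
  also have "\<dots> = (\<Sum>c<length xs. if c = i then (xs ! i) ^ j * (if i = l then xs ! i else 0) else 0)"
    using Suc by (intro sum.cong) (auto simp: X_def)
  also have "\<dots> = (if i = l then (xs ! i) ^ Suc j else 0)" using Suc.prems by simp
  finally show ?case .
qed

text \<open>
  A diagonal matrix turns a list of real numbers into the uniform measure on its entries.
\<close>

lemma psd_diagonal:
  fixes xs :: "real list"
  assumes f: "\<forall>n\<ge>1. \<forall>X\<in>symmetric_mats n. psd n (eval_trace_poly f X)" and c: "c \<in> set xs"
  shows "0 \<le> eval_at (\<lambda>i. (\<Sum>x\<leftarrow>xs. x ^ Suc i) / real (length xs)) c f"
proof -
  define n where "n = length xs"
  define X where "X = Matrix.mat n n (\<lambda>(i, l). if i = l then xs ! i else (0::real))"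
  have Xc: "X \<in> carrier_mat n n" by (simp add: X_def)
  have pw: "(X ^\<^sub>m j) $$ (i, l) = (if i = l then (xs ! i) ^ j else 0)" if "i < n" "l < n" for i j l
    using that unfolding X_def n_def by (rule pow_mat_diagonal)
  have "X \<in> symmetric_mats n" unfolding symmetric_mats_def using Xc by (auto simp: X_def intro!: eq_matI)
  moreover obtain k where k: "k < n" "xs ! k = c" using c by (auto simp: n_def in_set_conv_nth)
  ultimately have "psd n (eval_trace_poly f X)" using f by auto
  from psd_index_diagonal_nonneg[OF this k(1)] have "0 \<le> eval_trace_poly f X $$ (k, k)" .
  also have "\<dots> = (\<Sum>j\<le>degree f. evalT (\<lambda>i. normalized_trace (X ^\<^sub>m (i + 1))) (coeff f j) * c ^ j)"
    unfolding index_eval_trace_poly[OF Xc k(1,1)] using pw[OF k(1,1)] k(2) by simp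
  also have "(\<lambda>i. normalized_trace (X ^\<^sub>m (i + 1))) = (\<lambda>i. (\<Sum>x\<leftarrow>xs. x ^ Suc i) / real (length xs))"
  proof
    fix i
    have "(\<Sum>k<n. (X ^\<^sub>m (i + 1)) $$ (k, k)) = (\<Sum>k<n. (xs ! k) ^ Suc i)"
      using pw[of _ _ "i + 1"] by (intro sum.cong refl) (simp del: pow_mat.simps power_Suc)
    also have "\<dots> = (\<Sum>x\<leftarrow>xs. x ^ Suc i)"
      by (simp add: sum_list_sum_nth n_def lessThan_atLeast0)
    finally have "(\<Sum>k<n. (X ^\<^sub>m (i + 1)) $$ (k, k)) = (\<Sum>x\<leftarrow>xs. x ^ Suc i)" .
    moreover have "dim_row (X ^\<^sub>m (i + 1)) = n" using Xc by simp
    ultimately show "normalized_trace (X ^\<^sub>m (i + 1)) = (\<Sum>x\<leftarrow>xs. x ^ Suc i) / real (length xs)"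
      unfolding normalized_trace_def n_def by simp
  qed
  finally show ?thesis unfolding eval_at_eq .
qed

text \<open>
  The weight \<open>w\<close> of a node is approximated by repeating the node \<open>\<lceil>(m + 1) w\<rceil>\<close> times. Rounding up keeps
  every atom in the list.
\<close>

lemma nonneg_on_measures_if_psd:
  assumes f: "\<forall>n\<ge>1. \<forall>X\<in>symmetric_mats n. psd n (eval_trace_poly f X)"
  shows "nonneg_on_measures f"
  unfolding nonneg_on_measures_def
proof (intro allI impI ballI)
  fix S w c assume "prob_weights S w" and c: "c \<in> S"
  then have S: "finite S" "\<And>r. r \<in> S \<Longrightarrow> 0 < w r" "sum w S = 1" by (auto simp: prob_weights_def)
  define k where "k m r = nat \<lceil>real (Suc m) * w r\<rceil>" for m r
  define N where "N m = (\<Sum>r\<in>S. k m r)" for m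
  have kpos: "0 < k m r" if "r \<in> S" for m r
    using S(2)[OF that] unfolding k_def by (simp add: mult_pos_pos)
  have k_lim: "(\<lambda>m. real (k m r) / real (Suc m)) \<longlonglongrightarrow> w r" if "r \<in> S" for r
  proof (rule real_tendsto_sandwich)
    have b: "real (Suc m) * w r \<le> real (k m r)" "real (k m r) \<le> real (Suc m) * w r + 1" for m
    proof -
      have "0 < real (Suc m) * w r" using S(2)[OF that] by simp
      then have "real (k m r) = of_int \<lceil>real (Suc m) * w r\<rceil>" unfolding k_def by simp
      then show "real (Suc m) * w r \<le> real (k m r)" "real (k m r) \<le> real (Suc m) * w r + 1" by linarith+
    qed
    have "w r \<le> real (k m r) / real (Suc m)" for m
      using b(1)[of m] by (simp add: pos_le_divide_eq mult.commute del: of_nat_Suc)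
    then show "\<forall>\<^sub>F m in sequentially. w r \<le> real (k m r) / real (Suc m)" by simp
    have "real (k m r) / real (Suc m) \<le> w r + inverse (real (Suc m))" for m
    proof -
      define M where "M = real (Suc m)"
      have "0 < M" by (simp add: M_def)
      then have "M \<noteq> 0" by (rule less_imp_neq[symmetric])
      have "(w r + inverse M) * M = M * w r + 1"
        unfolding distrib_right left_inverse[OF \<open>M \<noteq> 0\<close>] mult.commute[of "w r" M] ..
      moreover have "real (k m r) \<le> M * w r + 1" using b(2)[of m] by (simp only: M_def)
      ultimately have "real (k m r) / M \<le> w r + inverse M" using \<open>0 < M\<close> by (simp only: pos_divide_le_eq)
      then show ?thesis by (simp only: M_def)
    qed
    then show "\<forall>\<^sub>F m in sequentially. real (k m r) / real (Suc m) \<le> w r + inverse (real (Suc m))" by simp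
    show "(\<lambda>m. w r + inverse (real (Suc m))) \<longlonglongrightarrow> w r"
      using tendsto_add[OF tendsto_const LIMSEQ_inverse_real_of_nat, of "w r"] by simp
  qed simp
  have sum_lim: "(\<lambda>m. (\<Sum>r\<in>S. real (k m r) * g r) / real (Suc m)) \<longlonglongrightarrow> (\<Sum>r\<in>S. w r * g r)" for g
  proof -
    have "(\<Sum>r\<in>S. real (k m r) * g r) / real (Suc m) = (\<Sum>r\<in>S. real (k m r) / real (Suc m) * g r)" for m
      by (simp add: sum_divide_distrib del: of_nat_Suc)
    then show ?thesis by (simp only:) (intro tendsto_sum tendsto_mult tendsto_const k_lim)
  qed
  define a where "a m i = (\<Sum>r\<in>S. real (k m r) * r ^ Suc i) / real (N m)" for m i
  have "(\<lambda>m. a m i) \<longlonglongrightarrow> moments S w i" for i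
  proof -
    \<comment> \<open>The repetitions k m r add up to N m, not to m + 1, so quotients of two limits are taken.\<close>
    have nz: "(\<Sum>r\<in>S. w r * 1) \<noteq> 0" using S(3) by simp
    have e: "a m i = ((\<Sum>r\<in>S. real (k m r) * r ^ Suc i) / real (Suc m)) / ((\<Sum>r\<in>S. real (k m r) * 1) / real (Suc m))" for m
      unfolding a_def N_def of_nat_sum by simp
    have "moments S w i = (\<Sum>r\<in>S. w r * r ^ Suc i) / (\<Sum>r\<in>S. w r * 1)"
      by (simp add: moments_def S(3))
    then show ?thesis unfolding e using tendsto_divide[OF sum_lim sum_lim nz] by (simp only:)
  qed
  then have lim: "(\<lambda>m. eval_at (a m) c f) \<longlonglongrightarrow> eval_at (moments S w) c f"
    by (intro tendsto_eval_at tendsto_const)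
  have "0 \<le> eval_at (a m) c f" for m
  proof -
    define rs where "rs = sorted_list_of_set S"
    have rs: "distinct rs" "set rs = S" using S(1) by (simp_all add: rs_def)
    define xs where "xs = concat (map (\<lambda>r. replicate (k m r) r) rs)"
    have "sum_list (map g xs) = (\<Sum>r\<leftarrow>rs. real (k m r) * g r)" for g :: "real \<Rightarrow> real"
      unfolding xs_def by (induction rs) (simp_all add: sum_list_replicate)
    then have sl: "sum_list (map g xs) = (\<Sum>r\<in>S. real (k m r) * g r)" for g :: "real \<Rightarrow> real"
      using sum_list_distinct_conv_sum_set[OF rs(1)] rs(2) by simp
    have "real (length xs) = real (N m)" using sl[of "\<lambda>_. 1"] by (simp add: sum_list_triv N_def)
    then have "a m = (\<lambda>i. (\<Sum>x\<leftarrow>xs. x ^ Suc i) / real (length xs))"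
      unfolding a_def sl by simp
    moreover have "c \<in> set xs" using c rs kpos[OF c, of m] by (auto simp: xs_def)
    ultimately show ?thesis using psd_diagonal[OF f] by simp
  qed
  then show "0 \<le> eval_at (moments S w) c f"
    by (intro LIMSEQ_le_const[OF lim]) blast
qed

text \<open>
  Gaussian elimination: a pivot \<open>p\<close> for the equation \<open>e\<close> removes one unknown and one equation.
\<close>

lemma homogeneous_system_solution:
  fixes A :: "'e \<Rightarrow> 'i \<Rightarrow> real"
  assumes "finite E" "finite I" "card E < card I"
  shows "\<exists>c. (\<exists>i\<in>I. c i \<noteq> 0) \<and> (\<forall>e\<in>E. (\<Sum>i\<in>I. c i * A e i) = 0)"
  using assms
proof (induction E arbitrary: I A rule: finite_induct)
  case empty
  then have "I \<noteq> {}" by auto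
  then show ?case by (intro exI[of _ "\<lambda>_. 1"]) auto
next
  case (insert e E)
  show ?case
  proof (cases "\<exists>p\<in>I. A e p \<noteq> 0")
    case False
    from insert have "card E < card I" by simp
    from insert.IH[OF insert.prems(1) this, of A] show ?thesis using False by auto
  next
    case True
    then obtain p where p: "p \<in> I" "A e p \<noteq> 0" by blast
    define J where "J = I - {p}"
    have J: "finite J" "card E < card J" using insert p by (auto simp: J_def)
    obtain c where c: "\<exists>i\<in>J. c i \<noteq> 0" "\<forall>e'\<in>E. (\<Sum>i\<in>J. c i * (A e' i - A e' p * A e i / A e p)) = 0"
      using insert.IH[OF J, of "\<lambda>e' i. A e' i - A e' p * A e i / A e p"] by blast
    define d where "d i = (if i = p then - (\<Sum>i\<in>J. c i * A e i) / A e p else c i)" for i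
    have sumI: "(\<Sum>i\<in>I. d i * A e' i) = (\<Sum>i\<in>J. c i * A e' i) - (\<Sum>i\<in>J. c i * A e i) / A e p * A e' p" for e'
    proof -
      have "(\<Sum>i\<in>I. d i * A e' i) = d p * A e' p + (\<Sum>i\<in>J. d i * A e' i)"
        unfolding J_def using insert.prems(1) p(1) by (rule sum.remove)
      also have "(\<Sum>i\<in>J. d i * A e' i) = (\<Sum>i\<in>J. c i * A e' i)"
        by (intro sum.cong) (auto simp: d_def J_def)
      finally show ?thesis by (simp add: d_def)
    qed
    have "(\<Sum>i\<in>I. d i * A e' i) = 0" if "e' \<in> insert e E" for e'
    proof (cases "e' = e")
      case True
      then show ?thesis unfolding sumI using p by simp
    next
      case False
      then have "0 = (\<Sum>i\<in>J. c i * (A e' i - A e' p * A e i / A e p))" using c that by auto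
      also have "\<dots> = (\<Sum>i\<in>J. c i * A e' i) - (\<Sum>i\<in>J. c i * A e i) / A e p * A e' p"
        by (simp add: right_diff_distrib sum_subtractf sum_distrib_left sum_distrib_right sum_divide_distrib mult_ac)
      finally show ?thesis unfolding sumI by simp
    qed
    moreover have "\<exists>i\<in>I. d i \<noteq> 0" using c(1) by (auto simp: d_def J_def)
    ultimately show ?thesis by blast
  qed
qed

text \<open>
  With \<open>y i = X^i v\<close> this reads \<open>\<langle>(g q)(X) v, v\<rangle> = \<langle>g(X) v, q(X) v\<rangle>\<close> for a symmetric matrix \<open>X\<close>.
\<close>

lemma moment_functional_gram:
  assumes "\<And>i j. \<mu> (i + j) = (\<Sum>k\<in>K. y i k * y j k)"
  shows "moment_functional \<mu> (g * q) =
    (\<Sum>k\<in>K. moment_functional (\<lambda>i. y i k) g * moment_functional (\<lambda>i. y i k) q)"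
proof -
  have mono: "moment_functional \<mu> (monom a i * monom b j) = a * b * \<mu> (i + j)" for a b i j
    using moment_functional_smult[of \<mu> "a * b" "monom 1 (i + j)"]
    by (simp add: mult_monom smult_monom moment_functional_monom)
  have "moment_functional \<mu> (g * q) = moment_functional \<mu>
      ((\<Sum>i\<le>degree g. monom (coeff g i) i) * (\<Sum>j\<le>degree q. monom (coeff q j) j))"
    by (simp add: poly_as_sum_of_monoms)
  also have "\<dots> = (\<Sum>i\<le>degree g. \<Sum>j\<le>degree q. coeff g i * coeff q j * \<mu> (i + j))"
    unfolding sum_product moment_functional_sum mono ..
  also have "\<dots> = (\<Sum>i\<le>degree g. \<Sum>j\<le>degree q. \<Sum>k\<in>K. (coeff g i * y i k) * (coeff q j * y j k))"
    by (simp add: assms sum_distrib_left mult_ac)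
  also have "\<dots> = (\<Sum>i\<le>degree g. \<Sum>k\<in>K. \<Sum>j\<le>degree q. (coeff g i * y i k) * (coeff q j * y j k))"
    by (intro sum.cong refl sum.swap)
  also have "\<dots> = (\<Sum>k\<in>K. \<Sum>i\<le>degree g. \<Sum>j\<le>degree q. (coeff g i * y i k) * (coeff q j * y j k))"
    by (rule sum.swap)
  also have "\<dots> = (\<Sum>k\<in>K. moment_functional (\<lambda>i. y i k) g * moment_functional (\<lambda>i. y i k) q)"
    by (simp add: moment_functional_def sum_product)
  finally show ?thesis .
qed

text \<open>
  The spectral theorem for \<open>X\<close>, in terms of the spectral measures \<open>W v\<close> of vectors \<open>v\<close>. Let \<open>g\<close> be a
  minimal polynomial of \<open>X\<close>. If \<open>(x - a)^2 + b^2\<close> divided \<open>g\<close>, with cofactor \<open>q\<close>, then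
  \<open>0 = \<langle>g(X) v, q(X) v\<rangle> = |(X - a) q(X) v|^2 + b^2 |q(X) v|^2\<close> for all \<open>v\<close>, so the polynomial
  \<open>(x - a) q\<close> of smaller degree would annihilate \<open>X\<close>. Hence \<open>g\<close> has distinct real roots \<open>r\<close>. The values
  of the Lagrange polynomials at \<open>X\<close> are the spectral projections, and \<open>W v r\<close> is the squared length of
  the projection of \<open>v\<close>. By minimality no projection is zero, so each root has positive weight for some
  basis vector; this is needed because atoms of a measure have positive weight.
\<close>

lemma spectral_measures:
  fixes X :: "real mat"
  assumes X: "X \<in> symmetric_mats n"
  obtains S W where "finite S" "\<And>v r. r \<in> S \<Longrightarrow> 0 \<le> (W v r :: real)"
    "\<And>r. r \<in> S \<Longrightarrow> \<exists>l<n. 0 < W (\<lambda>i. if i = l then 1 else 0) r"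
    "\<And>v p. moment_functional (\<lambda>j. \<Sum>k<n. \<Sum>l<n. v k * (X ^\<^sub>m j) $$ (k, l) * v l) p = (\<Sum>r\<in>S. W v r * poly p r)"
proof -
  have Xc: "X \<in> carrier_mat n n" using X by (simp add: symmetric_mats_def)
  define y where "y v i k = (\<Sum>l<n. (X ^\<^sub>m i) $$ (k, l) * v l)" for v i k
  define \<mu> where "\<mu> v j = (\<Sum>k<n. \<Sum>l<n. v k * (X ^\<^sub>m j) $$ (k, l) * v l)" for v j
  have gram: "\<mu> v (i + j) = (\<Sum>c<n. y v i c * y v j c)" for v i j
  proof -
    have "\<mu> v (i + j) = (\<Sum>k<n. \<Sum>l<n. \<Sum>c<n. ((X ^\<^sub>m i) $$ (c, k) * v k) * ((X ^\<^sub>m j) $$ (c, l) * v l))"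
      unfolding \<mu>_def
    proof (intro sum.cong refl)
      fix k l assume kl: "k \<in> {..<n}" "l \<in> {..<n}"
      have "(X ^\<^sub>m (i + j)) $$ (k, l) = (\<Sum>c<n. (X ^\<^sub>m i) $$ (k, c) * (X ^\<^sub>m j) $$ (c, l))"
        using kl by (intro index_pow_mat_add[OF Xc]) auto
      also have "\<dots> = (\<Sum>c<n. (X ^\<^sub>m i) $$ (c, k) * (X ^\<^sub>m j) $$ (c, l))"
        using kl index_pow_mat_symmetric[OF X] by (intro sum.cong) auto
      finally show "v k * (X ^\<^sub>m (i + j)) $$ (k, l) * v l =
        (\<Sum>c<n. ((X ^\<^sub>m i) $$ (c, k) * v k) * ((X ^\<^sub>m j) $$ (c, l) * v l))"
        by (simp add: sum_distrib_left sum_distrib_right mult_ac)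
    qed
    also have "\<dots> = (\<Sum>k<n. \<Sum>c<n. \<Sum>l<n. ((X ^\<^sub>m i) $$ (c, k) * v k) * ((X ^\<^sub>m j) $$ (c, l) * v l))"
      by (intro sum.cong refl sum.swap)
    also have "\<dots> = (\<Sum>c<n. \<Sum>k<n. \<Sum>l<n. ((X ^\<^sub>m i) $$ (c, k) * v k) * ((X ^\<^sub>m j) $$ (c, l) * v l))"
      by (rule sum.swap)
    also have "\<dots> = (\<Sum>c<n. y v i c * y v j c)" by (simp add: y_def sum_product)
    finally show ?thesis .
  qed
  have mu: "moment_functional (\<mu> v) (g * q) =
    (\<Sum>k<n. moment_functional (\<lambda>i. y v i k) g * moment_functional (\<lambda>i. y v i k) q)" for v g q
    by (rule moment_functional_gram) (rule gram)
  define ann where "ann g \<longleftrightarrow> (\<forall>k<n. \<forall>l<n. moment_functional (\<lambda>i. (X ^\<^sub>m i) $$ (k, l)) g = 0)" for g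
  have yX: "moment_functional (\<lambda>i. y v i k) g = (\<Sum>l<n. moment_functional (\<lambda>i. (X ^\<^sub>m i) $$ (k, l)) g * v l)" for v k g
    unfolding moment_functional_def y_def
    by (simp add: sum_distrib_left sum_distrib_right mult.assoc) (rule sum.swap)
  have annD: "moment_functional (\<lambda>i. y v i k) g = 0" if "ann g" "k < n" for v k g
    unfolding yX using that by (simp add: ann_def)
  define unit where "unit l = (\<lambda>i::nat. if i = l then 1 else (0::real))" for l
  have y_unit: "moment_functional (\<lambda>i. y (unit l) i k) g = moment_functional (\<lambda>i. (X ^\<^sub>m i) $$ (k, l)) g"
    if "l < n" for l k g
    unfolding yX unit_def using that by (simp add: if_distrib[of "(*) _"] cong: if_cong)
  \<comment> \<open>A matrix has card E entries, so its first card E + 1 powers are linearly dependent.\<close>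
  have "\<exists>g. g \<noteq> 0 \<and> ann g"
  proof -
    define E where "E = {..<n} \<times> {..<n}"
    have "finite E" by (simp add: E_def)
    from homogeneous_system_solution[OF this, of "{..card E}" "\<lambda>(k, l) i. (X ^\<^sub>m i) $$ (k, l)"]
    obtain c where c: "\<exists>i\<in>{..card E}. c i \<noteq> 0" "\<And>k l. k < n \<Longrightarrow> l < n \<Longrightarrow> (\<Sum>i\<le>card E. c i * (X ^\<^sub>m i) $$ (k, l)) = 0"
      by (auto simp: E_def)
    define g where "g = (\<Sum>i\<le>card E. smult (c i) (monom 1 i))"
    have "moment_functional \<nu> g = (\<Sum>i\<le>card E. c i * \<nu> i)" for \<nu>
      unfolding g_def moment_functional_sum moment_functional_smult moment_functional_monom ..
    then have "ann g" using c(2) by (simp add: ann_def)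
    moreover have "coeff g i = c i" if "i \<le> card E" for i
      using that unfolding g_def by (simp add: coeff_sum smult_monom sum.delta)
    then have "g \<noteq> 0" using c(1) by (metis atMost_iff coeff_0)
    ultimately show ?thesis by blast
  qed
  then obtain g0 where "g0 \<noteq> 0 \<and> ann g0" ..
  from ex_has_least_nat[of "\<lambda>g. g \<noteq> 0 \<and> ann g", OF this, of degree] obtain g where
    least: "(g \<noteq> 0 \<and> ann g) \<and> (\<forall>h. h \<noteq> 0 \<and> ann h \<longrightarrow> degree g \<le> degree h)" ..
  then have g: "g \<noteq> 0" "ann g" by simp_all
  have min: "degree g \<le> degree h" if "h \<noteq> 0" "ann h" for h using least that by simp
  have nq: "\<not> real_quadratic a b dvd g" for a b
  proof
    assume "real_quadratic a b dvd g"
    then obtain q where q: "g = real_quadratic a b * q" by (auto elim: dvdE)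
    then have q0: "q \<noteq> 0" using g by auto
    have "degree (real_quadratic a b) = 2" "real_quadratic a b \<noteq> 0" by (simp_all add: real_quadratic_def)
    then have dg: "degree g = 2 + degree q" using q0 unfolding q by (simp add: degree_mult_eq)
    define l where "l = [:- a, 1:]"
    have l: "degree l = 1" "l \<noteq> 0" by (simp_all add: l_def)
    have eq: "g * q = (l * q) * (l * q) + smult (b\<^sup>2) (q * q)"
      unfolding q real_quadratic_eq l_def[symmetric] by (simp add: power2_eq_square algebra_simps)
    have "moment_functional (\<lambda>i. y v i k) (l * q) = 0" if k: "k < n" for v k
    proof -
      have "0 = moment_functional (\<mu> v) (g * q)" unfolding mu using annD[OF g(2)] by simp
      also have "\<dots> = (\<Sum>k<n. (moment_functional (\<lambda>i. y v i k) (l * q))\<^sup>2) +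
          b\<^sup>2 * (\<Sum>k<n. (moment_functional (\<lambda>i. y v i k) q)\<^sup>2)"
        unfolding eq moment_functional_add moment_functional_smult mu by (simp add: power2_eq_square)
      finally have "(\<Sum>k<n. (moment_functional (\<lambda>i. y v i k) (l * q))\<^sup>2) \<le> 0"
        using mult_nonneg_nonneg[OF zero_le_power2[of b] sum_nonneg[of "{..<n}" "\<lambda>k. (moment_functional (\<lambda>i. y v i k) q)\<^sup>2"]]
        by simp
      then have "(\<Sum>k<n. (moment_functional (\<lambda>i. y v i k) (l * q))\<^sup>2) = 0"
        by (intro antisym sum_nonneg) auto
      then show ?thesis using k by (subst (asm) sum_nonneg_eq_0_iff) auto
    qed
    then have "ann (l * q)" unfolding ann_def using y_unit by metis
    moreover have "l * q \<noteq> 0" using l q0 by simp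
    ultimately have "degree g \<le> degree (l * q)" by (intro min)
    then show False using dg l q0 by (simp add: degree_mult_eq)
  qed
  define S where "S = {r. poly g r = 0}"
  have S: "finite S" "card S = degree g"
    unfolding S_def using poly_roots_finite[OF g(1)] real_rooted[OF g(1) nq] by auto
  define W where "W v r = moment_functional (\<mu> v) (lagrange S r)" for v r
  have quad: "moment_functional (\<mu> v) p = (\<Sum>r\<in>S. W v r * poly p r)" for v p
    unfolding W_def
  proof (rule quadrature_formula[OF S(1) g(1)])
    show "moment_functional (\<mu> v) (p div g * g) = 0" unfolding mu using annD[OF g(2)] by simp
  qed (use S in \<open>auto simp: S_def\<close>)
  have Wsq: "W v r = (\<Sum>k<n. (moment_functional (\<lambda>i. y v i k) (lagrange S r))\<^sup>2)" if r: "r \<in> S" for v r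
  proof -
    have "moment_functional (\<mu> v) (lagrange S r * lagrange S r) =
        (\<Sum>s\<in>S. W v s * poly (lagrange S r * lagrange S r) s)" by (rule quad)
    also have "\<dots> = (\<Sum>s\<in>S. if s = r then W v s else 0)"
      by (intro sum.cong refl) (simp add: poly_lagrange[OF S(1)])
    also have "\<dots> = W v r" using S(1) r by simp
    finally show ?thesis unfolding mu by (simp add: power2_eq_square)
  qed
  show ?thesis
  proof (rule that[OF S(1)])
    show "0 \<le> W v r" if "r \<in> S" for v r unfolding Wsq[OF that] by (intro sum_nonneg) simp
    show "\<exists>l<n. 0 < W (\<lambda>i. if i = l then 1 else 0) r" if r: "r \<in> S" for r
    proof -
      have l0: "lagrange S r \<noteq> 0" using poly_lagrange[OF S(1) r, of r] by auto
      have "\<not> ann (lagrange S r)"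
      proof
        assume "ann (lagrange S r)"
        from min[OF l0 this] show False using degree_lagrange[OF S(1) r] S(2) by simp
      qed
      then obtain k l where kl: "k < n" "l < n" "moment_functional (\<lambda>i. (X ^\<^sub>m i) $$ (k, l)) (lagrange S r) \<noteq> 0"
        by (auto simp: ann_def)
      have "0 < W (unit l) r" unfolding Wsq[OF r]
        by (rule sum_pos2[of _ k]) (use kl y_unit in auto)
      then show ?thesis using kl(2) unfolding unit_def by blast
    qed
    show "moment_functional (\<lambda>j. \<Sum>k<n. \<Sum>l<n. v k * (X ^\<^sub>m j) $$ (k, l) * v l) p = (\<Sum>r\<in>S. W v r * poly p r)" for v p
      using quad[of v p] unfolding \<mu>_def .
  qed
qed

text \<open>
  The average of the spectral measures of the basis vectors is a probability measure whose moments are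
  the normalized traces of the powers of \<open>X\<close> and whose atoms are the eigenvalues. So \<open>f\<close>, with these
  moments inserted, is nonnegative at all eigenvalues, and \<open>\<langle>f(X) v, v\<rangle>\<close> is its integral against the
  spectral measure of \<open>v\<close>.
\<close>

lemma psd_if_nonneg_on_measures:
  assumes f: "nonneg_on_measures f" and n: "n \<ge> 1" and X: "X \<in> symmetric_mats n"
  shows "psd n (eval_trace_poly f X)"
proof -
  have Xc: "X \<in> carrier_mat n n" using X by (simp add: symmetric_mats_def)
  obtain S W where S: "finite S" and W0: "\<And>v r. r \<in> S \<Longrightarrow> 0 \<le> W v r"
    and Wpos: "\<And>r. r \<in> S \<Longrightarrow> \<exists>l<n. 0 < W (\<lambda>i. if i = l then 1 else 0) r"
    and W: "\<And>v p. moment_functional (\<lambda>j. \<Sum>k<n. \<Sum>l<n. v k * (X ^\<^sub>m j) $$ (k, l) * v l) p = (\<Sum>r\<in>S. W v r * poly p r)"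
    using spectral_measures[OF X] by blast
  define unit where "unit l = (\<lambda>i::nat. if i = l then 1 else (0::real))" for l
  define w where "w r = (\<Sum>l<n. W (unit l) r) / real n" for r
  define a where "a i = normalized_trace (X ^\<^sub>m (i + 1))" for i
  have trace: "(\<Sum>r\<in>S. w r * r ^ j) = (\<Sum>l<n. (X ^\<^sub>m j) $$ (l, l)) / real n" for j
  proof -
    have u: "(\<Sum>k<n. \<Sum>m<n. unit l k * (X ^\<^sub>m j) $$ (k, m) * unit l m) = (X ^\<^sub>m j) $$ (l, l)" if "l < n" for l j
      using that by (simp add: unit_def if_distrib[of "\<lambda>x. x * _"] if_distrib[of "(*) _"] cong: if_cong)
    have "(\<Sum>r\<in>S. W (unit l) r * r ^ j) = (X ^\<^sub>m j) $$ (l, l)" if "l < n" for l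
      using W[of "unit l" "monom 1 j"] u[OF that] by (simp add: moment_functional_monom poly_monom)
    then have "(\<Sum>l<n. (X ^\<^sub>m j) $$ (l, l)) = (\<Sum>l<n. \<Sum>r\<in>S. W (unit l) r * r ^ j)" by simp
    also have "\<dots> = (\<Sum>r\<in>S. (\<Sum>l<n. W (unit l) r) * r ^ j)"
      by (subst sum.swap) (simp add: sum_distrib_right)
    finally show ?thesis by (simp add: w_def sum_divide_distrib[where A = S])
  qed
  have "0 < w r" if r: "r \<in> S" for r
  proof -
    obtain l where l: "l < n" "0 < W (\<lambda>i. if i = l then 1 else 0) r"
      using Wpos[OF r] by (elim exE conjE) (rule that)
    then have "0 < W (unit l) r" by (simp only: unit_def)
    with l(1) have "0 < (\<Sum>l<n. W (unit l) r)" using W0[OF r] by (intro sum_pos2[of _ l]) auto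
    then show ?thesis using n by (simp add: w_def)
  qed
  moreover have "sum w S = 1" using trace[of 0] n Xc by simp
  ultimately have pw: "prob_weights S w" using S by (simp add: prob_weights_def)
  have "moments S w = a"
    using trace Xc by (intro ext) (simp add: moments_def a_def normalized_trace_def del: power_Suc pow_mat.simps)
  then have pos: "0 \<le> eval_at a r f" if "r \<in> S" for r
    using f pw that unfolding nonneg_on_measures_def by metis
  define p where "p = map_poly (evalT a) f"
  have entry: "eval_trace_poly f X $$ (k, l) = moment_functional (\<lambda>j. (X ^\<^sub>m j) $$ (k, l)) p" if "k < n" "l < n" for k l
    unfolding index_eval_trace_poly[OF Xc that] p_def a_def[symmetric]
    by (subst moment_functional_eq[OF degree_map_poly_le]) (simp add: coeff_map_poly)
  have Ac: "eval_trace_poly f X \<in> carrier_mat n n" using Xc by (simp add: eval_trace_poly_def)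
  have "transpose_mat (eval_trace_poly f X) = eval_trace_poly f X"
  proof (rule eq_matI)
    fix k l assume "k < dim_row (eval_trace_poly f X)" "l < dim_col (eval_trace_poly f X)"
    then have kl: "k < n" "l < n" using Ac by auto
    then have "eval_trace_poly f X $$ (l, k) = eval_trace_poly f X $$ (k, l)"
      unfolding entry[OF kl] entry[OF kl(2,1)] moment_functional_def
      using index_pow_mat_symmetric[OF X kl] by simp
    then show "transpose_mat (eval_trace_poly f X) $$ (k, l) = eval_trace_poly f X $$ (k, l)"
      using Ac kl by simp
  qed (use Ac in auto)
  moreover have "0 \<le> v \<bullet> (eval_trace_poly f X *\<^sub>v v)" if v: "v \<in> carrier_vec n" for v
  proof -
    have "v \<bullet> (eval_trace_poly f X *\<^sub>v v) = (\<Sum>k<n. \<Sum>l<n. v $ k * moment_functional (\<lambda>j. (X ^\<^sub>m j) $$ (k, l)) p * v $ l)"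
      unfolding scalar_prod_mult_mat_vec[OF Ac v] by (intro sum.cong) (auto simp: entry)
    also have "\<dots> = (\<Sum>k<n. \<Sum>l<n. \<Sum>j\<le>degree p. coeff p j * (v $ k * (X ^\<^sub>m j) $$ (k, l) * v $ l))"
      by (simp add: moment_functional_def sum_distrib_left sum_distrib_right mult_ac)
    also have "\<dots> = (\<Sum>k<n. \<Sum>j\<le>degree p. \<Sum>l<n. coeff p j * (v $ k * (X ^\<^sub>m j) $$ (k, l) * v $ l))"
      by (intro sum.cong refl sum.swap)
    also have "\<dots> = (\<Sum>j\<le>degree p. \<Sum>k<n. \<Sum>l<n. coeff p j * (v $ k * (X ^\<^sub>m j) $$ (k, l) * v $ l))"
      by (rule sum.swap)
    also have "\<dots> = moment_functional (\<lambda>j. \<Sum>k<n. \<Sum>l<n. v $ k * (X ^\<^sub>m j) $$ (k, l) * v $ l) p"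
      by (simp add: moment_functional_def sum_distrib_left)
    also have "\<dots> = (\<Sum>r\<in>S. W (\<lambda>i. v $ i) r * poly p r)" by (rule W)
    also have "0 \<le> \<dots>"
    proof (intro sum_nonneg mult_nonneg_nonneg)
      fix r assume r: "r \<in> S"
      show "0 \<le> W (\<lambda>i. v $ i) r" by (rule W0[OF r])
      show "0 \<le> poly p r" using pos[OF r] by (simp add: p_def eval_at_def)
    qed
    finally show ?thesis .
  qed
  ultimately show ?thesis using Ac by (simp add: psd_def symmetric_mats_def)
qed

section \<open>The cone of quotients\<close>

lemma Q0_sum_listI: "\<forall>gs\<in>set gss. set gs \<subseteq> squares_and_traces \<Longrightarrow> sum_list (map prod_list gss) \<in> Q0"
  unfolding Q0_def by blast

lemma Q0_0: "0 \<in> Q0"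
  using Q0_sum_listI[of "[]"] by simp

lemma Q0_factor: "g \<in> squares_and_traces \<Longrightarrow> g \<in> Q0"
  using Q0_sum_listI[of "[[g]]"] by simp

lemma Q0_square: "g\<^sup>2 \<in> Q0"
  by (rule Q0_factor) (auto simp: squares_and_traces_def)

lemma Q0_Tr_square: "[:Tr (g\<^sup>2):] \<in> Q0"
  by (rule Q0_factor) (auto simp: squares_and_traces_def)

lemma Q0_1: "1 \<in> Q0"
  using Q0_square[of 1] by simp

lemma Q0_add:
  assumes "p \<in> Q0" "q \<in> Q0"
  shows "p + q \<in> Q0"
proof -
  obtain gss hss where "p = sum_list (map prod_list gss)" "\<forall>gs\<in>set gss. set gs \<subseteq> squares_and_traces"
    "q = sum_list (map prod_list hss)" "\<forall>gs\<in>set hss. set gs \<subseteq> squares_and_traces"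
    using assms by (auto simp: Q0_def)
  then show ?thesis using Q0_sum_listI[of "gss @ hss"] by auto
qed

lemma Q0_mult:
  assumes "p \<in> Q0" "q \<in> Q0"
  shows "p * q \<in> Q0"
proof -
  obtain gss where p: "p = sum_list (map prod_list gss)" "\<forall>gs\<in>set gss. set gs \<subseteq> squares_and_traces"
    using assms(1) by (auto simp: Q0_def)
  obtain hss where q: "q = sum_list (map prod_list hss)" "\<forall>gs\<in>set hss. set gs \<subseteq> squares_and_traces"
    using assms(2) by (auto simp: Q0_def)
  have one: "prod_list gs * q \<in> Q0" if "set gs \<subseteq> squares_and_traces" for gs
  proof -
    have "prod_list gs * q = sum_list (map prod_list (map ((@) gs) hss))"
      unfolding q(1) by (induction hss) (simp_all add: distrib_left)
    moreover have "\<forall>hs\<in>set (map ((@) gs) hss). set hs \<subseteq> squares_and_traces" using that q(2) by auto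
    ultimately show ?thesis using Q0_sum_listI by metis
  qed
  show ?thesis unfolding p(1) using p(2)
    by (induction gss) (auto simp: distrib_right Q0_0 intro!: Q0_add one)
qed

definition quotient_cone :: "trace_poly fract set" where
  "quotient_cone = {Fract r q | r q. r \<in> Q0 \<and> q \<in> Q0 \<and> q \<noteq> 0}"

lemma quotient_coneI: "r \<in> Q0 \<Longrightarrow> q \<in> Q0 \<Longrightarrow> q \<noteq> 0 \<Longrightarrow> Fract r q \<in> quotient_cone"
  by (auto simp: quotient_cone_def)

lemma quotient_cone_nonneg:
  assumes "Fract f 1 \<in> quotient_cone"
  shows "nonneg_on_measures f"
proof -
  obtain r q where rq: "Fract f 1 = Fract r q" "r \<in> Q0" "q \<in> Q0" "q \<noteq> 0"
    using assms by (auto simp: quotient_cone_def)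
  then have "f * q = r" by (simp add: eq_fract)
  then show ?thesis using quotient_nonneg_on_measures rq by blast
qed

lemma square_in_quotient_cone: "z\<^sup>2 \<in> quotient_cone"
proof -
  obtain a b where z: "z = Fract a b" "b \<noteq> 0" by (cases z) auto
  have "z\<^sup>2 = Fract (a\<^sup>2) (b\<^sup>2)" using z by (simp add: power2_eq_square)
  then show ?thesis using z Q0_square[of a] Q0_square[of b] by (auto intro!: quotient_coneI)
qed

text \<open>
  A trace polynomial in this cone is nonnegative on measures, which \<open>- 1\<close> is not.
\<close>

lemma quotient_cone_proper: "proper_cone quotient_cone"
  unfolding proper_cone_def
proof (intro conjI ballI)
  show "1 \<in> quotient_cone" using square_in_quotient_cone[of 1] by simp
  show "- 1 \<notin> quotient_cone"
  proof
    assume "- 1 \<in> quotient_cone"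
    moreover have "- 1 = Fract (- 1) (1 :: trace_poly)" by (simp add: One_fract_def)
    ultimately have "nonneg_on_measures (- 1)" using quotient_cone_nonneg by metis
    moreover have "prob_weights {0} (\<lambda>_. 1)" by (simp add: prob_weights_def)
    ultimately have "0 \<le> eval_at (moments {0} (\<lambda>_. 1)) 0 (- 1)"
      unfolding nonneg_on_measures_def by blast
    then show False by (simp add: eval_at.hom_uminus)
  qed
  fix x assume "x \<in> quotient_cone"
  then obtain r q where x: "x = Fract r q" "r \<in> Q0" "q \<in> Q0" "q \<noteq> 0" by (auto simp: quotient_cone_def)
  show "inverse x \<in> quotient_cone"
  proof (cases "r = 0")
    case True
    then have "x = 0" using x by (simp add: Zero_fract_def eq_fract)
    then show ?thesis using square_in_quotient_cone[of 0] by simp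
  next
    case False
    then show ?thesis using x by (auto intro: quotient_coneI)
  qed
  fix y assume "y \<in> quotient_cone"
  then obtain s t where y: "y = Fract s t" "s \<in> Q0" "t \<in> Q0" "t \<noteq> 0" by (auto simp: quotient_cone_def)
  have "x + y = Fract (r * t + s * q) (q * t)" "x * y = Fract (r * s) (q * t)" using x y by simp_all
  then show "x + y \<in> quotient_cone" "x * y \<in> quotient_cone"
    using x y by (auto intro!: quotient_coneI Q0_add Q0_mult)
  show "(x - y)\<^sup>2 \<in> quotient_cone" by (rule square_in_quotient_cone)
qed

text \<open>
  Every \<open>z\<close> is \<open>((z + 1) / 2)^2 - ((z - 1) / 2)^2\<close>, and the cone contains all squares.
\<close>

lemma difference_in_quotient_cone: "\<exists>b\<in>quotient_cone. \<exists>c\<in>quotient_cone. z = b - c"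
proof -
  have "Fract (2 :: trace_poly) 1 \<noteq> 0" unfolding Zero_fract_def by (subst eq_fract) auto
  moreover have "Fract (2 :: trace_poly) 1 = 2" using of_nat_fract[of 2] by simp
  ultimately have two: "(2 :: trace_poly fract) \<noteq> 0" by (simp only: not_False_eq_True)
  define h where "h = inverse (2 :: trace_poly fract)"
  have h: "h + h = 1" using right_inverse[OF two] by (simp only: h_def mult_2)
  have "((z + 1) * h)\<^sup>2 - ((z - 1) * h)\<^sup>2 = z * (h + h) * (h + h)"
    by (simp add: power2_eq_square algebra_simps)
  then have "z = ((z + 1) * h)\<^sup>2 - ((z - 1) * h)\<^sup>2" unfolding h by simp
  then show ?thesis using square_in_quotient_cone by blast
qed

section \<open>A real closed field ordered by a counterexample\<close>

definition counterexample :: "trace_poly \<Rightarrow> bool" where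
  "counterexample f \<longleftrightarrow> nonneg_on_measures f \<and> Fract f 1 \<notin> quotient_cone"

lemma proper_cone_image:
  fixes \<iota> :: "'a::field \<Rightarrow> 'b::field"
  assumes P: "proper_cone P" and hom: "comm_ring_hom \<iota>" and inv: "\<And>x. \<iota> (inverse x) = inverse (\<iota> x)"
    and inj: "\<And>x y. \<iota> x = \<iota> y \<Longrightarrow> x = y"
  shows "proper_cone (\<iota> ` P)"
proof -
  interpret comm_ring_hom \<iota> by fact
  note D = proper_coneD[OF P]
  show ?thesis unfolding proper_cone_def
  proof (intro conjI ballI)
    show "1 \<in> \<iota> ` P" using D(1) by (metis hom_one imageI)
    show "- 1 \<notin> \<iota> ` P"
    proof
      assume "- 1 \<in> \<iota> ` P"
      then obtain x where "x \<in> P" "\<iota> x = \<iota> (- 1)" by (auto simp: hom_uminus)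
      then show False using inj D(2) by metis
    qed
    fix x assume "x \<in> \<iota> ` P"
    then obtain a where a: "x = \<iota> a" "a \<in> P" by blast
    show "inverse x \<in> \<iota> ` P" unfolding a(1) inv[symmetric] using D(7) a(2) by blast
    fix y assume "y \<in> \<iota> ` P"
    then obtain b where b: "y = \<iota> b" "b \<in> P" by blast
    show "x + y \<in> \<iota> ` P" "x * y \<in> \<iota> ` P" "(x - y)\<^sup>2 \<in> \<iota> ` P"
      unfolding a(1) b(1) hom_add[symmetric] hom_mult[symmetric] hom_minus[symmetric] hom_power[symmetric]
      using D(4-6) a(2) b(2) by blast+
  qed
qed

lemma to_ac_hom: "comm_ring_hom to_ac"
  by unfold_locales simp_all

text \<open>
  A type cannot depend on a polynomial \<open>f\<close>. The real closed field is therefore built from a choice: if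
  the theorem has counterexamples at all, then one of them is negative in the chosen ordering. Without
  counterexamples the choice is any ordering that extends the quotients.
\<close>

definition model_cone :: "trace_poly fract alg_closure set" where
  "model_cone = (SOME P. maximal_cone P \<and> to_ac ` quotient_cone \<subseteq> P \<and>
     ((\<exists>f. counterexample f) \<longrightarrow> (\<exists>f. counterexample f \<and> - to_ac (Fract f 1) \<in> P)))"

lemma model_cone:
  shows model_cone_maximal: "maximal_cone model_cone"
    and model_cone_quotients: "to_ac ` quotient_cone \<subseteq> model_cone"
    and model_cone_counterexample: "\<exists>f. counterexample f \<Longrightarrow> \<exists>f. counterexample f \<and> - to_ac (Fract f 1) \<in> model_cone"
proof -
  have "\<exists>P. proper_cone P \<and> quotient_cone \<subseteq> P \<and>
     ((\<exists>f. counterexample f) \<longrightarrow> (\<exists>f. counterexample f \<and> - Fract f 1 \<in> P))"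
  proof (cases "\<exists>f. counterexample f")
    case False
    then show ?thesis using quotient_cone_proper by blast
  next
    case True
    then obtain f where f: "counterexample f" ..
    obtain b c where bc: "b \<in> quotient_cone" "c \<in> quotient_cone" "Fract f 1 = b - c"
      using difference_in_quotient_cone[of "Fract f 1"] by blast
    define P where "P = {p - (b - c) * q | p q. p \<in> quotient_cone \<and> q \<in> quotient_cone}"
    have "proper_cone P" unfolding P_def
      by (rule proper_cone_adjoin[OF quotient_cone_proper bc(1,2)]) (use f bc in \<open>simp add: counterexample_def\<close>)
    moreover have "quotient_cone \<subseteq> P"
    proof
      fix p assume "p \<in> quotient_cone"
      moreover have "p = p - (b - c) * 0" by simp
      ultimately show "p \<in> P" unfolding P_def using proper_coneD(3)[OF quotient_cone_proper] by blast
    qed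
    moreover have "- Fract f 1 = 0 - (b - c) * 1" by (simp add: bc(3) del: minus_fract)
    then have "- Fract f 1 \<in> P" unfolding P_def
      using proper_coneD(1,3)[OF quotient_cone_proper] by blast
    ultimately show ?thesis using f by blast
  qed
  then obtain P where P: "proper_cone P" "quotient_cone \<subseteq> P"
    "(\<exists>f. counterexample f) \<longrightarrow> (\<exists>f. counterexample f \<and> - Fract f 1 \<in> P)" by blast
  have "proper_cone (to_ac ` P)" by (rule proper_cone_image[OF P(1) to_ac_hom]) simp_all
  then obtain M where M: "to_ac ` P \<subseteq> M" "maximal_cone M" using maximal_cone_exists by blast
  have "\<exists>P. maximal_cone P \<and> to_ac ` quotient_cone \<subseteq> P \<and>
     ((\<exists>f. counterexample f) \<longrightarrow> (\<exists>f. counterexample f \<and> - to_ac (Fract f 1) \<in> P))"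
  proof (intro exI[of _ M] conjI impI)
    show "to_ac ` quotient_cone \<subseteq> M" using M(1) P(2) by blast
    assume "\<exists>f. counterexample f"
    then obtain f where "counterexample f" "- Fract f 1 \<in> P" using P(3) by blast
    moreover from this have "to_ac (- Fract f 1) \<in> M" using M(1) by blast
    ultimately show "\<exists>f. counterexample f \<and> - to_ac (Fract f 1) \<in> M" by (auto simp del: minus_fract)
  qed (rule M(2))
  from someI_ex[OF this, folded model_cone_def]
  show "maximal_cone model_cone" "to_ac ` quotient_cone \<subseteq> model_cone"
    "\<exists>f. counterexample f \<Longrightarrow> \<exists>f. counterexample f \<and> - to_ac (Fract f 1) \<in> model_cone" by blast+
qed

lemma model_cone_proper: "proper_cone model_cone"
  using model_cone_maximal by (simp add: maximal_cone_def)

lemmas model_coneD = proper_coneD[OF model_cone_proper]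

text \<open>
  The real closed field that is ordered by the chosen maximal cone, as a subfield of an algebraic
  closure of the field of fractions of the trace polynomials.
\<close>

typedef trace_rcf = "{x. x \<in> model_cone \<or> - x \<in> model_cone}"
  using model_coneD(3) by auto

setup_lifting type_definition_trace_rcf

lemma signed_add:
  assumes "x \<in> model_cone \<or> - x \<in> model_cone" "y \<in> model_cone \<or> - y \<in> model_cone"
  shows "x + y \<in> model_cone \<or> - (x + y) \<in> model_cone"
proof -
  have e: "- (x + y) = - x + - y" "x - - y = x + y" "y - - x = x + y" "- y - x = - (x + y)" "- x - y = - (x + y)"
    by simp_all
  consider "x \<in> model_cone" "y \<in> model_cone" | "x \<in> model_cone" "- y \<in> model_cone"
    | "- x \<in> model_cone" "y \<in> model_cone" | "- x \<in> model_cone" "- y \<in> model_cone"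
    using assms by blast
  then show ?thesis
  proof cases
    case 1
    then show ?thesis using model_coneD(4) by blast
  next
    case 2
    from maximal_cone_total[OF model_cone_maximal this] show ?thesis unfolding e .
  next
    case 3
    from maximal_cone_total[OF model_cone_maximal this(2,1)] show ?thesis unfolding e .
  next
    case 4
    then have "- x + - y \<in> model_cone" by (rule model_coneD(4))
    then show ?thesis unfolding e(1) ..
  qed
qed

lemma signed_uminus:
  "x \<in> model_cone \<or> - x \<in> model_cone \<Longrightarrow> - x \<in> model_cone \<or> - (- x) \<in> model_cone"
  by auto

lemma signed_mult:
  assumes "x \<in> model_cone \<or> - x \<in> model_cone" "y \<in> model_cone \<or> - y \<in> model_cone"
  shows "x * y \<in> model_cone \<or> - (x * y) \<in> model_cone"
  using assms model_coneD(5)[of x y] model_coneD(5)[of "- x" y] model_coneD(5)[of x "- y"] model_coneD(5)[of "- x" "- y"]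
  by auto

lemma signed_inverse:
  "x \<in> model_cone \<or> - x \<in> model_cone \<Longrightarrow> inverse x \<in> model_cone \<or> - inverse x \<in> model_cone"
  using model_coneD(7)[of x] model_coneD(7)[of "- x"] by auto

instantiation trace_rcf :: linordered_field
begin

lift_definition zero_trace_rcf :: trace_rcf is 0 using model_coneD(3) by simp
lift_definition one_trace_rcf :: trace_rcf is 1 using model_coneD(1) by simp
lift_definition plus_trace_rcf :: "trace_rcf \<Rightarrow> trace_rcf \<Rightarrow> trace_rcf" is "(+)" by (rule signed_add)
lift_definition uminus_trace_rcf :: "trace_rcf \<Rightarrow> trace_rcf" is uminus by (rule signed_uminus)
lift_definition minus_trace_rcf :: "trace_rcf \<Rightarrow> trace_rcf \<Rightarrow> trace_rcf" is "(-)"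
  unfolding diff_conv_add_uminus by (rule signed_add[OF _ signed_uminus])
lift_definition times_trace_rcf :: "trace_rcf \<Rightarrow> trace_rcf \<Rightarrow> trace_rcf" is "(*)" by (rule signed_mult)
lift_definition inverse_trace_rcf :: "trace_rcf \<Rightarrow> trace_rcf" is inverse by (rule signed_inverse)
lift_definition divide_trace_rcf :: "trace_rcf \<Rightarrow> trace_rcf \<Rightarrow> trace_rcf" is "(/)"
  unfolding divide_inverse by (rule signed_mult[OF _ signed_inverse])
lift_definition less_eq_trace_rcf :: "trace_rcf \<Rightarrow> trace_rcf \<Rightarrow> bool" is "\<lambda>x y. y - x \<in> model_cone" .
definition less_trace_rcf :: "trace_rcf \<Rightarrow> trace_rcf \<Rightarrow> bool" where "less_trace_rcf x y \<longleftrightarrow> x \<le> y \<and> \<not> y \<le> x"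
definition abs_trace_rcf :: "trace_rcf \<Rightarrow> trace_rcf" where "abs_trace_rcf x = (if x < 0 then - x else x)"
definition sgn_trace_rcf :: "trace_rcf \<Rightarrow> trace_rcf" where
  "sgn_trace_rcf x = (if x = 0 then 0 else if 0 < x then 1 else - 1)"

instance
proof
  fix a b c :: trace_rcf
  show "a + b + c = a + (b + c)" by transfer (simp add: add.assoc)
  show "a + b = b + a" by transfer (simp add: add.commute)
  show "0 + a = a" by transfer simp
  show "- a + a = 0" by transfer simp
  show "a - b = a + - b" by transfer simp
  show "a + b - a = b" by transfer simp
  show "a - b - c = a - (b + c)" by transfer (simp add: diff_diff_eq)
  show "0 * a = 0" by transfer simp
  show "a * 0 = 0" by transfer simp
  show "a * b * c = a * (b * c)" by transfer (simp add: mult.assoc)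
  show "a * b = b * a" by transfer (simp add: mult.commute)
  show "1 * a = a" by transfer simp
  show "(a + b) * c = a * c + b * c" by transfer (simp add: distrib_right)
  show "(0::trace_rcf) \<noteq> 1" by transfer simp
  show "a \<noteq> 0 \<Longrightarrow> inverse a * a = 1" by transfer simp
  show "a div b = a * inverse b" by transfer (simp add: divide_inverse)
  show "inverse 0 = (0::trace_rcf)" by transfer simp
  show "(a < b) = (a \<le> b \<and> \<not> b \<le> a)" by (rule less_trace_rcf_def)
  show "a \<le> a" by transfer (simp add: model_coneD(3))
  show "a \<le> b \<Longrightarrow> b \<le> c \<Longrightarrow> a \<le> c"
  proof transfer
    fix a b c assume "b - a \<in> model_cone" "c - b \<in> model_cone"
    from model_coneD(4)[OF this(2,1)] show "c - a \<in> model_cone" by simp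
  qed
  show anti: "a \<le> b \<Longrightarrow> b \<le> a \<Longrightarrow> a = b" for a b :: trace_rcf
  proof transfer
    fix a b assume "b - a \<in> model_cone" "a - b \<in> model_cone"
    then have "b - a = 0" using proper_cone_antisym[OF model_cone_proper, of "b - a"] by simp
    then show "a = b" by simp
  qed
  show "a \<le> b \<or> b \<le> a"
  proof transfer
    fix a b assume "a \<in> model_cone \<or> - a \<in> model_cone" "b \<in> model_cone \<or> - b \<in> model_cone"
    from signed_add[OF this(2) signed_uminus[OF this(1)]] show "b - a \<in> model_cone \<or> a - b \<in> model_cone"
      by simp
  qed
  show "a \<le> b \<Longrightarrow> c + a \<le> c + b" by transfer simp
  show "a < b \<Longrightarrow> 0 < c \<Longrightarrow> c * a < c * b"
  proof -
    assume ab: "a < b" and c: "0 < c"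
    have "a \<le> b" "0 \<le> c" using ab c by (simp_all add: less_trace_rcf_def)
    then have le: "c * a \<le> c * b"
    proof transfer
      fix a b c assume "b - a \<in> model_cone" "c - 0 \<in> model_cone"
      then have "c * (b - a) \<in> model_cone" using model_coneD(5) by simp
      then show "c * b - c * a \<in> model_cone" by (simp add: right_diff_distrib)
    qed
    have "a \<noteq> b" "c \<noteq> 0" using ab c by (auto simp: less_trace_rcf_def)
    then have "c * a \<noteq> c * b" by transfer simp
    then have "\<not> c * b \<le> c * a" using anti[OF le] by blast
    then show ?thesis using le by (simp add: less_trace_rcf_def)
  qed
  show "\<bar>a\<bar> = (if a < 0 then - a else a)" by (rule abs_trace_rcf_def)
  show "sgn a = (if a = 0 then 0 else if 0 < a then 1 else - 1)" by (rule sgn_trace_rcf_def)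
qed

end

lemma Rep_trace_rcf_hom: "comm_ring_hom Rep_trace_rcf"
  by unfold_locales (simp_all add: zero_trace_rcf.rep_eq one_trace_rcf.rep_eq plus_trace_rcf.rep_eq times_trace_rcf.rep_eq)

lemma Rep_trace_rcf_image: "Rep_trace_rcf ` {0..} = model_cone"
proof (intro equalityI subsetI)
  fix x assume "x \<in> Rep_trace_rcf ` {0..}"
  then show "x \<in> model_cone" by (auto simp: less_eq_trace_rcf.rep_eq zero_trace_rcf.rep_eq)
next
  fix x assume x: "x \<in> model_cone"
  then have "Rep_trace_rcf (Abs_trace_rcf x) = x" by (intro Abs_trace_rcf_inverse) simp
  then show "x \<in> Rep_trace_rcf ` {0..}"
    using x by (intro image_eqI[of _ _ "Abs_trace_rcf x"]) (auto simp: less_eq_trace_rcf.rep_eq zero_trace_rcf.rep_eq)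
qed

lemma trace_rcf_ivt:
  fixes a b :: trace_rcf
  assumes "a < b" "(\<Sum>k\<le>n. c k * a ^ k) < 0" "0 < (\<Sum>k\<le>n. c k * b ^ k)"
  shows "\<exists>x. a < x \<and> x < b \<and> (\<Sum>k\<le>n. c k * x ^ k) = 0"
proof -
  define p where "p = (\<Sum>k\<le>n. monom (c k) k)"
  have p: "poly p x = (\<Sum>k\<le>n. c k * x ^ k)" for x by (simp add: p_def poly_sum poly_monom)
  have "\<exists>x. a < x \<and> x < b \<and> poly p x = 0"
  proof (rule maximal_cone_ivt[OF Rep_trace_rcf_hom])
    show "\<And>x. Rep_trace_rcf x = 0 \<Longrightarrow> x = 0" by (metis Rep_trace_rcf_inject zero_trace_rcf.rep_eq)
    show "maximal_cone (Rep_trace_rcf ` {0..})" unfolding Rep_trace_rcf_image by (rule model_cone_maximal)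
    show "poly p a * poly p b < 0" unfolding p using assms by (intro mult_neg_pos)
  qed (rule assms(1))
  then show ?thesis unfolding p .
qed

instance trace_rcf :: real_closed_field
  by intro_classes (rule trace_rcf_ivt)

lemma signed_to_ac: "to_ac z \<in> model_cone \<or> - to_ac z \<in> model_cone"
proof -
  obtain b c where bc: "b \<in> quotient_cone" "c \<in> quotient_cone" "z = b - c"
    using difference_in_quotient_cone[of z] by blast
  then have "to_ac b \<in> model_cone" "to_ac c \<in> model_cone" using model_cone_quotients by auto
  from maximal_cone_total[OF model_cone_maximal this] show ?thesis using bc(3) by simp
qed

definition model_embedding :: "trace_poly \<Rightarrow> trace_rcf" where
  "model_embedding f = Abs_trace_rcf (to_ac (Fract f 1))"

lemma Rep_model_embedding: "Rep_trace_rcf (model_embedding f) = to_ac (Fract f 1)"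
  unfolding model_embedding_def by (rule Abs_trace_rcf_inverse) (use signed_to_ac in simp)

lemma model_embedding_hom: "comm_ring_hom model_embedding"
proof unfold_locales
  show "model_embedding (x + y) = model_embedding x + model_embedding y" for x y
    unfolding Rep_trace_rcf_inject[symmetric] plus_trace_rcf.rep_eq Rep_model_embedding to_ac_add[symmetric]
    by simp
  show "model_embedding (x * y) = model_embedding x * model_embedding y" for x y
    unfolding Rep_trace_rcf_inject[symmetric] times_trace_rcf.rep_eq Rep_model_embedding to_ac_mult[symmetric]
    by simp
  show "model_embedding 1 = 1"
    unfolding Rep_trace_rcf_inject[symmetric] one_trace_rcf.rep_eq Rep_model_embedding One_fract_def[symmetric]
    by simp
  show "model_embedding 0 = 0"
    unfolding Rep_trace_rcf_inject[symmetric] zero_trace_rcf.rep_eq Rep_model_embedding Zero_fract_def[symmetric]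
    by simp
qed

interpretation model_embedding: comm_ring_hom model_embedding by (rule model_embedding_hom)

lemma model_embedding_eq_0: "model_embedding f = 0 \<Longrightarrow> f = 0"
proof -
  assume "model_embedding f = 0"
  then have "to_ac (Fract f 1) = 0" by (metis Rep_model_embedding zero_trace_rcf.rep_eq)
  then have "Fract f 1 = 0" by (simp only: to_ac_eq_0_iff)
  then show "f = 0" unfolding Zero_fract_def by (subst (asm) eq_fract) auto
qed

lemma model_embedding_Q0_nonneg: "g \<in> Q0 \<Longrightarrow> 0 \<le> model_embedding g"
proof -
  assume "g \<in> Q0"
  then have "Fract g 1 \<in> quotient_cone" using Q0_1 by (intro quotient_coneI) auto
  then have "to_ac (Fract g 1) \<in> model_cone" using model_cone_quotients by blast
  then show ?thesis by (simp add: less_eq_trace_rcf.rep_eq zero_trace_rcf.rep_eq Rep_model_embedding)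
qed

lemma model_embedding_counterexample:
  assumes "\<exists>f. counterexample f"
  shows "\<exists>f. counterexample f \<and> model_embedding f < 0"
proof -
  obtain f where f: "counterexample f" "- to_ac (Fract f 1) \<in> model_cone"
    using model_cone_counterexample[OF assms] by blast
  have "model_embedding f \<le> 0" using f(2) by (simp add: less_eq_trace_rcf.rep_eq zero_trace_rcf.rep_eq Rep_model_embedding)
  moreover have "f \<noteq> 0"
  proof
    assume "f = 0"
    then have "Fract f 1 \<in> quotient_cone" using Q0_0 Q0_1 by (intro quotient_coneI) auto
    then show False using f(1) by (simp add: counterexample_def)
  qed
  then have "model_embedding f \<noteq> 0" using model_embedding_eq_0 by blast
  ultimately show ?thesis using f(1) by (auto simp: less_le)
qed

text \<open>
  A positive constant is the square of a constant and therefore belongs to \<open>Q0\<close>.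
\<close>

lemma model_embedding_const: "same_sign (model_embedding [:const_poly c:]) c"
proof -
  have sq: "0 < model_embedding [:const_poly d:]" if "0 < d" for d
  proof -
    have "const_poly d = (const_poly (sqrt d))\<^sup>2"
      using that by (simp add: power2_eq_square Poly_Mapping.mult_single)
    then have "[:const_poly d:] = [:const_poly (sqrt d):]\<^sup>2" by (simp add: power2_eq_square)
    then have "0 \<le> model_embedding [:const_poly d:]"
      using model_embedding_Q0_nonneg[OF Q0_square] by metis
    moreover have "const_poly d \<noteq> 0" using that by (metis Poly_Mapping.lookup_single_eq lookup_zero less_irrefl)
    then have "model_embedding [:const_poly d:] \<noteq> 0" using model_embedding_eq_0[of "[:const_poly d:]"] by auto
    ultimately show ?thesis by simp
  qed
  have neg: "[:const_poly c:] = - [:const_poly (- c):]" by (simp add: Poly_Mapping.single_uminus)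
  consider "0 < c" | "c = 0" | "0 < - c" by linarith
  then show ?thesis
  proof cases
    case 1
    with sq[OF 1] show ?thesis by (auto simp: same_sign_def)
  next
    case 2
    then show ?thesis by simp
  next
    case 3
    with sq[OF 3] show ?thesis unfolding neg model_embedding.hom_uminus by (auto simp: same_sign_def)
  qed
qed

text \<open>
  The variable \<open>x\<close> is eliminated by one more use of \<open>sign_transfer\<close>, with the pure trace polynomials as
  the coefficient ring.
\<close>

lemma real_point_with_model_signs:
  assumes G: "finite G"
  shows "\<exists>a c. \<forall>g\<in>G. same_sign (model_embedding g) (eval_at a c g)"
proof -
  define \<phi> where "\<phi> p = model_embedding [:p:]" for p
  have hom: "comm_ring_hom \<phi>"
  proof unfold_locales
    show "\<phi> (x + y) = \<phi> x + \<phi> y" for x y by (simp add: \<phi>_def model_embedding.hom_add[symmetric])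
    show "\<phi> (x * y) = \<phi> x * \<phi> y" for x y by (simp add: \<phi>_def model_embedding.hom_mult[symmetric] mult.commute)
    show "\<phi> 1 = 1" by (simp add: \<phi>_def one_pCons[symmetric])
  qed (simp add: \<phi>_def)
  interpret \<phi>: comm_ring_hom \<phi> by (rule hom)
  have inj: "p = 0" if "\<phi> p = 0" for p using model_embedding_eq_0[of "[:p:]"] that by (simp add: \<phi>_def)
  define \<xi> where "\<xi> = model_embedding [:0, 1:]"
  have ev: "poly (map_poly \<phi> g) \<xi> = model_embedding g" for g
  proof (induction g)
    case (pCons p g)
    have "pCons p g = [:p:] + [:0, 1:] * g" by simp
    then have "model_embedding (pCons p g) = \<phi> p + \<xi> * model_embedding g"
      unfolding \<phi>_def \<xi>_def by (metis model_embedding.hom_add model_embedding.hom_mult)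
    then show ?case using pCons by (simp add: \<phi>.map_poly_pCons_hom)
  qed simp
  have "sign_transfer \<phi> UNIV TYPE(real) G"
    by (rule sign_transfer[OF hom inj _ G]) (auto simp: subring_set_def polys_over_def)
  then obtain H where H: "finite H" and
    T: "\<forall>\<psi>::pure_trace_poly \<Rightarrow> real. comm_ring_hom \<psi> \<longrightarrow> (\<forall>h\<in>H. same_sign (\<phi> h) (\<psi> h)) \<longrightarrow>
      (\<exists>T. diagram G (map_poly \<phi>) (map_poly \<psi>) T)"
    unfolding sign_transfer_def by (elim exE conjE) (rule that)
  obtain n where n: "H \<subseteq> polys_in n" using polys_in_finite[OF H] by blast
  have "same_sign (\<phi> (const_poly c)) c" for c unfolding \<phi>_def by (rule model_embedding_const)
  from artin_lang[OF hom inj this H n] obtain a where a: "\<forall>h\<in>H. same_sign (\<phi> h) (evalT a h)" ..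
  obtain T where T: "diagram G (map_poly \<phi>) (map_poly (evalT a)) T"
    using T[rule_format, OF evalT_hom] a by blast
  obtain c where c: "matched T \<xi> c" using matched_exists[OF diagramD(1,2)[OF T]] by blast
  have "same_sign (model_embedding g) (eval_at a c g)" if "g \<in> G" for g
    using diagramD(5)[OF T c that] unfolding ev eval_at_def .
  then show ?thesis by blast
qed

section \<open>Orthogonal trace polynomials\<close>

lemma Tr_0 [simp]: "Tr 0 = 0"
  by (simp add: Tr_def)

lemma Tr_diff: "Tr (f - g) = Tr f - Tr g"
  using Tr_add[of f "- g"] Tr_smult[of "- 1" g] by simp

lemma Tr_sum: "Tr (sum f A) = (\<Sum>i\<in>A. Tr (f i))"
  by (induction A rule: infinite_finite_induct) (simp_all add: Tr_add)

text \<open>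
  Gram-Schmidt orthogonalisation of the powers of \<open>x\<close> with respect to \<open>Tr(g h)\<close>, without denominators:
  the product \<open>c\<close> of all earlier \<open>Tr(g\<^sub>i^2)\<close> multiplies \<open>x^k\<close> and absorbs the divisions.
\<close>

lemma orthogonal_trace_polys:
  "\<exists>g :: nat \<Rightarrow> trace_poly. \<forall>j<k. degree (g j) = j \<and> g j \<noteq> 0 \<and> (\<forall>i<j. Tr (g j * g i) = 0)"
proof (induction k)
  case (Suc k)
  then obtain g :: "nat \<Rightarrow> trace_poly" where
    g: "\<And>j. j < k \<Longrightarrow> degree (g j) = j" "\<And>j. j < k \<Longrightarrow> g j \<noteq> 0" "\<And>i j. j < k \<Longrightarrow> i < j \<Longrightarrow> Tr (g j * g i) = 0"
    by blast
  define D where "D i = Tr ((g i)\<^sup>2)" for i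
  have D: "D i \<noteq> 0" if "i < k" for i unfolding D_def by (rule Tr_square_nonzero[OF g(2)[OF that]])
  define c where "c = prod D {..<k}"
  have c: "c \<noteq> 0" unfolding c_def using D by simp
  define b where "b i = Tr (monom 1 k * g i) * prod D ({..<k} - {i})" for i
  define h where "h = smult c (monom 1 k) - (\<Sum>i<k. smult (b i) (g i))"
  have top: "degree (smult c (monom 1 k)) = k" "smult c (monom 1 k) \<noteq> 0"
    using c by (simp_all add: smult_monom degree_monom_eq)
  have "degree h = k \<and> h \<noteq> 0"
  proof (cases "k = 0")
    case True
    then show ?thesis using top by (simp add: h_def)
  next
    case False
    have "degree (\<Sum>i<k. smult (b i) (g i)) \<le> k - 1"
    proof (rule degree_sum_le)
      fix i assume "i \<in> {..<k}"
      then show "degree (smult (b i) (g i)) \<le> k - 1" using g(1)[of i] degree_smult_le[of "b i" "g i"] by simp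
    qed simp
    then have "degree (- (\<Sum>i<k. smult (b i) (g i))) < degree (smult c (monom 1 k))"
      using False top by simp
    then have "degree h = k" unfolding h_def diff_conv_add_uminus by (subst degree_add_eq_left) (use top in auto)
    then show ?thesis using False by auto
  qed
  moreover have "Tr (h * g i) = 0" if i: "i < k" for i
  proof -
    have off: "Tr (g l * g i) = 0" if "l < k" "l \<noteq> i" for l
      using g(3)[of l i] g(3)[of i l] that i by (cases l i rule: linorder_cases) (auto simp: mult.commute)
    have "Tr (h * g i) = c * Tr (monom 1 k * g i) - (\<Sum>l<k. b l * Tr (g l * g i))"
      by (simp add: h_def left_diff_distrib sum_distrib_right Tr_diff Tr_smult Tr_sum)
    also have "(\<Sum>l<k. b l * Tr (g l * g i)) = (\<Sum>l<k. if l = i then b i * D i else 0)"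
      using off by (intro sum.cong) (auto simp: D_def power2_eq_square)
    also have "\<dots> = b i * D i" using i by simp
    also have "\<dots> = c * Tr (monom 1 k * g i)"
      unfolding b_def c_def using i by (subst prod.remove[of "{..<k}" i D]) (auto simp: mult_ac)
    finally show ?thesis by simp
  qed
  ultimately have "\<forall>j<Suc k. degree ((g(k := h)) j) = j \<and> (g(k := h)) j \<noteq> 0 \<and> (\<forall>i<j. Tr ((g(k := h)) j * (g(k := h)) i) = 0)"
    using g by (auto simp: less_Suc_eq)
  then show ?case by blast
qed simp

section \<open>The equivalence\<close>

text \<open>
  The signs of \<open>f\<close>, of \<open>Tr(g\<^sub>j^2)\<close> and of the leading coefficients of an orthogonal family \<open>g\<close> are realised
  at a real point \<open>(c; a)\<close>. There the \<open>g\<^sub>j\<close> specialise to real polynomials \<open>e\<^sub>j\<close> of degree \<open>j\<close> that are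
  orthogonal and have positive norm for the moment functional of \<open>a\<close>, so quadrature yields a measure
  with atom \<open>c\<close> that has the same moments as far as \<open>f\<close> is concerned.
\<close>

lemma no_counterexample: "\<not> counterexample f"
proof
  assume "counterexample f"
  then obtain f where f: "nonneg_on_measures f" "model_embedding f < 0"
    using model_embedding_counterexample unfolding counterexample_def by blast
  obtain N where "coeff f ` {..degree f} \<subseteq> polys_in N" using polys_in_finite[of "coeff f ` {..degree f}"] by blast
  then have N: "coeff f j \<in> polys_in N" for j
    using subring_setD(2)[OF polys_in_subring] by (cases "j \<le> degree f") (auto simp: coeff_eq_0)
  \<comment> \<open>Quadrature of size M is exact up to degree 2 M - 2, which covers the moments up to N that
    occur in f.\<close>
  define M where "M = N + 2"
  obtain g :: "nat \<Rightarrow> trace_poly" where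
    gs: "\<forall>j<Suc (Suc M). degree (g j) = j \<and> g j \<noteq> 0 \<and> (\<forall>i<j. Tr (g j * g i) = 0)"
    using orthogonal_trace_polys[of "Suc (Suc M)"] ..
  have g: "degree (g j) = j" "g j \<noteq> 0" if "j \<le> Suc M" for j using gs that by simp_all
  have go: "Tr (g j * g i) = 0" if "i < j" "j \<le> Suc M" for i j using gs that by simp
  define G where "G = insert f ((\<lambda>j. [:lead_coeff (g j):]) ` {..Suc M} \<union> (\<lambda>j. [:Tr ((g j)\<^sup>2):]) ` {..Suc M})"
  have "finite G" by (simp add: G_def)
  from real_point_with_model_signs[OF this] obtain a c where
    sg: "\<And>h. h \<in> G \<Longrightarrow> same_sign (model_embedding h) (eval_at a c h)" by blast
  have fneg: "eval_at a c f < 0" using sg[of f] f(2) by (simp add: G_def same_sign_def)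
  have lead: "evalT a (lead_coeff (g j)) \<noteq> 0" if "j \<le> Suc M" for j
  proof -
    have "model_embedding [:lead_coeff (g j):] \<noteq> 0"
      using model_embedding_eq_0[of "[:lead_coeff (g j):]"] g(2)[OF that] by auto
    moreover have "same_sign (model_embedding [:lead_coeff (g j):]) (evalT a (lead_coeff (g j)))"
      using sg[of "[:lead_coeff (g j):]"] that by (simp add: G_def)
    ultimately show ?thesis using same_sign_eq_0 by blast
  qed
  have pos: "0 < evalT a (Tr ((g j)\<^sup>2))" if "j \<le> Suc M" for j
  proof -
    have "model_embedding [:Tr ((g j)\<^sup>2):] \<noteq> 0"
      using model_embedding_eq_0[of "[:Tr ((g j)\<^sup>2):]"] Tr_square_nonzero[OF g(2)[OF that]] by auto
    then have "0 < model_embedding [:Tr ((g j)\<^sup>2):]"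
      using model_embedding_Q0_nonneg[OF Q0_Tr_square, of "g j"] by simp
    moreover have "same_sign (model_embedding [:Tr ((g j)\<^sup>2):]) (evalT a (Tr ((g j)\<^sup>2)))"
      using sg[of "[:Tr ((g j)\<^sup>2):]"] that by (simp add: G_def)
    ultimately show ?thesis by (simp add: same_sign_def)
  qed
  define e where "e j = map_poly (evalT a) (g j)" for j
  define \<mu> where "\<mu> j = evalT a (Tr_sym j)" for j
  have prod: "moment_functional \<mu> (e i * e j) = evalT a (Tr (g i * g j))" for i j
    unfolding evalT_Tr evalT_poly.hom_mult e_def \<mu>_def ..
  obtain S w where S: "finite S" "c \<in> S" "\<And>r. r \<in> S \<Longrightarrow> 0 < w r"
    and quad: "\<And>p. degree p \<le> 2 * M - 2 \<Longrightarrow> moment_functional \<mu> p = (\<Sum>r\<in>S. w r * poly p r)"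
  proof (rule quadrature_with_node[of M e \<mu> c])
    show "degree (e i) = i" if "i \<le> Suc M" for i
      unfolding e_def using hom_degree_eq(1)[OF evalT_hom lead[OF that]] g(1)[OF that] by simp
    show "e i \<noteq> 0" if "i \<le> Suc M" for i
      unfolding e_def using hom_degree_eq(2)[OF evalT_hom lead[OF that]] lead[OF that] by (metis leading_coeff_0_iff)
    show "moment_functional \<mu> (e j * e i) = 0" if "i < j" "j \<le> Suc M" for i j
      unfolding prod go[OF that] by simp
    show "0 < moment_functional \<mu> (e i * e i)" if "i \<le> Suc M" for i
      unfolding prod using pos[OF that] by (simp add: power2_eq_square)
    show "1 \<le> M" by (simp add: M_def)
  qed (rule that)
  have mom: "\<mu> j = (\<Sum>r\<in>S. w r * r ^ j)" if "j \<le> N + 1" for j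
    using quad[of "monom 1 j"] that by (simp add: moment_functional_monom degree_monom_eq poly_monom M_def)
  have "sum w S = 1" using mom[of 0] by (simp add: \<mu>_def evalT_Tr_sym)
  then have pw: "prob_weights S w" using S by (simp add: prob_weights_def)
  have "moments S w i = a i" if "i < N" for i
    using mom[of "Suc i"] that by (simp add: moments_def \<mu>_def evalT_Tr_sym)
  then have "evalT (moments S w) (coeff f j) = evalT a (coeff f j)" for j
    by (intro evalT_cong[OF N])
  then have "eval_at (moments S w) c f = eval_at a c f" by (simp add: eval_at_eq)
  then show False using f(1) pw S(2) fneg unfolding nonneg_on_measures_def by (metis not_less)
qed

theorem corollary3p8:
  fixes f :: trace_poly
  shows "(\<forall>n\<ge>1. \<forall>X\<in>symmetric_mats n. psd n (eval_trace_poly f X)) \<longleftrightarrow>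
         (\<exists>r\<in>Q0. \<exists>q\<in>Q0. q \<noteq> 0 \<and> Fraction_Field.Fract f 1 = Fraction_Field.Fract r q)"
proof -
  have "(\<exists>r\<in>Q0. \<exists>q\<in>Q0. q \<noteq> 0 \<and> Fract f 1 = Fract r q) \<longleftrightarrow> Fract f 1 \<in> quotient_cone"
    unfolding quotient_cone_def by blast
  also have "\<dots> \<longleftrightarrow> nonneg_on_measures f"
    using quotient_cone_nonneg no_counterexample[of f] unfolding counterexample_def by blast
  also have "\<dots> \<longleftrightarrow> (\<forall>n\<ge>1. \<forall>X\<in>symmetric_mats n. psd n (eval_trace_poly f X))"
    using nonneg_on_measures_if_psd psd_if_nonneg_on_measures by blast
  finally show ?thesis by (rule sym)
qed

end
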